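(* Let $\tau:\Sigma\times\mathbb Z^d\to\Sigma\times\mathbb Z^d$ be a twisted skew product with twisting matrix $A$, height function $h$, and base shift $(\Sigma,\sigma)$ a transitive subshift of finite type. The following are equivalent: (a) $\tau$ is totally transitive; (b) $\rho(A)=1$, $\tau$ has the total ftp, and $0\in\mathrm{Int}\big(\mathrm{rot}_F(\tau^{N(A)})\big)$; (c) $\tau$ has the total ftp and its periodic points are dense in $\Sigma\times\mathbb Z^d$; (d) $\tau$ is topologically mixing.
   Context: Countable state Markov shift: a countable set $S$ of states and a $\{0,1\}$-matrix $C=(C_{ij})_{i,j\in S}$ with finite row and column sums; $\Sigma=\{s\in S^{\mathbb Z}:C_{s_is_{i+1}}=1\ \forall i\}$ with the product of discrete topologies, $\sigma$ the left shift. If $S$ is finite it is a subshift of finite type. Twisted skew product: given $(\Sigma,\sigma)$, a finitely generated abelian group $G$ (discrete), a height function $h:\Sigma\to G$ with $h(s)$ depending only on $(s_0,s_1)$, and an automorphism $\Psi$ of $G$ (twisting automorphism; for $G=\mathbb Z^d$ given by an integer matrix $A$ of determinant $\pm1$, the twisting matrix), $\tau(s,g)=(\sigma(s),\Psi(g)+h(s))$. It is untwisted if $\Psi=\mathrm{id}$. Iterates $\tau^k$ ($k>0$) have the same form with twisting $\Psi^k$. For a subgroup $\Gamma$ with $\Psi(\Gamma)=\Gamma$, the quotient is $\tau_\Gamma(s,g+\Gamma)=(\sigma(s),\Psi(g)+h(s)+\Gamma)$ on $\Sigma\times G/\Gamma$. A homeomorphism is transitive if for all nonempty open $U,V$ some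 $n\in\mathbb Z$ has $g^n(U)\cap V\ne\emptyset$; totally transitive if all positive iterates are transitive; topologically mixing if $g^n(U)\cap V\ne\emptyset$ for all large $n$. ftp: for $G=\mathbb Z^d$, $\tau$ has the finite transitivity property (ftp) if $\tau_\Gamma$ is transitive for every $\Psi$-invariant subgroup $\Gamma\subset\mathbb Z^d$ of finite index; it has the total ftp if $\tau^k$ has the ftp for all $k>0$. Pure subgroup: $\Gamma\subset\mathbb Z^d$ with $\mathbb Z^d/\Gamma$ torsion-free; purification $P(X)$ = smallest pure subgroup containing $X$. Fried quotient: $\tau_F$ with $F=P(\mathrm{im}(\Psi-\mathrm{id}))$; it is untwisted with group $\mathbb Z^d/F\cong\mathbb Z^k$. For an untwisted skew product with group $\mathbb Z^k$: $h(s,n)=\sum_{i=0}^{n-1}h(\sigma^is)$, the rotation vector is $\mathrm{rot}(s)=\lim_{n\to\infty}h(s,n)/n\in\mathbb R^k$ when it exists, and $\mathrm{rot}(\tau)$ is the set of all rotation vectors. $\mathrm{rot}_F(\tau)=\mathrm{rot}(\tau_F)\subset\mathbb R^k$ (empty if $k=0$); interior is in $\mathbb R^k$. $\rho(A)$ is the spectral radius; if $\rho(A)=1$, $N(A)$ is the least positive integer with $\mathrm{spec}(A^{N(A)})=\{1\}$. *)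

theory Defs
  imports "HOL-Analysis.Analysis"
begin

text \<open>States form a finite type 'a; C is the 0-1 transition matrix (as a relation).\<close>
definition SFT :: "('a \<Rightarrow> 'a \<Rightarrow> bool) \<Rightarrow> (int \<Rightarrow> 'a) set" where
  "SFT C = {s. \<forall>i. C (s i) (s (i + 1))}"

definition shift :: "(int \<Rightarrow> 'a) \<Rightarrow> (int \<Rightarrow> 'a)" where
  "shift s = (\<lambda>i. s (i + 1))"

definition SFT_top :: "('a \<Rightarrow> 'a \<Rightarrow> bool) \<Rightarrow> (int \<Rightarrow> 'a) topology" where
  "SFT_top C = subtopology (product_topology (\<lambda>i. discrete_topology UNIV) UNIV) (SFT C)"

text \<open>g^n(U) \<inter> V \<noteq> {} for some integer n; for negative n = -m this is U \<inter> g^m(V) \<noteq> {}.\<close>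
definition top_transitive :: "'x topology \<Rightarrow> ('x \<Rightarrow> 'x) \<Rightarrow> bool" where
  "top_transitive T g \<longleftrightarrow>
     (\<forall>U V. openin T U \<and> openin T V \<and> U \<noteq> {} \<and> V \<noteq> {} \<longrightarrow>
        (\<exists>n::nat. (g ^^ n) ` U \<inter> V \<noteq> {} \<or> U \<inter> (g ^^ n) ` V \<noteq> {}))"

definition totally_transitive :: "'x topology \<Rightarrow> ('x \<Rightarrow> 'x) \<Rightarrow> bool" where
  "totally_transitive T g \<longleftrightarrow> (\<forall>k>0. top_transitive T (g ^^ k))"

definition top_mixing :: "'x topology \<Rightarrow> ('x \<Rightarrow> 'x) \<Rightarrow> bool" where
  "top_mixing T g \<longleftrightarrow>
     (\<forall>U V. openin T U \<and> openin T V \<and> U \<noteq> {} \<and> V \<noteq> {} \<longrightarrow>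
        (\<exists>N. \<forall>n\<ge>N. (g ^^ n) ` U \<inter> V \<noteq> {}))"

definition periodic_points :: "'x topology \<Rightarrow> ('x \<Rightarrow> 'x) \<Rightarrow> 'x set" where
  "periodic_points T g = {x \<in> topspace T. \<exists>n>0. (g ^^ n) x = x}"

definition dense_periodic :: "'x topology \<Rightarrow> ('x \<Rightarrow> 'x) \<Rightarrow> bool" where
  "dense_periodic T g \<longleftrightarrow> T closure_of periodic_points T g = topspace T"

definition mpow :: "'b::comm_ring_1^'d^'d \<Rightarrow> nat \<Rightarrow> 'b^'d^'d" where
  "mpow A k = ((\<lambda>M. A ** M) ^^ k) (mat 1)"

definition cmat :: "int^'d^'d \<Rightarrow> complex^'d^'d" where
  "cmat A = (\<chi> i j. of_int (A $ i $ j))"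

definition cspec :: "int^'d^'d \<Rightarrow> complex set" where
  "cspec A = {\<mu>. \<exists>v::complex^'d. v \<noteq> 0 \<and> cmat A *v v = \<mu> *s v}"

definition spec_radius :: "int^'d^'d \<Rightarrow> real" where
  "spec_radius A = Max (norm ` cspec A)"

definition NA :: "int^'d^'d \<Rightarrow> nat" where
  "NA A = (LEAST n. n > 0 \<and> cspec (mpow A n) = {1})"

definition subgrp :: "(int^'d) set \<Rightarrow> bool" where
  "subgrp \<Gamma> \<longleftrightarrow> 0 \<in> \<Gamma> \<and> (\<forall>x\<in>\<Gamma>. \<forall>y\<in>\<Gamma>. x + y \<in> \<Gamma> \<and> - x \<in> \<Gamma>)"

definition cosets :: "(int^'d) set \<Rightarrow> (int^'d) set set" where
  "cosets \<Gamma> = range (\<lambda>x. (\<lambda>y. x + y) ` \<Gamma>)"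

definition finite_index :: "(int^'d) set \<Rightarrow> bool" where
  "finite_index \<Gamma> \<longleftrightarrow> finite (cosets \<Gamma>)"

definition invariant :: "int^'d^'d \<Rightarrow> (int^'d) set \<Rightarrow> bool" where
  "invariant B \<Gamma> \<longleftrightarrow> (\<lambda>x. B *v x) ` \<Gamma> = \<Gamma>"

definition pure :: "(int^'d) set \<Rightarrow> bool" where
  "pure \<Gamma> \<longleftrightarrow> subgrp \<Gamma> \<and> (\<forall>x (n::int). n \<noteq> 0 \<and> of_int n * x \<in> \<Gamma> \<longrightarrow> x \<in> \<Gamma>)"

definition purification :: "(int^'d) set \<Rightarrow> (int^'d) set" where
  "purification X = \<Inter> {\<Gamma>. pure \<Gamma> \<and> X \<subseteq> \<Gamma>}"

definition fried :: "int^'d^'d \<Rightarrow> (int^'d) set" where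
  "fried B = purification (range (\<lambda>x. B *v x - x))"

definition skew :: "int^'d^'d \<Rightarrow> ('a \<Rightarrow> 'a \<Rightarrow> int^'d) \<Rightarrow> (int \<Rightarrow> 'a) \<times> (int^'d) \<Rightarrow> (int \<Rightarrow> 'a) \<times> (int^'d)"
  where "skew A h = (\<lambda>(s, g). (shift s, A *v g + h (s 0) (s 1)))"

definition skew_top :: "('a \<Rightarrow> 'a \<Rightarrow> bool) \<Rightarrow> ((int \<Rightarrow> 'a) \<times> (int^'d)) topology" where
  "skew_top C = prod_topology (SFT_top C) (discrete_topology UNIV)"

text \<open>Map induced on \<Sigma> \<times> Z^d/\<Gamma> by a map f of the form (s,g) \<mapsto> (\<sigma>^k s, B g + h'(s)),
  cosets being represented as sets.\<close>
definition quot_map :: "((int \<Rightarrow> 'a) \<times> (int^'d) \<Rightarrow> (int \<Rightarrow> 'a) \<times> (int^'d))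
    \<Rightarrow> (int \<Rightarrow> 'a) \<times> (int^'d) set \<Rightarrow> (int \<Rightarrow> 'a) \<times> (int^'d) set" where
  "quot_map f = (\<lambda>(s, c). (fst (f (s, 0)), (\<lambda>x. snd (f (s, x))) ` c))"

definition quot_top :: "('a \<Rightarrow> 'a \<Rightarrow> bool) \<Rightarrow> (int^'d) set \<Rightarrow> ((int \<Rightarrow> 'a) \<times> (int^'d) set) topology" where
  "quot_top C \<Gamma> = prod_topology (SFT_top C) (discrete_topology (cosets \<Gamma>))"

definition ftp :: "('a \<Rightarrow> 'a \<Rightarrow> bool) \<Rightarrow> int^'d^'d \<Rightarrow> ((int \<Rightarrow> 'a) \<times> (int^'d) \<Rightarrow> (int \<Rightarrow> 'a) \<times> (int^'d)) \<Rightarrow> bool" where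
  "ftp C B f \<longleftrightarrow> (\<forall>\<Gamma>. subgrp \<Gamma> \<and> finite_index \<Gamma> \<and> invariant B \<Gamma> \<longrightarrow>
      top_transitive (quot_top C \<Gamma>) (quot_map f))"

definition total_ftp :: "('a \<Rightarrow> 'a \<Rightarrow> bool) \<Rightarrow> int^'d^'d \<Rightarrow> ('a \<Rightarrow> 'a \<Rightarrow> int^'d) \<Rightarrow> bool" where
  "total_ftp C A h \<longleftrightarrow> (\<forall>k>0. ftp C (mpow A k) (skew A h ^^ k))"

text \<open>Height of the iterate \<tau>^N: \<tau>^N(s,g) = (\<sigma>^N s, A^N g + h_N(s)).\<close>
definition iter_height :: "int^'d^'d \<Rightarrow> ('a \<Rightarrow> 'a \<Rightarrow> int^'d) \<Rightarrow> nat \<Rightarrow> (int \<Rightarrow> 'a) \<Rightarrow> int^'d" where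
  "iter_height A h N s = snd ((skew A h ^^ N) (s, 0))"

text \<open>Birkhoff sums of the height of the (untwisted) Fried quotient of \<tau>^N, lifted to Z^d
  (representatives of the classes modulo F), embedded in R^d.\<close>
definition fried_sum :: "int^'d^'d \<Rightarrow> ('a \<Rightarrow> 'a \<Rightarrow> int^'d) \<Rightarrow> nat \<Rightarrow> (int \<Rightarrow> 'a) \<Rightarrow> nat \<Rightarrow> real^'d" where
  "fried_sum A h N s n = (\<chi> j. of_int ((\<Sum>i<n. iter_height A h N ((shift ^^ (N * i)) s)) $ j))"

text \<open>The real span V of F (F pure, so (Z^d/F) \<otimes> R = R^d / V).\<close>
definition fried_space :: "int^'d^'d \<Rightarrow> (real^'d) set" where
  "fried_space B = span ((\<lambda>x. \<chi> j. of_int (x $ j)) ` fried B)"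

text \<open>Preimage in R^d of the rotation set rot_F(\<tau>^N) \<subseteq> R^d/V: v + V is the rotation
  vector of s iff h_F(s,n)/n \<rightarrow> v + V in the quotient norm, i.e. the distance from
  h(s,n)/n - v to V tends to 0.\<close>
definition rot_F_lift :: "('a \<Rightarrow> 'a \<Rightarrow> bool) \<Rightarrow> int^'d^'d \<Rightarrow> ('a \<Rightarrow> 'a \<Rightarrow> int^'d) \<Rightarrow> nat \<Rightarrow> (real^'d) set" where
  "rot_F_lift C A h N = {v. \<exists>s\<in>SFT C.
      ((\<lambda>n. infdist ((1 / real n) *\<^sub>R fried_sum A h N s n - v) (fried_space (mpow A N))) \<longlongrightarrow> 0) sequentially}"

end

theory Submission
  imports Defs "Jordan_Normal_Form.Schur_Decomposition"
begin

text \<open>The skew product over a subshift of finite type is itself a countable Markov shift, whose graph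
  has the pairs (state, lattice vector) as vertices. Total transitivity, mixing and density of periodic points
  become statements about walks in this graph: each of the first two says that any two vertices
  are joined by walks whose lengths are multiples of any given number, and density of periodic points says that
  every walk can be closed up.

  A left eigenvector of \<open>A\<close> for an eigenvalue of modulus greater than \<open>1\<close> would grow along walks, so
  in each case the spectrum lies in the unit circle. It then consists of roots of unity (the
  traces of the powers of \<open>A\<close> are integers that come arbitrarily close to the dimension), and
  \<open>B = A\<^sup>N\<close> is unipotent for \<open>N = N(A)\<close>. The heights of the loops at a vertex then form a
  semigroup twisted by \<open>B\<close>. The finite transitivity property controls it modulo every integer.
  Filter the lattice by the annihilators of the functionals killed by powers of \<open>B\<^sup>T - 1\<close>
  and add one functional \<open>c\<close> at a time: all heights are attained as soon as \<open>c\<close> takes both signs on the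
  loops in the kernel of the previous functionals. For \<open>B\<close>-invariant functionals this follows
  from the rotation set (or from periodic points); for the others from commutators of
  loops, on which \<open>c\<close> grows quadratically as in the Heisenberg group.\<close>

text \<open>Heights of loops form only a semigroup, so subtraction is never available. What replaces
  it is information modulo every integer. Suppose a target is reached up to an error in
  \<open>K\<close> and the error has to be pushed into the kernel of a further functional
  \<open>c\<close>. Loops in \<open>K\<close> with \<open>c\<close>-values \<open>a > 0\<close> and
  \<open>-b < 0\<close> produce by repetition \<open>r a b y\<close> for every \<open>y\<close> in
  \<open>K\<close>, up to \<open>r\<close> times the kernel; hence reaching the target modulo
  \<open>r a b\<close> in \<open>K\<close> gives it modulo \<open>r\<close> in the kernel. Losing
  the factor \<open>a b\<close> is harmless exactly because all moduli are carried through the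
  induction (\<open>reach\<close>). Divisibility of the lengths is carried along for a similar
  reason: at suitable lengths the power of \<open>B\<close> is the identity modulo \<open>r\<close>,
  so concatenation becomes addition modulo \<open>r\<close>. The rotation set enters through a
  greedy choice of loops that decreases a quadratic potential. The same steering, run against a
  prescribed vector, shows in the converse direction that every small vector is a rotation
  vector.\<close>

no_notation Matrix.vec_index (infixl \<open>$\<close> 100)
no_notation Matrix.scalar_prod (infix \<open>\<bullet>\<close> 70)
hide_const (open) Matrix.mat Matrix.vec Matrix.row Determinant.det VectorSpace.subspace
hide_fact (open) Matrix.mat_def Matrix.vec_eq_iff

section \<open>Recurrence of rotations of a torus\<close>

text \<open>By compactness two vectors of powers are close to each other; dividing by the earlier
  one, whose entries have modulus 1, makes the difference of the exponents a near-return time for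
  all coordinates at once.\<close>

lemma simultaneous_return:
  fixes z :: "'d::finite \<Rightarrow> complex"
  assumes z: "\<And>i. norm (z i) = 1" and "\<epsilon> > 0"
  shows "\<exists>k>0. \<forall>i. norm (z i ^ k - 1) < \<epsilon>"
proof -
  define x :: "nat \<Rightarrow> complex^'d" where "x k = (\<chi> i. z i ^ k)" for k
  have "norm (x k) \<le> of_nat CARD('d)" for k
  proof -
    have "norm (x k) \<le> (\<Sum>i\<in>UNIV. norm (x k $ i))" unfolding norm_vec_def by (rule L2_set_le_sum) auto
    also have "\<dots> = of_nat CARD('d)" by (simp add: x_def norm_power z)
    finally show ?thesis .
  qed
  then have "bounded (range x)" by (auto simp: bounded_iff)
  then obtain l r where r: "strict_mono (r :: nat \<Rightarrow> nat)" and lim: "(x \<circ> r) \<longlonglongrightarrow> l"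
    using bounded_imp_convergent_subsequence by blast
  from lim have "Cauchy (x \<circ> r)" by (rule LIMSEQ_imp_Cauchy)
  then obtain M where M: "\<And>m n. m \<ge> M \<Longrightarrow> n \<ge> M \<Longrightarrow> dist (x (r m)) (x (r n)) < \<epsilon>"
    using \<open>\<epsilon> > 0\<close> unfolding Cauchy_def by fastforce
  define a b where "a = r M" and "b = r (Suc M)"
  have ab: "a < b" using r by (auto simp: a_def b_def strict_mono_def)
  have "norm (z i ^ (b - a) - 1) < \<epsilon>" for i
  proof -
    have "norm (z i ^ (b - a) - 1) = norm (z i ^ a) * norm (z i ^ (b - a) - 1)" by (simp add: norm_power z)
    also have "\<dots> = norm (z i ^ b - z i ^ a)"
      using ab by (simp add: norm_mult[symmetric] right_diff_distrib power_add[symmetric])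
    also have "\<dots> = norm ((x b - x a) $ i)" by (simp add: x_def)
    also have "\<dots> \<le> dist (x b) (x a)" unfolding dist_norm by (rule Finite_Cartesian_Product.norm_nth_le)
    also have "\<dots> < \<epsilon>" unfolding a_def b_def by (rule M) auto
    finally show ?thesis .
  qed
  then show ?thesis using ab by (intro exI[of _ "b - a"]) auto
qed

subsection \<open>Triangular matrices\<close>

definition mtrace :: "'a::comm_monoid_add mat \<Rightarrow> 'a" where
  "mtrace M = (\<Sum>i<dim_row M. M $$ (i, i))"

lemma mtrace_mult_commute:
  fixes X Y :: "'a::comm_semiring_1 mat"
  assumes "X \<in> carrier_mat n n" "Y \<in> carrier_mat n n"
  shows "mtrace (X * Y) = mtrace (Y * X)"
proof -
  have [simp]: "dim_row X = n" "dim_col X = n" "dim_row Y = n" "dim_col Y = n"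
    using assms by auto
  have "mtrace (X * Y) = (\<Sum>i<n. \<Sum>j<n. X $$ (i, j) * Y $$ (j, i))"
    by (simp add: mtrace_def scalar_prod_def atLeast0LessThan)
  also have "\<dots> = (\<Sum>j<n. \<Sum>i<n. X $$ (i, j) * Y $$ (j, i))" by (rule sum.swap)
  also have "\<dots> = mtrace (Y * X)"
    by (simp add: mtrace_def scalar_prod_def atLeast0LessThan mult.commute)
  finally show ?thesis .
qed

lemma mtrace_similar:
  fixes X :: "'a::comm_ring_1 mat"
  assumes "similar_mat_wit X Y P Q" shows "mtrace X = mtrace Y"
proof -
  define n where "n = dim_row X"
  note * = similar_mat_witD[OF n_def assms]
  have "mtrace X = mtrace (Q * (P * Y))"
    unfolding *(3) by (rule mtrace_mult_commute[of _ n]) (use * in auto)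
  also have "Q * (P * Y) = (Q * P) * Y" by (rule assoc_mult_mat[symmetric, of _ n n _ n _ n]) (use * in auto)
  also have "\<dots> = Y" using * by simp
  finally show ?thesis .
qed

lemma mult_upper_triangular:
  fixes X Y :: "'a::comm_ring_1 mat"
  assumes "X \<in> carrier_mat n n" "Y \<in> carrier_mat n n" "upper_triangular X" "upper_triangular Y"
  shows "upper_triangular (X * Y)" "i < n \<Longrightarrow> (X * Y) $$ (i, i) = X $$ (i, i) * Y $$ (i, i)"
proof -
  have [simp]: "dim_row X = n" "dim_col X = n" "dim_row Y = n" "dim_col Y = n" using assms by auto
  have e: "(X * Y) $$ (i, j) = (\<Sum>k<n. X $$ (i, k) * Y $$ (k, j))" if "i < n" "j < n" for i j
    using that by (simp add: scalar_prod_def atLeast0LessThan)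
  have z: "X $$ (i, k) * Y $$ (k, j) = 0" if "i < n" "j < n" "k < n" "k < i \<or> j < k" for i j k
    using that assms(3,4) by (auto simp: upper_triangular_def)
  show "upper_triangular (X * Y)"
  proof (rule upper_triangularI)
    fix i j assume "i < dim_row (X * Y)" "j < i"
    then have ij: "i < n" "j < n" by auto
    show "(X * Y) $$ (i, j) = 0" unfolding e[OF ij]
      by (rule sum.neutral) (use z ij \<open>j < i\<close> in \<open>metis lessThan_iff not_less_iff_gr_or_eq less_trans\<close>)
  qed
  show "(X * Y) $$ (i, i) = X $$ (i, i) * Y $$ (i, i)" if i: "i < n"
  proof -
    have "(X * Y) $$ (i, i) = (\<Sum>k\<in>{i}. X $$ (i, k) * Y $$ (k, i))" unfolding e[OF i i]
      by (rule sum.mono_neutral_right) (use i z in \<open>auto simp: neq_iff\<close>)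
    then show ?thesis by simp
  qed
qed

lemma pow_upper_triangular:
  fixes T :: "'a::comm_ring_1 mat"
  assumes "T \<in> carrier_mat n n" "upper_triangular T"
  shows "upper_triangular (T ^\<^sub>m k) \<and> (\<forall>i<n. (T ^\<^sub>m k) $$ (i, i) = T $$ (i, i) ^ k)"
proof (induction k)
  case 0 then show ?case using assms by auto
next
  case (Suc k)
  have "T ^\<^sub>m k \<in> carrier_mat n n" using assms by auto
  from mult_upper_triangular[OF this assms(1) _ assms(2)] Suc show ?case by (auto simp: mult.commute)
qed

text \<open>Each factor moves the nonzero entries one more superdiagonal away from the
  diagonal.\<close>

lemma strict_upper_triangular_nilpotent:
  fixes T :: "'a::comm_ring_1 mat"
  assumes T: "T \<in> carrier_mat n n" and "\<And>i j. i < n \<Longrightarrow> j \<le> i \<Longrightarrow> T $$ (i, j) = 0"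
  shows "T ^\<^sub>m n = 0\<^sub>m n n"
proof -
  have "\<forall>i<n. \<forall>j<n. j < i + k \<longrightarrow> (T ^\<^sub>m k) $$ (i, j) = 0" for k
  proof (induction k)
    case 0 then show ?case using T by auto
  next
    case (Suc k)
    have [simp]: "T ^\<^sub>m k \<in> carrier_mat n n" "dim_row (T ^\<^sub>m k) = n" "dim_col (T ^\<^sub>m k) = n" "dim_row T = n" "dim_col T = n"
      using T by (auto intro: pow_carrier_mat)
    show ?case
    proof (intro allI impI)
      fix i j assume ij: "i < n" "j < n" "j < i + Suc k"
      have "(T ^\<^sub>m Suc k) $$ (i, j) = (\<Sum>l<n. (T ^\<^sub>m k) $$ (i, l) * T $$ (l, j))"
        using ij by (simp add: scalar_prod_def atLeast0LessThan)
      also have "\<dots> = 0"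
      proof (rule sum.neutral, intro ballI)
        fix l assume "l \<in> {..<n}"
        then show "(T ^\<^sub>m k) $$ (i, l) * T $$ (l, j) = 0"
          using Suc.IH assms(2)[of l j] ij by (cases "l < i + k") auto
      qed
      finally show "(T ^\<^sub>m Suc k) $$ (i, j) = 0" .
    qed
  qed
  from this[of n] show ?thesis using T by (intro eq_matI) (auto simp: pow_carrier_mat)
qed

text \<open>With the eigenvalues on the diagonal of \<open>T\<close>, determinants and traces of
  powers can be read off with multiplicities.\<close>

lemma triangular_form:
  fixes M :: "complex mat"
  assumes M: "M \<in> carrier_mat n n"
  obtains T P Q where "similar_mat_wit M T P Q" "T \<in> carrier_mat n n" "upper_triangular T"
    "\<And>\<mu>. eigenvalue M \<mu> \<longleftrightarrow> (\<exists>i<n. \<mu> = T $$ (i, i))"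
proof -
  obtain es where es: "char_poly M = (\<Prod>a\<leftarrow>es. [:- a, 1:])" using char_poly_factorized[OF M] by blast
  from schur_decomposition_exists[OF M es] obtain T where
    T: "T \<in> carrier_mat n n" "upper_triangular T" "similar_mat M T" by blast
  then obtain P Q where PQ: "similar_mat_wit M T P Q" unfolding similar_mat_def by blast
  have "char_poly M = (\<Prod>a\<leftarrow>diag_mat T. [:- a, 1:])"
    using char_poly_similar[OF T(3)] char_poly_upper_triangular[OF T(1,2)] by simp
  then have "eigenvalue M \<mu> \<longleftrightarrow> (\<exists>i<n. \<mu> = T $$ (i, i))" for \<mu>
    unfolding eigenvalue_root_char_poly[OF M] using T(1)
    by (auto simp: poly_prod_list prod_list_zero_iff diag_mat_def)
  with PQ T show ?thesis using that by blast
qed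

subsection \<open>Transfer from finite Cartesian powers\<close>

text \<open>Schur triangularisation and characteristic polynomials live on matrices indexed by an
  initial segment of the naturals; the enumeration \<open>e\<close> of the index type carries the
  matrices of the problem there.\<close>

locale index_bij =
  fixes e :: "nat \<Rightarrow> 'd::finite" and n :: nat
  assumes e: "bij_betw e {..<n} UNIV"
begin

definition tomat :: "'b^'d^'d \<Rightarrow> 'b mat" where
  "tomat M = Matrix.mat n n (\<lambda>(i, j). M $ e i $ e j)"

definition tovec :: "'b^'d \<Rightarrow> 'b Matrix.vec" where
  "tovec v = Matrix.vec n (\<lambda>i. v $ e i)"

lemma sum_e: "(\<Sum>i<n. f (e i)) = (\<Sum>x\<in>UNIV. f x)"
  by (rule sum.reindex_bij_betw[OF e])

lemma e_inject: "i < n \<Longrightarrow> j < n \<Longrightarrow> e i = e j \<longleftrightarrow> i = j"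
  using e by (auto simp: bij_betw_def inj_on_def)

lemma e_surj: obtains i where "i < n" "e i = x"
  using e by (metis UNIV_I bij_betw_imp_surj_on imageE lessThan_iff)

lemma tomat_carrier[simp]: "tomat M \<in> carrier_mat n n" by (simp add: tomat_def)
lemma tomat_dim[simp]: "dim_row (tomat M) = n" "dim_col (tomat M) = n" by (simp_all add: tomat_def)
lemma tovec_carrier[simp]: "tovec M \<in> carrier_vec n" by (simp add: tovec_def)

lemma tomat_inject: "tomat M = tomat M' \<longleftrightarrow> M = M'"
proof
  assume eq: "tomat M = tomat M'"
  show "M = M'"
  proof (unfold vec_eq_iff, intro allI)
    fix x y
    obtain i j where "i < n" "e i = x" "j < n" "e j = y" using e_surj by metis
    with arg_cong[OF eq, of "\<lambda>M. M $$ (i, j)"] show "M $ x $ y = M' $ x $ y" by (simp add: tomat_def)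
  qed
qed simp

lemma tovec_inject: "tovec v = tovec v' \<longleftrightarrow> v = v'"
proof
  assume eq: "tovec v = tovec v'"
  show "v = v'"
  proof (unfold vec_eq_iff, intro allI)
    fix x
    obtain i where "i < n" "e i = x" using e_surj by metis
    with arg_cong[OF eq, of "\<lambda>v. vec_index v i"] show "v $ x = v' $ x" by (simp add: tovec_def)
  qed
qed simp

lemma tovec_surj: assumes "v \<in> carrier_vec n" obtains w where "v = tovec w"
proof
  show "v = tovec (\<chi> x. vec_index v (inv_into {..<n} e x))"
    using assms e by (intro eq_vecI) (auto simp: tovec_def bij_betw_def inv_into_f_f)
qed

lemma tomat_mult: "tomat (M ** M') = tomat M * tomat (M' :: 'b::comm_ring_1^'d^'d)"
  by (rule eq_matI)
     (auto simp: tomat_def matrix_matrix_mult_def scalar_prod_def atLeast0LessThan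
        sum_e[of "\<lambda>k. M $ _ $ k * M' $ k $ _", symmetric])

lemma tomat_one: "tomat (mat 1 :: 'b::comm_ring_1^'d^'d) = 1\<^sub>m n"
  by (rule eq_matI) (auto simp: tomat_def mat_def e_inject)

lemma tomat_pow: "tomat (mpow M k) = tomat (M :: 'b::comm_ring_1^'d^'d) ^\<^sub>m k"
proof (induction k)
  case (Suc k)
  have "mpow M (Suc k) = M ** mpow M k" by (simp add: mpow_def)
  also have "\<dots> = mpow M k ** M"
    by (induction k) (simp_all add: mpow_def, metis matrix_mul_assoc)
  finally show ?case using Suc by (simp add: tomat_mult)
qed (simp add: mpow_def tomat_one)

lemma tomat_mult_vec: "tomat M *\<^sub>v tovec v = tovec (M *v (v :: 'b::comm_ring_1^'d))"
  by (rule eq_vecI)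
     (auto simp: tomat_def tovec_def matrix_vector_mult_def scalar_prod_def atLeast0LessThan
        sum_e[of "\<lambda>k. M $ _ $ k * v $ k", symmetric])

lemma tomat_cmat: "tomat (cmat A) = map_mat of_int (tomat A)"
  by (rule eq_matI) (auto simp: tomat_def cmat_def)

lemma eigenvalue_tomat: "eigenvalue (tomat (cmat A)) \<mu> \<longleftrightarrow> \<mu> \<in> cspec A"
proof -
  have sm: "tovec (\<mu> *s v) = \<mu> \<cdot>\<^sub>v tovec v" for v :: "complex^'d"
    by (rule eq_vecI) (auto simp: tovec_def)
  have z: "tovec (0 :: complex^'d) = 0\<^sub>v n" by (rule eq_vecI) (auto simp: tovec_def)
  have "eigenvector (tomat (cmat A)) (tovec v) \<mu> \<longleftrightarrow> v \<noteq> 0 \<and> cmat A *v v = \<mu> *s v" for v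
    unfolding eigenvector_def tomat_mult_vec sm[symmetric] tovec_inject
    by (simp add: z[symmetric] tovec_inject)
  moreover have "eigenvector (tomat (cmat A)) w \<mu> \<Longrightarrow> \<exists>v. w = tovec v" for w
    unfolding eigenvector_def using tovec_surj[of w] by auto
  ultimately show ?thesis unfolding eigenvalue_def cspec_def by blast
qed

end

lemma ex_index_bij: "\<exists>(e :: nat \<Rightarrow> 'd::finite). index_bij e CARD('d)"
proof -
  obtain e :: "nat \<Rightarrow> 'd" where "bij_betw e {0..<CARD('d)} UNIV"
    using ex_bij_betw_nat_finite[of "UNIV :: 'd set"] by auto
  then show ?thesis by (auto simp: index_bij_def atLeast0LessThan intro!: exI[of _ e])
qed

section \<open>Spectra of integer matrices\<close>

lemma cmat_mult: "cmat (A ** B) = cmat A ** cmat B"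
  by (simp add: cmat_def matrix_matrix_mult_def vec_eq_iff)

lemma cmat_one: "cmat (mat 1) = mat 1"
  by (simp add: cmat_def mat_def vec_eq_iff)

lemma cmat_mpow: "cmat (mpow A k) = mpow (cmat A) k"
  by (induction k) (simp_all add: mpow_def cmat_mult cmat_one)

lemma cspec_finite_nonempty: "finite (cspec A)" "cspec A \<noteq> {}"
proof -
  obtain e where "index_bij (e :: nat \<Rightarrow> 'a) CARD('a)" using ex_index_bij by blast
  then interpret index_bij e "CARD('a)" .
  obtain T P Q where T: "similar_mat_wit (tomat (cmat A)) T P Q" "T \<in> carrier_mat CARD('a) CARD('a)" "upper_triangular T"
    "\<And>\<mu>. eigenvalue (tomat (cmat A)) \<mu> \<longleftrightarrow> (\<exists>i<CARD('a). \<mu> = T $$ (i, i))"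
    using triangular_form[OF tomat_carrier] by metis
  have "cspec A = (\<lambda>i. T $$ (i, i)) ` {..<CARD('a)}" using T(4) by (auto simp: eigenvalue_tomat)
  then show "finite (cspec A)" "cspec A \<noteq> {}" by (auto simp: lessThan_empty_iff)
qed

text \<open>In triangular form \<open>B - 1\<close> is strictly upper triangular, hence nilpotent.
  The identity is proved over the complex numbers and descends because \<open>cmat\<close> is
  injective.\<close>

lemma cspec_unipotent:
  fixes B :: "int^'d^'d"
  assumes "cspec B = {1}"
  shows "\<exists>m. \<forall>x. ((\<lambda>u. B *v u - u) ^^ m) x = 0"
proof -
  obtain e where "index_bij (e :: nat \<Rightarrow> 'd) CARD('d)" using ex_index_bij by blast
  then interpret index_bij e "CARD('d)" .
  let ?n = "CARD('d)"
  obtain T P Q where T: "similar_mat_wit (tomat (cmat B)) T P Q" "T \<in> carrier_mat ?n ?n" "upper_triangular T"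
    "\<And>\<mu>. eigenvalue (tomat (cmat B)) \<mu> \<longleftrightarrow> (\<exists>i<?n. \<mu> = T $$ (i, i))"
    using triangular_form[OF tomat_carrier] by metis
  have diag: "T $$ (i, i) = 1" if "i < ?n" for i using T(4) assms that by (auto simp: eigenvalue_tomat)
  have "dim_row (tomat (cmat B)) = ?n" by simp
  note wit = similar_mat_witD[OF this[symmetric] T(1)]
  have TI: "(T - 1\<^sub>m ?n) ^\<^sub>m ?n = 0\<^sub>m ?n ?n"
  proof (rule strict_upper_triangular_nilpotent)
    show "T - 1\<^sub>m ?n \<in> carrier_mat ?n ?n" using T(2) by auto
    fix i j assume "i < ?n" "j \<le> i"
    then show "(T - 1\<^sub>m ?n) $$ (i, j) = 0" using T(2,3) diag by (cases "i = j") (auto simp: upper_triangular_def)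
  qed
  have "tomat (cmat B - mat 1) = tomat (cmat B) - 1\<^sub>m ?n"
    by (subst tomat_one[symmetric], rule eq_matI) (auto simp: tomat_def)
  also have "\<dots> = P * T * Q - P * 1\<^sub>m ?n * Q" using wit by simp
  also have "\<dots> = P * (T - 1\<^sub>m ?n) * Q"
    using wit by (simp add: mult_minus_distrib_mat[of _ ?n ?n _ ?n] minus_mult_distrib_mat[of _ ?n ?n _ _ ?n])
  finally have "similar_mat_wit (tomat (cmat B - mat 1)) (T - 1\<^sub>m ?n) P Q"
    using wit by (intro similar_mat_witI[of _ _ ?n]) auto
  from similar_mat_wit_pow_id[OF this, of ?n] have "tomat (mpow (cmat B - mat 1) ?n) = 0\<^sub>m ?n ?n"
    unfolding tomat_pow using TI wit by simp
  also have "\<dots> = tomat 0" by (rule eq_matI) (auto simp: tomat_def)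
  finally have "mpow (cmat B - mat 1) ?n = 0" by (simp add: tomat_inject)
  moreover have "cmat B - mat 1 = cmat (B - mat 1)" by (simp add: cmat_def mat_def vec_eq_iff)
  ultimately have "cmat (mpow (B - mat 1) ?n) = 0" by (simp add: cmat_mpow)
  then have 0: "mpow (B - mat 1) ?n = 0" by (simp add: cmat_def vec_eq_iff)
  have "((\<lambda>u. B *v u - u) ^^ k) x = mpow (B - mat 1) k *v x" for k x
    by (induction k) (simp_all add: mpow_def matrix_vector_mult_diff_rdistrib matrix_vector_mul_assoc[symmetric])
  then show ?thesis using 0 by (auto intro!: exI[of _ ?n])
qed

text \<open>Kronecker's argument. The determinant is a unit, so the product of the moduli of the
  eigenvalues is 1, and none of them can lie strictly inside the disc. At a near-return time
  \<open>k\<close> of all eigenvalues the trace of the \<open>k\<close>-th power is forced to equal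
  the dimension, and then every \<open>k\<close>-th power of an eigenvalue is 1.\<close>

lemma root_of_unity_spectrum:
  fixes A A' :: "int^'d^'d"
  assumes inv: "A ** A' = mat 1" and le1: "\<And>\<mu>. \<mu> \<in> cspec A \<Longrightarrow> norm \<mu> \<le> 1"
  shows "\<And>\<mu>. \<mu> \<in> cspec A \<Longrightarrow> norm \<mu> = 1" and "\<exists>k>0. cspec (mpow A k) = {1}"
proof -
  obtain e where "index_bij (e :: nat \<Rightarrow> 'd) CARD('d)" using ex_index_bij by blast
  then interpret index_bij e "CARD('d)" .
  let ?n = "CARD('d)"
  let ?M = "tomat (cmat A)"
  obtain T P Q where T: "similar_mat_wit ?M T P Q" "T \<in> carrier_mat ?n ?n" "upper_triangular T"
    "\<And>\<mu>. eigenvalue ?M \<mu> \<longleftrightarrow> (\<exists>i<?n. \<mu> = T $$ (i, i))"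
    using triangular_form[OF tomat_carrier] by metis
  have d_le: "norm (T $$ (i, i)) \<le> 1" if "i < ?n" for i
    using le1[of "T $$ (i, i)"] T(4) that by (auto simp: eigenvalue_tomat)
  have "Determinant.det (tomat A) * Determinant.det (tomat A') = 1"
    using arg_cong[OF inv, of tomat] by (simp add: tomat_mult tomat_one Determinant.det_mult[of _ ?n, symmetric])
  then have "norm (of_int (Determinant.det (tomat A)) :: complex) = 1"
    by (metis norm_one norm_of_int of_int_1 of_int_abs zmult_eq_1_iff abs_1 abs_minus_cancel)
  then have "norm (Determinant.det ?M) = 1" by (simp add: tomat_cmat)
  also have "Determinant.det ?M = Determinant.det T" using T(1) by (intro det_similar) (auto simp: similar_mat_def)
  also have "\<dots> = (\<Prod>i<?n. T $$ (i, i))"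
    using T(2) by (simp add: Determinant.det_upper_triangular[OF T(3,2)] diag_mat_def prod.list_conv_set_nth atLeast0LessThan)
  finally have prod1: "(\<Prod>i<?n. norm (T $$ (i, i))) = 1" by (simp add: prod_norm)
  have d1: "norm (T $$ (i, i)) = 1" if i: "i < ?n" for i
  proof (rule ccontr)
    assume "norm (T $$ (i, i)) \<noteq> 1"
    with d_le[OF i] have lt: "norm (T $$ (i, i)) < 1" by simp
    have "(\<Prod>i<?n. norm (T $$ (i, i))) = norm (T $$ (i, i)) * (\<Prod>j\<in>{..<?n} - {i}. norm (T $$ (j, j)))"
      using i by (intro prod.remove) auto
    also have "\<dots> \<le> norm (T $$ (i, i)) * 1"
      by (intro mult_left_mono prod_le_1) (use d_le in auto)
    finally show False using lt prod1 by simp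
  qed
  then show "\<And>\<mu>. \<mu> \<in> cspec A \<Longrightarrow> norm \<mu> = 1" using T(4) by (auto simp: eigenvalue_tomat)
  define z where "z x = T $$ (inv_into {..<?n} e x, inv_into {..<?n} e x)" for x
  have ie: "inv_into {..<?n} e x < ?n" for x
    using e by (metis UNIV_I bij_betw_imp_surj_on inv_into_into lessThan_iff)
  have ze: "z (e i) = T $$ (i, i)" if "i < ?n" for i
    using e that by (simp add: z_def bij_betw_def inv_into_f_f)
  obtain k where k: "k > 0" "\<And>x. norm (z x ^ k - 1) < 1 / ?n"
    using simultaneous_return[of z "1 / ?n"] d1 ie by (auto simp: z_def)
  from similar_mat_wit_pow[OF T(1), of k] have wk: "similar_mat_wit (?M ^\<^sub>m k) (T ^\<^sub>m k) P Q" .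
  have Tk: "T ^\<^sub>m k \<in> carrier_mat ?n ?n" "upper_triangular (T ^\<^sub>m k)"
    "\<And>i. i < ?n \<Longrightarrow> (T ^\<^sub>m k) $$ (i, i) = T $$ (i, i) ^ k"
    using T(2) pow_upper_triangular[OF T(2,3), of k] by auto
  have "of_int (mtrace (tomat (mpow A k))) = mtrace (tomat (cmat (mpow A k)))"
    by (simp add: mtrace_def tomat_cmat)
  also have "\<dots> = mtrace (T ^\<^sub>m k)" using mtrace_similar[OF wk] by (simp add: cmat_mpow tomat_pow)
  also have "\<dots> = (\<Sum>i<?n. z (e i) ^ k)" using Tk T(2) by (simp add: mtrace_def ze)
  finally have tr: "of_int (mtrace (tomat (mpow A k))) = (\<Sum>x\<in>UNIV. z x ^ k)"
    using sum_e[of "\<lambda>x. z x ^ k"] by simp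
  \<comment> \<open>The trace is an integer at distance less than \<open>1\<close> from the dimension.\<close>
  have "norm ((of_int (mtrace (tomat (mpow A k)) - int ?n)) :: complex) = norm (\<Sum>x\<in>UNIV. z x ^ k - 1)"
    by (simp add: tr sum_subtractf)
  also have "\<dots> \<le> (\<Sum>x\<in>UNIV. norm (z x ^ k - 1))" by (rule norm_sum)
  also have "\<dots> < (\<Sum>x\<in>(UNIV :: 'd set). 1 / ?n)" by (rule sum_strict_mono) (use k in auto)
  also have "\<dots> = 1" by simp
  finally have "mtrace (tomat (mpow A k)) = int ?n" unfolding norm_of_int by linarith
  with tr have "(\<Sum>x\<in>UNIV. z x ^ k) = of_nat ?n" by simp
  then have "(\<Sum>x\<in>UNIV. Re (z x ^ k)) = real ?n" by (metis Re_sum complex_Re_of_nat)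
  \<comment> \<open>Points of the unit circle have real part at most 1, so their sum equals their
    number only if each of them is 1.\<close>
  then have "(\<Sum>x\<in>UNIV. 1 - Re (z x ^ k)) = 0" by (simp add: sum_subtractf)
  moreover have nz: "norm (z x ^ k) = 1" for x using d1 ie by (simp add: z_def norm_power)
  then have "1 - Re (z x ^ k) \<ge> 0" for x using complex_Re_le_cmod[of "z x ^ k"] by simp
  ultimately have "1 - Re (z x ^ k) = 0" for x by (subst (asm) sum_nonneg_eq_0_iff) auto
  then have zk: "z x ^ k = 1" for x using nz[of x] by (auto simp: complex_eq_iff cmod_def)
  have "Char_Poly.eigenvalue (tomat (cmat (mpow A k))) \<mu> \<longleftrightarrow> \<mu> = 1" for \<mu>
  proof -
    have c: "?M ^\<^sub>m k \<in> carrier_mat ?n ?n" by simp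
    have "similar_mat (?M ^\<^sub>m k) (T ^\<^sub>m k)" using wk by (auto simp: similar_mat_def)
    then have "char_poly (?M ^\<^sub>m k) = (\<Prod>a\<leftarrow>diag_mat (T ^\<^sub>m k). [:- a, 1:])"
      using char_poly_similar char_poly_upper_triangular[OF Tk(1,2)] by metis
    moreover have "T $$ (i, i) ^ k = 1" if "i < ?n" for i using zk[of "e i"] ze[OF that] by simp
    then have "diag_mat (T ^\<^sub>m k) = replicate ?n 1"
      using Tk T(2) by (intro nth_equalityI) (auto simp: diag_mat_def)
    ultimately show ?thesis
      unfolding cmat_mpow tomat_pow eigenvalue_root_char_poly[OF c]
      by (auto simp: poly_prod_list prod_list_zero_iff)
  qed
  then have "cspec (mpow A k) = {1}" by (auto simp: eigenvalue_tomat)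
  then show "\<exists>k>0. cspec (mpow A k) = {1}" using k by blast
qed

section \<open>Integer inverses and left eigenvectors\<close>

lemma int_matrix_inverse:
  fixes A :: "int^'d^'d"
  assumes "det A = 1 \<or> det A = -1"
  obtains A' where "A ** A' = mat 1" "A' ** A = mat 1"
proof -
  let ?r = "\<lambda>M :: int^'d^'d. (\<chi> i j. real_of_int (M $ i $ j)) :: real^'d^'d"
  have detr: "det (?r M) = of_int (det M)" for M by (simp add: Determinants.det_def)
  have mulr: "?r (M ** M') = ?r M ** ?r M'" for M M' by (simp add: matrix_matrix_mult_def vec_eq_iff)
  have oner: "?r (mat 1) = mat 1" by (simp add: mat_def vec_eq_iff)
  have injr: "?r M = ?r M' \<Longrightarrow> M = M'" for M M' by (simp add: vec_eq_iff)
  \<comment> \<open>Cramer's rule. Since the determinant is 1 or -1, dividing by it is the same as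
    multiplying by it, and the entries stay integers.\<close>
  define A' where "A' = (\<chi> k l. det A * det (\<chi> i j. if j = k then (if i = l then 1 else 0) else A $ i $ j))"
  have "?r A ** ?r A' = mat 1"
  proof -
    have "?r A *v column l (?r A') = axis l 1" for l
    proof -
      have "column l (?r A') = (\<chi> k. det (\<chi> i j. if j = k then axis l 1 $ i else ?r A $ i $ j) / det (?r A))"
      proof (unfold vec_eq_iff, intro allI)
        fix k
        let ?X = "(\<chi> i j. if j = k then (if i = l then 1 else 0) else A $ i $ j) :: int^'d^'d"
        have "(\<chi> i j. if j = k then axis l 1 $ i else ?r A $ i $ j) = ?r ?X"
          by (simp add: vec_eq_iff axis_def)
        then have "det (\<chi> i j. if j = k then axis l 1 $ i else ?r A $ i $ j) = of_int (det ?X)"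
          by (simp only: detr)
        moreover have "det (?r A) = of_int (det A)" by (rule detr)
        ultimately show "column l (?r A') $ k = (\<chi> k. det (\<chi> i j. if j = k then axis l 1 $ i else ?r A $ i $ j) / det (?r A)) $ k"
          using assms by (auto simp: column_def A'_def)
      qed
      moreover have "det (?r A) \<noteq> 0" using assms detr[of A] by auto
      ultimately show ?thesis by (subst cramer) auto
    qed
    moreover have "(?r A ** ?r A') $ i $ l = (?r A *v column l (?r A')) $ i" for i l
      by (simp add: matrix_matrix_mult_def matrix_vector_mult_def column_def)
    ultimately have "(?r A ** ?r A') $ i $ l = mat 1 $ i $ l" for i l
      by (simp add: axis_def mat_def)
    then show ?thesis by (simp add: vec_eq_iff)
  qed
  moreover from this have "?r A' ** ?r A = mat 1" by (simp only: matrix_left_right_inverse)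
  ultimately have "?r (A ** A') = ?r (mat 1)" "?r (A' ** A) = ?r (mat 1)"
    by (simp_all only: mulr oner)
  then show ?thesis using that[of A'] injr[of "A ** A'" "mat 1"] injr[of "A' ** A" "mat 1"] by simp
qed

text \<open>A functional that \<open>A\<close> multiplies by \<mu> turns the recursion of the fibre
  coordinate into a scalar affine recursion. It is a kernel vector of the transpose of
  \<open>cmat A - mat \<mu>\<close>, which is singular together with the matrix itself.\<close>

lemma left_eigenvector:
  fixes A :: "int^'d^'d"
  assumes "\<mu> \<in> cspec A"
  obtains c :: "complex^'d" where "c \<noteq> 0"
    "\<And>x. (\<Sum>i\<in>UNIV. c $ i * of_int ((A *v x) $ i)) = \<mu> * (\<Sum>i\<in>UNIV. c $ i * of_int (x $ i))"
proof -
  let ?N = "cmat A - mat \<mu>"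
  have mv: "(mat \<mu> :: complex^'d^'d) *v v = \<mu> *s v" for v
    by (simp add: mat_def matrix_vector_mult_def vec_eq_iff if_distrib if_distribR cong: if_cong)
  from assms obtain v where "v \<noteq> 0" "?N *v v = 0"
    by (auto simp: cspec_def matrix_vector_mult_diff_rdistrib mv)
  then have "\<not> (\<exists>B. B ** ?N = mat 1)" unfolding matrix_left_invertible_ker by blast
  then have "\<not> (\<exists>B. ?N ** B = mat 1)" using matrix_left_right_inverse by metis
  then have "\<not> (\<exists>B. B ** transpose ?N = mat 1)" by (simp add: left_invertible_transpose)
  then obtain c where c: "c \<noteq> 0" "transpose ?N *v c = 0" unfolding matrix_left_invertible_ker by blast
  have e: "(\<Sum>i\<in>UNIV. c $ i * cmat A $ i $ j) = \<mu> * c $ j" for j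
  proof -
    have "0 = (transpose ?N *v c) $ j" unfolding c(2) by simp
    also have "\<dots> = (\<Sum>i\<in>UNIV. c $ i * cmat A $ i $ j) - (\<Sum>i\<in>UNIV. (mat \<mu> :: complex^'d^'d) $ i $ j * c $ i)"
      by (simp add: matrix_vector_mult_def transpose_def left_diff_distrib right_diff_distrib sum_subtractf mult.commute)
    also have "(\<Sum>i\<in>UNIV. (mat \<mu> :: complex^'d^'d) $ i $ j * c $ i) = \<mu> * c $ j"
      by (simp add: mat_def if_distrib if_distribR cong: if_cong)
    finally show ?thesis by simp
  qed
  show ?thesis
  proof (rule that[OF c(1)])
    fix x :: "int^'d"
    have "(\<Sum>i\<in>UNIV. c $ i * of_int ((A *v x) $ i)) = (\<Sum>i\<in>UNIV. \<Sum>j\<in>UNIV. (c $ i * cmat A $ i $ j) * of_int (x $ j))"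
      by (simp add: matrix_vector_mult_def cmat_def sum_distrib_left mult.assoc)
    also have "\<dots> = (\<Sum>j\<in>UNIV. \<Sum>i\<in>UNIV. (c $ i * cmat A $ i $ j) * of_int (x $ j))" by (rule sum.swap)
    also have "\<dots> = (\<Sum>j\<in>UNIV. (\<mu> * c $ j) * of_int (x $ j))" by (simp add: sum_distrib_right[symmetric] e)
    finally show "(\<Sum>i\<in>UNIV. c $ i * of_int ((A *v x) $ i)) = \<mu> * (\<Sum>i\<in>UNIV. c $ i * of_int (x $ i))"
      by (simp add: sum_distrib_left mult.assoc)
  qed
qed

hide_const (open) Char_Poly.eigenvalue

subsection \<open>The integer lattice\<close>

definition idot :: "int^'d \<Rightarrow> int^'d \<Rightarrow> int" where
  "idot x y = (\<Sum>i\<in>UNIV. x $ i * y $ i)"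

lemma idot_simps[simp]:
  "idot (x + y) z = idot x z + idot y z" "idot z (x + y) = idot z x + idot z y"
  "idot (x - y) z = idot x z - idot y z" "idot z (x - y) = idot z x - idot z y"
  "idot (- x) z = - idot x z" "idot z (- x) = - idot z x"
  "idot (m *s x) z = m * idot x z" "idot z (m *s x) = m * idot z x"
  "idot 0 z = 0" "idot z 0 = 0"
  by (simp_all add: idot_def algebra_simps sum.distrib sum_subtractf sum_negf sum_distrib_left)

lemma idot_commute: "idot x y = idot y x"
  by (simp add: idot_def mult.commute)

lemma idot_self: "idot x x \<ge> 0" "idot x x = 0 \<longleftrightarrow> x = 0"
proof -
  show "idot x x \<ge> 0" by (simp add: idot_def sum_nonneg)
  show "idot x x = 0 \<longleftrightarrow> x = 0"
    unfolding idot_def by (subst sum_nonneg_eq_0_iff) (auto simp: vec_eq_iff)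
qed

lemma idot_transpose: "idot (transpose B *v c) u = idot c (B *v u)"
proof -
  have "idot (transpose B *v c) u = (\<Sum>i\<in>UNIV. \<Sum>j\<in>UNIV. B $ j $ i * c $ j * u $ i)"
    by (simp add: idot_def matrix_vector_mult_def transpose_def sum_distrib_right)
  also have "\<dots> = (\<Sum>j\<in>UNIV. \<Sum>i\<in>UNIV. B $ j $ i * c $ j * u $ i)" by (rule sum.swap)
  also have "\<dots> = idot c (B *v u)"
    by (simp add: idot_def matrix_vector_mult_def sum_distrib_left ac_simps)
  finally show ?thesis .
qed

definition rvec :: "int^'d \<Rightarrow> real^'d" where
  "rvec x = (\<chi> i. of_int (x $ i))"

lemma rvec_simps[simp]:
  "rvec (x + y) = rvec x + rvec y" "rvec (x - y) = rvec x - rvec y" "rvec 0 = 0"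
  "rvec (- x) = - rvec x" "rvec (m *s x) = of_int m *\<^sub>R rvec x"
  by (simp_all add: rvec_def vec_eq_iff)

lemma rvec_eq_0[simp]: "rvec x = 0 \<longleftrightarrow> x = 0"
  by (simp add: rvec_def vec_eq_iff)

lemma inner_rvec: "rvec x \<bullet> rvec y = of_int (idot x y)"
  by (simp add: rvec_def idot_def inner_vec_def)

lemma subgrp_smult:
  assumes "subgrp H" "x \<in> H" shows "m *s x \<in> H"
proof -
  have nat: "int n *s x \<in> H" for n
  proof (induction n)
    case (Suc n)
    have "int (Suc n) *s x = int n *s x + x" by (simp add: vec_eq_iff algebra_simps)
    then show ?case using Suc assms by (simp add: subgrp_def)
  qed (use assms in \<open>simp add: subgrp_def vec_eq_iff zero_vec_def[symmetric]\<close>)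
  show ?thesis
  proof (cases "m \<ge> 0")
    case True then show ?thesis using nat[of "nat m"] by simp
  next
    case False
    then have "m *s x = - (int (nat (- m)) *s x)" by (simp add: vec_eq_iff)
    then show ?thesis using nat[of "nat (- m)"] assms by (metis subgrp_def)
  qed
qed

lemma subgrp_diff: "subgrp H \<Longrightarrow> x \<in> H \<Longrightarrow> y \<in> H \<Longrightarrow> x - y \<in> H"
  by (metis diff_conv_add_uminus subgrp_def)

text \<open>Gram--Schmidt without division.\<close>
lemma integer_orthogonal_projection:
  fixes H :: "(int^'d) set"
  assumes H: "subgrp H" and "finite X" "X \<subseteq> H"
  shows "\<exists>m>0. \<exists>y\<in>H. (\<forall>v. (\<forall>z\<in>X. idot v z = 0) \<longrightarrow> idot v y = 0) \<and> (\<forall>z\<in>X. idot (m *s x - y) z = 0)"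
  using assms(2,3)
proof (induction X arbitrary: x rule: finite_induct)
  case empty
  have "(0 :: int^'d) \<in> H" using H by (simp add: subgrp_def)
  then show ?case by (intro exI[of _ 1] conjI bexI[of _ 0]) auto
next
  case (insert w X)
  then have wH: "w \<in> H" and XH: "X \<subseteq> H" by auto
  obtain k y where k: "k > 0" "y \<in> H" "\<And>v. (\<forall>z\<in>X. idot v z = 0) \<Longrightarrow> idot v y = 0"
    and kw: "\<And>z. z \<in> X \<Longrightarrow> idot (k *s w - y) z = 0"
    using insert.IH[OF XH, of w] by blast

  obtain m u where m: "m > 0" "u \<in> H" "\<And>v. (\<forall>z\<in>X. idot v z = 0) \<Longrightarrow> idot v u = 0"
    and mx: "\<And>z. z \<in> X \<Longrightarrow> idot (m *s x - u) z = 0"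
    using insert.IH[OF XH, of x] by blast
  define w' where "w' = k *s w - y"
  define x' where "x' = m *s x - u"
  have w'H: "w' \<in> H" unfolding w'_def using H k wH by (intro subgrp_diff subgrp_smult)
  \<comment> \<open>\<open>w'\<close> is the part of \<open>w\<close> perpendicular to
    \<open>X\<close>, up to a scale; if it vanishes, \<open>w\<close> adds no new condition.\<close>
  have perp_w: "idot v w = 0" if "\<forall>z\<in>X. idot v z = 0" "idot v w' = 0" for v
    using that k(1) k(3)[of v] by (simp add: w'_def)
  show ?case
  proof (cases "w' = 0")
    case True
    have "idot x' w = 0" by (rule perp_w) (use True mx in \<open>simp_all add: x'_def\<close>)
    then show ?thesis using m mx unfolding x'_def
      by (intro exI[of _ m] conjI bexI[of _ u]) auto
  next
    case False
    let ?q = "idot w' w'" and ?t = "idot x' w'"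
    have q: "?q > 0" using False idot_self[of w'] by linarith
    \<comment> \<open>The Gram--Schmidt coefficient would be \<open>?t / ?q\<close>; everything is
      multiplied by \<open>?q\<close> to stay in the lattice.\<close>
    let ?y = "?q *s u + ?t *s w'"
    have eq: "(?q * m) *s x - ?y = ?q *s x' - ?t *s w'" by (simp add: x'_def vec_eq_iff algebra_simps)
    have perp: "idot (?q *s x' - ?t *s w') z = 0" if "z \<in> X" for z
      using kw[OF that, folded w'_def] mx[OF that, folded x'_def] by simp
    have "idot (?q *s x' - ?t *s w') w = 0"
      by (rule perp_w) (use perp in auto)
    moreover have "?y \<in> H" using H m w'H by (metis subgrp_def subgrp_smult)
    moreover have "idot v ?y = 0" if "\<forall>z\<in>insert w X. idot v z = 0" for v
      using that m(3)[of v] k(3)[of v] by (simp add: w'_def)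
    ultimately show ?thesis using q m perp
      by (intro exI[of _ "?q * m"] conjI bexI[of _ ?y]) (auto simp: eq simp del: idot_simps)
  qed
qed

text \<open>A maximal linearly independent subset over the reals. It allows the functionals of an
  infinite set to be imposed one at a time, by a finite induction.\<close>

lemma finite_determining_subset:
  fixes X :: "(int^'d) set"
  obtains F where "finite F" "F \<subseteq> X" "\<And>c. (\<forall>b\<in>F. idot c b = 0) \<Longrightarrow> (\<forall>x\<in>X. idot c x = 0)"
proof -
  obtain F' where F': "F' \<subseteq> rvec ` X" "independent F'" "rvec ` X \<subseteq> span F'"
    using maximal_independent_subset[of "rvec ` X"] by auto
  then have "finite F'" using independent_imp_finite by blast
  then obtain F where F: "F \<subseteq> X" "finite F" "F' = rvec ` F" using F'(1) finite_subset_image by metis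
  show ?thesis
  proof (rule that[OF F(2,1)], intro ballI)
    fix c x assume c: "\<forall>b\<in>F. idot c b = 0" and "x \<in> X"
    have "span F' \<subseteq> {y. rvec c \<bullet> y = 0}"
      by (rule span_minimal) (use c F in \<open>auto simp: inner_rvec subspace_hyperplane\<close>)
    then have "rvec c \<bullet> rvec x = 0" using F'(3) \<open>x \<in> X\<close> by auto
    then show "idot c x = 0" by (simp add: inner_rvec)
  qed
qed

text \<open>The double annihilator of \<open>H\<close> is its rational span. The difference
  \<open>m *s x - y\<close> with the projection \<open>y\<close> is perpendicular to
  \<open>H\<close>, hence by assumption to \<open>x\<close>, hence to itself, so it is 0.\<close>

lemma multiple_in_subgroup:
  fixes H :: "(int^'d) set"
  assumes H: "subgrp H" and x: "\<And>c. (\<forall>y\<in>H. idot c y = 0) \<Longrightarrow> idot c x = 0"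
  shows "\<exists>m>0. m *s x \<in> H"
proof -
  obtain F where F: "finite F" "F \<subseteq> H" "\<And>c. (\<forall>b\<in>F. idot c b = 0) \<Longrightarrow> (\<forall>x\<in>H. idot c x = 0)"
    using finite_determining_subset[of H] by metis
  obtain m y where m: "m > 0" "y \<in> H" "\<forall>z\<in>F. idot (m *s x - y) z = 0"
    using integer_orthogonal_projection[OF H F(1,2), of x] by blast
  let ?c = "m *s x - y"
  have c: "\<forall>z\<in>H. idot ?c z = 0" using F(3)[OF m(3)] .
  then have "idot ?c ?c = 0" using x[OF c] m(2) idot_simps(4,8) by (metis diff_zero mult_zero_right)
  then have "m *s x = y" by (simp only: idot_self) simp
  then show ?thesis using m by auto
qed

subsection \<open>Unipotent matrices\<close>

locale unipotent =
  fixes B :: "int^'d^'d" and d :: nat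
  assumes nilpotent: "((\<lambda>u. B *v u - u) ^^ d) x = 0"
begin

definition D :: "int^'d \<Rightarrow> int^'d" where "D u = B *v u - u"

definition Bi :: "nat \<Rightarrow> int^'d \<Rightarrow> int^'d" where "Bi n = ((*v) B) ^^ n"

lemma D_simps[simp]: "D (x + y) = D x + D y" "D (x - y) = D x - D y" "D (m *s x) = m *s D x" "D 0 = 0" "D (- x) = - D x"
  by (simp_all add: D_def matrix_vector_mult_def vec_eq_iff algebra_simps sum.distrib sum_subtractf sum_distrib_left sum_negf)

lemma D_pow_nilpotent: "(D ^^ d) x = 0"
  using nilpotent unfolding D_def[abs_def] .

lemma D_pow_simps[simp]: "(D ^^ i) (x + y) = (D ^^ i) x + (D ^^ i) y" "(D ^^ i) (x - y) = (D ^^ i) x - (D ^^ i) y"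
    "(D ^^ i) 0 = 0"
  by (induction i) simp_all

lemma Bi_0[simp]: "Bi 0 x = x" by (simp add: Bi_def)
lemma Bi_Suc: "Bi (Suc n) x = Bi n x + D (Bi n x)" by (simp add: Bi_def D_def)
lemma Bi_add: "Bi (n + k) x = Bi n (Bi k x)" by (simp add: Bi_def funpow_add)

lemma Bi_simps[simp]: "Bi n (x + y) = Bi n x + Bi n y" "Bi n (x - y) = Bi n x - Bi n y" "Bi n (m *s x) = m *s Bi n x" "Bi n 0 = 0" "Bi n (- x) = - Bi n x"
proof -
  show 1: "Bi n (x - y) = Bi n x - Bi n y" for x y
    by (induction n) (simp_all add: Bi_Suc)
  show 2: "Bi n 0 = 0" by (induction n) (simp_all add: Bi_Suc)
  show 3: "Bi n (- x) = - Bi n x" for x using 1[of 0 x] 2 by simp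
  show "Bi n (x + y) = Bi n x + Bi n y" using 1[of x "- y"] 3[of y] by simp
  show "Bi n (m *s x) = m *s Bi n x"
    by (induction n) (simp_all add: Bi_Suc vector_add_ldistrib)
qed

lemma D_pow_Bi: "(D ^^ i) (Bi n x) = Bi n ((D ^^ i) x)"
  by (induction n) (simp_all add: Bi_Suc funpow_swap1[symmetric])

lemma Bi_fixed: "D v = 0 \<Longrightarrow> Bi n v = v"
  by (induction n) (simp_all add: Bi_Suc)

text \<open>The functionals killed by the \<open>j\<close>-th power of the transpose of
  \<open>B - 1\<close>, expressed through \<open>D\<close> instead of the transpose.
  \<open>Cf 1\<close> consists of the \<open>B\<close>-invariant functionals, and
  \<open>Cf d\<close> is everything.\<close>

definition Cf :: "nat \<Rightarrow> (int^'d) set" where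
  "Cf j = {c. \<forall>u. idot c ((D ^^ j) u) = 0}"

definition ann :: "(int^'d) set \<Rightarrow> (int^'d) set" where
  "ann X = {x. \<forall>c\<in>X. idot c x = 0}"

lemma subgrp_ann: "subgrp (ann X)" by (auto simp: subgrp_def ann_def)

lemma ann_divide: "m *s x \<in> ann X \<Longrightarrow> m \<noteq> 0 \<Longrightarrow> x \<in> ann X" by (auto simp: ann_def)

lemma Cf_Suc: "Cf j \<subseteq> Cf (Suc j)"
  by (auto simp: Cf_def funpow_Suc_right simp del: funpow.simps)

lemma Cf_1_subset: "Cf 1 \<subseteq> Cf (Suc j)"
  using lift_Suc_mono_le[of Cf 1 "Suc j"] Cf_Suc by auto

lemma Cf_1: "c \<in> Cf 1 \<longleftrightarrow> (\<forall>u. idot c (D u) = 0)" by (simp add: Cf_def)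

lemma Cf_d: "Cf d = UNIV"
  by (simp add: Cf_def D_pow_nilpotent)

text \<open>The transpose of \<open>B - 1\<close> maps level \<open>j + 1\<close> of the filtration
  to level \<open>j\<close>. So the functionals of the next level, although not
  \<open>B\<close>-invariant in general, are invariant on \<open>ann (Cf j)\<close>.\<close>

lemma Cf_D: assumes "c \<in> Cf (Suc j)" "x \<in> ann (Cf j)" shows "idot c (D x) = 0"
proof -
  let ?c = "transpose B *v c - c"
  have e: "idot ?c u = idot c (D u)" for u
    by (simp only: idot_simps idot_transpose D_def)
  then have "?c \<in> Cf j" using assms(1) by (simp add: Cf_def)
  then show ?thesis using assms(2) e by (auto simp: ann_def)
qed

text \<open>\<open>D\<close> is nilpotent on \<open>K\<close>, so \<open>1 + D\<close> is invertible
  there: a solution for the right-hand side \<open>D y\<close> yields the solution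
  \<open>y - x\<close> for \<open>y\<close>. This lets a correction be applied in advance, before a
  twist acts on it.\<close>

lemma Bi_surj_on:
  assumes "subgrp K" "\<And>x. x \<in> K \<Longrightarrow> D x \<in> K" "y \<in> K"
  shows "\<exists>x\<in>K. Bi n x = y"
proof -
  have 1: "\<exists>x\<in>K. x + D x = y" if "y \<in> K" for y
  proof -
    have "(D ^^ i) y = 0 \<Longrightarrow> y \<in> K \<Longrightarrow> \<exists>x\<in>K. x + D x = y" for i y
    proof (induction i arbitrary: y)
      case 0 then show ?case using assms(1) by (intro bexI[of _ 0]) (auto simp: subgrp_def)
    next
      case (Suc i)
      then obtain x where x: "x \<in> K" "x + D x = D y"
        using assms(2) by (auto simp: funpow_Suc_right simp del: funpow.simps)
      have "(y - x) + D (y - x) = y" using x(2) by (simp add: algebra_simps)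
      then show ?case using subgrp_diff[OF assms(1) Suc.prems(2) x(1)] by blast
    qed
    then show ?thesis using D_pow_nilpotent that by blast
  qed
  show ?thesis using assms(3)
  proof (induction n arbitrary: y)
    case (Suc n)
    then obtain z where z: "z \<in> K" "z + D z = y" using 1 by blast
    then obtain x where "x \<in> K" "Bi n x = z" using Suc by blast
    then show ?case using z by (auto simp: Bi_Suc)
  qed auto
qed

text \<open>A unipotent matrix has finite order modulo \<open>r\<close>. On the kernel of the next
  power of \<open>D\<close> one has \<open>Bi e x = x + y\<close> with \<open>y\<close> in the
  previous kernel, where \<open>Bi e\<close> is already trivial modulo \<open>r\<close>. Hence
  \<open>Bi (e * n) x\<close> is \<open>x + n y\<close> modulo \<open>r\<close>, and
  \<open>n = r\<close> finishes.\<close>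

lemma Bi_finite_order:
  assumes "r > 0"
  shows "\<exists>e>0. \<forall>x. \<exists>z. Bi e x - x = int r *s z"
proof -
  have "\<exists>e>0. \<forall>x. (D ^^ i) x = 0 \<longrightarrow> (\<exists>z. Bi e x - x = int r *s z)" for i
  proof (induction i)
    case 0 show ?case by (rule exI[of _ 1]) (auto intro: exI[of _ 0])
  next
    case (Suc i)
    then obtain e where e: "e > 0" "\<And>x. (D ^^ i) x = 0 \<Longrightarrow> \<exists>z. Bi e x - x = int r *s z" by blast
    have "\<exists>z. Bi (e * r) x - x = int r *s z" if x: "(D ^^ Suc i) x = 0" for x
    proof -
      define y where "y = Bi e x - x"
      have Dy: "(D ^^ i) (Bi n y) = 0" for n
      proof -
        have "D ((D ^^ i) x) = 0" using x by simp
        from Bi_fixed[OF this] show ?thesis by (simp add: D_pow_Bi y_def)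
      qed
      have y: "\<exists>z. Bi (e * n) y - y = int r *s z" for n
      proof (induction n)
        case 0 show ?case by (auto intro: exI[of _ 0])
      next
        case (Suc n)
        then obtain z where z: "Bi (e * n) y - y = int r *s z" by blast
        obtain z' where z': "Bi e (Bi (e * n) y) - Bi (e * n) y = int r *s z'"
          using e(2)[OF Dy] by blast
        have "Bi (e * Suc n) y = Bi e (Bi (e * n) y)" by (simp add: Bi_add)
        then have "Bi (e * Suc n) y - y = int r *s (z' + z)"
          using z z' by (simp add: vector_add_ldistrib algebra_simps)
        then show ?case by blast
      qed
      have "\<exists>z. Bi (e * n) x - x - int n *s y = int r *s z" for n
      proof (induction n)
        case 0 show ?case by (auto intro: exI[of _ 0])
      next
        case (Suc n)
        then obtain z where z: "Bi (e * n) x - x - int n *s y = int r *s z" by blast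
        obtain z' where z': "Bi (e * n) y - y = int r *s z'" using y by blast
        have "Bi (e * Suc n) x = Bi (e * n) (x + y)" by (simp add: Bi_add[symmetric] y_def add.commute)
        then have "Bi (e * Suc n) x - x - int (Suc n) *s y = int r *s (z + z')"
          using z z' by (simp add: vec_eq_iff algebra_simps)
        then show ?case by blast
      qed
      from this[of r] obtain z where "Bi (e * r) x - x - int r *s y = int r *s z" by blast
      then have "Bi (e * r) x - x = int r *s (z + y)" by (simp add: vec_eq_iff algebra_simps)
      then show ?thesis by blast
    qed
    then show ?case using e(1) assms by (intro exI[of _ "e * r"]) auto
  qed
  from this[of d] show ?thesis by (simp add: D_pow_nilpotent)
qed

end

subsection \<open>Twisted semigroups of heights\<close>

text \<open>\<open>S n\<close> models the heights of the loops of length \<open>n\<close> at a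
  vertex. The twist in \<open>comp\<close> reflects that the first loop is transported by the
  second; \<open>residues\<close> is the content of finite transitivity, and \<open>abelian\<close>
  records positivity for the invariant functionals, the part supplied by the rotation set or by
  periodic points.\<close>

locale height_semigroup = unipotent B d
  for B :: "int^'d^'d" and d :: nat +
  fixes S :: "nat \<Rightarrow> (int^'d) set"
  assumes comp: "u \<in> S n \<Longrightarrow> v \<in> S k \<Longrightarrow> Bi k u + v \<in> S (n + k)"
    and residues: "k > 0 \<Longrightarrow> r > 0 \<Longrightarrow> \<exists>n>0. k dvd n \<and> (\<exists>u\<in>S n. \<exists>y. u = w + int r *s y)"
    and abelian: "e > 0 \<Longrightarrow> \<exists>m>0. \<exists>i>0. e dvd i \<and> (\<exists>f\<in>ann (Cf 1). m *s x + f \<in> S i)"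
begin

text \<open>With \<open>K\<close> the whole lattice this is the assumption \<open>residues\<close>;
  with \<open>K = {0}\<close> it says that every vector is a height. The factor \<open>r\<close> on
  the error, for all \<open>r\<close>, is what makes the passage to a smaller \<open>K\<close>
  possible.\<close>

definition reach :: "(int^'d) set \<Rightarrow> bool" where
  "reach K \<longleftrightarrow> (\<forall>k>0. \<forall>r>0. \<forall>w. \<exists>n>0. k dvd n \<and> (\<exists>u\<in>S n. \<exists>y\<in>K. u = w + int r *s y))"

text \<open>Start from an error \<open>r a b y\<close> with \<open>y\<close> in \<open>K\<close>,
  where \<open>a\<close> and \<open>-b\<close> are the \<open>c\<close>-values of two loops in
  \<open>K\<close>. Suitable repetitions of these loops cancel it up to \<open>r\<close> times an
  element of the kernel of \<open>c\<close>. As \<open>c\<close> is \<open>B\<close>-invariant on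
  \<open>K\<close>, the twist does not disturb the bookkeeping of \<open>c\<close>-values.\<close>

lemma reach_step:
  assumes K: "subgrp K" "\<And>m x. m *s x \<in> K \<Longrightarrow> m \<noteq> 0 \<Longrightarrow> x \<in> K"
    and DK: "\<And>x. x \<in> K \<Longrightarrow> D x \<in> K" and cD: "\<And>x. x \<in> K \<Longrightarrow> idot c (D x) = 0"
    and signs: "\<And>e. e > 0 \<Longrightarrow> \<exists>x\<in>K. \<exists>y\<in>K. \<exists>i>0. \<exists>j>0. e dvd i \<and> e dvd j \<and> x \<in> S i \<and> y \<in> S j
                  \<and> idot c x > 0 \<and> idot c y < 0"
    and R: "reach K"
  shows "reach (K \<inter> {x. idot c x = 0})"
  unfolding reach_def
proof (intro allI impI)
  fix k r :: nat and w assume kr: "k > 0" "r > 0"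
  let ?K' = "K \<inter> {x. idot c x = 0}"
  have sK': "subgrp ?K'" using K(1) by (auto simp: subgrp_def)
  have Kadd: "x + y \<in> K" if "x \<in> K" "y \<in> K" for x y using K(1) that by (simp add: subgrp_def)
  have BiK: "Bi n x \<in> K \<and> idot c (Bi n x) = idot c x" if "x \<in> K" for n x
    using that by (induction n) (auto simp: Bi_Suc cD DK Kadd)
  obtain e0 where e0: "e0 > 0" "\<And>x. \<exists>z. Bi e0 x - x = int r *s z" using Bi_finite_order[OF kr(2)] by blast
  have Bi_mod: "\<exists>z. Bi (e0 * n) x - x = int r *s z" for n x
  proof (induction n)
    case 0 show ?case by (auto intro: exI[of _ 0])
  next
    case (Suc n)
    then obtain z where z: "Bi (e0 * n) x - x = int r *s z" by blast
    obtain z' where "Bi e0 (Bi (e0 * n) x) - Bi (e0 * n) x = int r *s z'" using e0(2) by blast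
    with z have "Bi (e0 * Suc n) x - x = int r *s (z + z')" by (simp add: Bi_add vec_eq_iff algebra_simps)
    then show ?case by blast
  qed
  define e where "e = e0 * k"
  have "e > 0" using e0 kr by (simp add: e_def)
  have Bi_e: "\<exists>z\<in>?K'. Bi n x = x + int r *s z" if "e dvd n" "x \<in> K" for n x
  proof -
    have "e0 dvd n" using that(1) by (auto simp: e_def)
    then obtain z where z: "Bi n x - x = int r *s z" using Bi_mod[of _ x] by (metis dvdE)
    have "int r *s z \<in> ?K'" using BiK[OF that(2), of n] subgrp_diff[OF K(1), of "Bi n x" x] that(2)
      by (simp add: z[symmetric])
    then have "z \<in> ?K'" using K(2)[of "int r" z] kr(2) by auto
    then show ?thesis using z by (metis add.commute diff_add_cancel)
  qed
  \<comment> \<open>At lengths divisible by \<open>e\<close> the twist changes elements of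
    \<open>K\<close> only by \<open>r\<close> times elements of \<open>?K'\<close>; the purity of
    \<open>K\<close> is used to divide by \<open>r\<close>. So \<open>P\<close>, the heights up to
    such errors, is closed under addition.\<close>
  define P where "P = {x\<in>K. \<exists>j>0. e dvd j \<and> (\<exists>z\<in>?K'. x + int r *s z \<in> S j)}"
  have P_add: "x1 + x2 \<in> P" if x: "x1 \<in> P" "x2 \<in> P" for x1 x2
  proof -
    obtain j1 z1 where 1: "x1 \<in> K" "j1 > 0" "e dvd j1" "z1 \<in> ?K'" "x1 + int r *s z1 \<in> S j1"
      using x(1) unfolding P_def by blast
    obtain j2 z2 where 2: "x2 \<in> K" "j2 > 0" "e dvd j2" "z2 \<in> ?K'" "x2 + int r *s z2 \<in> S j2"
      using x(2) unfolding P_def by blast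
    have "x1 + int r *s z1 \<in> K" using 1 K(1) by (intro Kadd subgrp_smult) auto
    from Bi_e[OF 2(3) this] obtain z3 where z3: "z3 \<in> ?K'" "Bi j2 (x1 + int r *s z1) = x1 + int r *s z1 + int r *s z3"
      by blast
    have "(x1 + x2) + int r *s (z1 + z3 + z2) \<in> S (j1 + j2)"
      using comp[OF 1(5) 2(5)] unfolding z3(2) by (simp add: vector_add_ldistrib algebra_simps)
    moreover have "z1 + z3 + z2 \<in> ?K'" using sK' 1 2 z3 by (metis subgrp_def)
    ultimately show ?thesis using 1(2,3) 2(2,3) Kadd[OF 1(1) 2(1)] unfolding P_def mem_Collect_eq
      by (intro conjI exI[of _ "j1 + j2"] bexI[of _ "z1 + z3 + z2"]) auto
  qed
  have P_mult: "int n *s x \<in> P" if "n > 0" "x \<in> P" for n x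
    using that(1)
  proof (induction n rule: nat_induct_non_zero)
    case (Suc n)
    have "int (Suc n) *s x = int n *s x + x" by (simp add: vec_eq_iff algebra_simps)
    then show ?case using P_add[OF Suc.IH that(2)] by (simp only:)
  qed (use that in simp)
  obtain p q i j where pq: "p \<in> K" "q \<in> K" "i > 0" "j > 0" "e dvd i" "e dvd j" "p \<in> S i" "q \<in> S j"
    "idot c p > 0" "idot c q < 0" using signs[OF \<open>e > 0\<close>] by blast
  have "0 \<in> ?K'" using sK' by (simp add: subgrp_def)
  then have pqP: "p \<in> P" "q \<in> P" using pq unfolding P_def by (force intro: bexI[of _ 0])+
  define a b where "a = nat (idot c p)" and "b = nat (- idot c q)"
  have ab: "a > 0" "b > 0" "idot c p = int a" "idot c q = - int b" using pq by (auto simp: a_def b_def)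
  have P_all: "int (r * a * b) *s y \<in> P" if y: "y \<in> K" for y
  proof -
    define t where "t = idot c y"
    \<comment> \<open>Adding 1 to both parts keeps their difference \<open>t\<close> and makes both
      multiplicities positive, since only positive repetitions exist.\<close>
    define n1 n2 where "n1 = nat t + 1" and "n2 = nat (- t) + 1"
    have t: "t = int n1 - int n2" by (simp add: n1_def n2_def)
    have "r * b * n1 > 0" "r * a * n2 > 0" using ab kr by (auto simp: n1_def n2_def)
    from P_add[OF P_mult[OF this(1) pqP(1)] P_mult[OF this(2) pqP(2)]] obtain j z where 1: "int (r * b * n1) *s p + int (r * a * n2) *s q + int r *s z \<in> S j"
      "j > 0" "e dvd j" "z \<in> ?K'" unfolding P_def by blast
    define v where "v = int (a * b) *s y - int (b * n1) *s p - int (a * n2) *s q"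
    have vK: "v \<in> K" unfolding v_def using K(1) pq y by (intro subgrp_diff subgrp_smult)
    have "idot c v = 0" using ab by (simp add: v_def t_def[symmetric] t algebra_simps)
    then have "z - v \<in> ?K'" using vK 1(4) by (intro subgrp_diff[OF sK']) auto
    moreover have "int (r * a * b) *s y + int r *s (z - v) =
        int (r * b * n1) *s p + int (r * a * n2) *s q + int r *s z"
      by (simp add: v_def vec_eq_iff algebra_simps)
    then have "int (r * a * b) *s y + int r *s (z - v) \<in> S j" using 1(1) by (simp only:)
    ultimately show ?thesis using 1(2,3) subgrp_smult[OF K(1) y] unfolding P_def by blast
  qed
  have "r * a * b > 0" using kr ab by simp
  then obtain n u y where n: "n > 0" "k dvd n" "u \<in> S n" "y \<in> K" "u = w + int (r * a * b) *s y"
    using R kr(1) unfolding reach_def by blast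
  \<comment> \<open>The correcting loop comes first and is transported by the second one, so it is
    chosen to have height proportional to \<open>-y\<close> only after the twist
    \<open>Bi n\<close>.\<close>
  have "- y \<in> K" using n(4) K(1) by (simp add: subgrp_def)
  then obtain y' where y': "y' \<in> K" "Bi n y' = - y" using Bi_surj_on[OF K(1) DK] by blast
  from P_all[OF y'(1)] obtain j z where j: "j > 0" "e dvd j" "z \<in> ?K'" "int (r * a * b) *s y' + int r *s z \<in> S j"
    unfolding P_def by blast
  have "Bi n (int (r * a * b) *s y' + int r *s z) + u = w + int r *s Bi n z"
    using y'(2) n(5) by simp
  with comp[OF j(4) n(3)] have "w + int r *s Bi n z \<in> S (j + n)" by (simp only:)
  moreover have "Bi n z \<in> ?K'" using BiK[of z n] j(3) by auto
  moreover have "k dvd j + n" using j n by (auto simp: e_def)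
  ultimately show "\<exists>n>0. k dvd n \<and> (\<exists>u\<in>S n. \<exists>y\<in>?K'. u = w + int r *s y)"
    using n(1) by (intro exI[of _ "j + n"]) auto
qed

text \<open>If loops \<open>x\<close> and \<open>y\<close> have heights \<open>w\<close> and \<open>- w\<close> modulo \<open>K\<close>, the heights of \<open>x\<^sup>py\<^sup>p\<close> and
  \<open>y\<^sup>px\<^sup>p\<close> lie in \<open>K\<close> and, as in the Heisenberg group, their \<open>c\<close>-values grow like
  \<open>p\<^sup>2\<close> with opposite signs.\<close>
lemma commutator_signs:
  assumes K: "subgrp K" and DK: "\<And>x. x \<in> K \<Longrightarrow> D x \<in> K" and cD: "\<And>x. x \<in> K \<Longrightarrow> idot c (D x) = 0"
    and R: "reach K" and w: "D w \<in> K" "idot c (D w) > 0" and "e > 0"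
  shows "\<exists>x\<in>K. \<exists>y\<in>K. \<exists>i>0. \<exists>j>0. e dvd i \<and> e dvd j \<and> x \<in> S i \<and> y \<in> S j \<and> idot c x > 0 \<and> idot c y < 0"
proof -
  define \<delta> where "\<delta> = idot c (D w)"
  have Kadd: "x + y \<in> K" if "x \<in> K" "y \<in> K" for x y using K that by (simp add: subgrp_def)
  \<comment> \<open>Modulo \<open>K\<close> the element is \<open>p w\<close>, and each application
    of \<open>B\<close> adds a multiple \<open>p\<close> of \<open>D w\<close> up to an element of
    \<open>K\<close> on which \<open>c\<close> vanishes. So \<open>c\<close> grows by
    \<open>p \<delta>\<close> per unit of length.\<close>
  have drift: "Bi n x - int p *s w \<in> K \<and> idot c (Bi n x) = idot c x + int n * int p * \<delta> "
    if x: "x - int p *s w \<in> K" for n p x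
  proof (induction n)
    case (Suc n)
    let ?y = "Bi n x"
    have D: "D ?y = int p *s D w + D (?y - int p *s w)" by simp
    have "D ?y \<in> K" unfolding D
      using Kadd[OF subgrp_smult[OF K w(1)] DK[OF conjunct1[OF Suc]]] .
    moreover have "idot c (D (?y - int p *s w)) = 0" using Suc cD by blast
    then have "idot c (D ?y) = int p * \<delta>" by (subst D) (simp only: idot_simps \<delta>_def add_0_right)
    moreover have "Bi (Suc n) x - int p *s w = (?y - int p *s w) + D ?y" by (simp add: Bi_Suc)
    ultimately show ?case using Suc Kadd[of "?y - int p *s w" "D ?y"] by (simp add: Bi_Suc distrib_right add_diff_eq diff_add_eq)
  qed (use x in simp)
  have drift': "Bi n x + int p *s w \<in> K \<and> idot c (Bi n x) = idot c x - int n * int p * \<delta>"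
    if x: "x + int p *s w \<in> K" for n p x
  proof -
    have "- x - int p *s w \<in> K" using x K by (metis add_uminus_conv_diff minus_add_distrib subgrp_def)
    note * = drift[OF this, of n]
    have "- (Bi n x + int p *s w) = Bi n (- x) - int p *s w" by (simp add: algebra_simps)
    with * have "- (Bi n x + int p *s w) \<in> K" by (simp only:)
    moreover have "idot c (Bi n x) = idot c x - int n * int p * \<delta>" using * by simp
    ultimately have "- (Bi n x + int p *s w) \<in> K" "idot c (Bi n x) = idot c x - int n * int p * \<delta>"
      by blast+
    then show ?thesis using K by (metis add.inverse_inverse subgrp_def)
  qed
  have reach1: "\<exists>n>0. e dvd n \<and> (\<exists>u\<in>S n. \<exists>y\<in>K. u = v + y)" for v
    using R[unfolded reach_def, rule_format, OF \<open>e > 0\<close> less_numeral_extra(1), of v] by simp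
  obtain L1 u1 y1 where 1: "L1 > 0" "e dvd L1" "u1 \<in> S L1" "y1 \<in> K" "u1 = w + y1"
    using reach1[of w] by blast
  obtain L2 u2 y2 where 2: "L2 > 0" "e dvd L2" "u2 \<in> S L2" "y2 \<in> K" "u2 = - w + y2"
    using reach1[of "- w"] by blast
  \<comment> \<open>\<open>X\<close> is the height of the \<open>p\<close>-fold repetition of the
    first loop. The drifts of its stages sum to \<open>L1 \<delta> (0 + 1 + ... + (p - 1))\<close>;
    the factor 2 avoids halving.\<close>
  have pow1: "\<exists>X\<in>S (p * L1). X - int p *s w \<in> K \<and> 2 * idot c X = 2 * int p * idot c u1 + int L1 * \<delta> * int p * (int p - 1)"
    if "p > 0" for p using that
  proof (induction p rule: nat_induct_non_zero)
    case 1 show ?case using \<open>u1 \<in> S L1\<close> \<open>y1 \<in> K\<close> \<open>u1 = w + y1\<close>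
      by (intro bexI[of _ u1]) auto
  next
    case (Suc p)
    then obtain X where X: "X \<in> S (p * L1)" "X - int p *s w \<in> K"
      "2 * idot c X = 2 * int p * idot c u1 + int L1 * \<delta> * int p * (int p - 1)" by blast
    have "Bi L1 X + u1 - int (Suc p) *s w = (Bi L1 X - int p *s w) + y1"
      using 1(5) by (simp add: vec_eq_iff algebra_simps)
    then have "Bi L1 X + u1 - int (Suc p) *s w \<in> K"
      using Kadd[OF conjunct1[OF drift[OF X(2), of L1]] 1(4)] by (simp only:)
    moreover have "2 * idot c (Bi L1 X + u1) = 2 * int (Suc p) * idot c u1 + int L1 * \<delta> * int (Suc p) * (int (Suc p) - 1)"
      using drift[OF X(2), of L1] X(3) by (simp add: algebra_simps)
    moreover have "Suc p * L1 = p * L1 + L1" by simp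
    then have "Bi L1 X + u1 \<in> S (Suc p * L1)" using comp[OF X(1) 1(3)] by (simp only:)
    ultimately show ?case by blast
  qed
  have pow2: "\<exists>X\<in>S (p * L2). X + int p *s w \<in> K \<and> 2 * idot c X = 2 * int p * idot c u2 - int L2 * \<delta> * int p * (int p - 1)"
    if "p > 0" for p using that
  proof (induction p rule: nat_induct_non_zero)
    case 1 show ?case using \<open>u2 \<in> S L2\<close> \<open>y2 \<in> K\<close> \<open>u2 = - w + y2\<close>
      by (intro bexI[of _ u2]) auto
  next
    case (Suc p)
    then obtain X where X: "X \<in> S (p * L2)" "X + int p *s w \<in> K"
      "2 * idot c X = 2 * int p * idot c u2 - int L2 * \<delta> * int p * (int p - 1)" by blast
    have "Bi L2 X + u2 + int (Suc p) *s w = (Bi L2 X + int p *s w) + y2"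
      using 2(5) by (simp add: vec_eq_iff algebra_simps)
    then have "Bi L2 X + u2 + int (Suc p) *s w \<in> K"
      using Kadd[OF conjunct1[OF drift'[OF X(2), of L2]] 2(4)] by (simp only:)
    moreover have "2 * idot c (Bi L2 X + u2) = 2 * int (Suc p) * idot c u2 - int L2 * \<delta> * int (Suc p) * (int (Suc p) - 1)"
      using drift'[OF X(2), of L2] X(3) by (simp add: algebra_simps)
    moreover have "Suc p * L2 = p * L2 + L2" by simp
    then have "Bi L2 X + u2 \<in> S (Suc p * L2)" using comp[OF X(1) 2(3)] by (simp only:)
    ultimately show ?case by blast
  qed
  \<comment> \<open>\<open>g\<close> gives the only contribution that is linear in \<open>p\<close>
    and has the same sign in both orders of concatenation. The choice of \<open>p\<close> makes the
    quadratic term exceed it.\<close>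
  define g where "g = idot c u1 + idot c u2"
  define p where "p = nat \<bar>g\<bar> + 2"
  have "p > 0" by (simp add: p_def)
  obtain X where X: "X \<in> S (p * L1)" "X - int p *s w \<in> K"
      "2 * idot c X = 2 * int p * idot c u1 + int L1 * \<delta> * int p * (int p - 1)" using pow1[OF \<open>p > 0\<close>] by blast
  obtain Y where Y: "Y \<in> S (p * L2)" "Y + int p *s w \<in> K"
      "2 * idot c Y = 2 * int p * idot c u2 - int L2 * \<delta> * int p * (int p - 1)" using pow2[OF \<open>p > 0\<close>] by blast
  let ?XY = "Bi (p * L2) X + Y" and ?YX = "Bi (p * L1) Y + X"
  have "?XY = (Bi (p * L2) X - int p *s w) + (Y + int p *s w)" by simp
  then have XYK: "?XY \<in> K" using drift[OF X(2), of "p * L2"] Y(2) Kadd by metis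
  have "?YX = (Bi (p * L1) Y + int p *s w) + (X - int p *s w)" by simp
  then have YXK: "?YX \<in> K" using drift'[OF Y(2), of "p * L1"] X(2) Kadd by metis
  have "\<delta> > 0" using w by (simp add: \<delta>_def)
  define q where "q = int p"
  have q: "q = \<bar>g\<bar> + 2" by (simp add: q_def p_def)
  have grow: "\<delta> * (a * q + b) > 2 * \<bar>g\<bar>" if "a \<ge> 2" "a + b \<ge> 0" for a b
  proof -
    have "2 * \<bar>g\<bar> < 2 * (q - 1)" using q by simp
    also have "\<dots> \<le> a * (q - 1)" using that q by (intro mult_right_mono) auto
    also have "\<dots> \<le> a * q + b" using that by (simp add: algebra_simps)
    also have "\<dots> \<le> \<delta> * (a * q + b)"
    proof -
      have "0 \<le> a * (q - 1)" using that q by auto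
      moreover have "a * (q - 1) = a * q - a" by (simp add: right_diff_distrib)
      ultimately have "0 \<le> a * q + b" using that by linarith
      then show ?thesis using \<open>\<delta> > 0\<close> mult_right_mono[of 1 \<delta> "a * q + b"] by simp
    qed
    finally show ?thesis .
  qed
  have "2 * idot c ?XY = q * (2 * g + \<delta> * ((int L1 + int L2) * q + (int L2 - int L1)))"
    using X(3) Y(3) drift[OF X(2), of "p * L2"] by (simp add: g_def q_def algebra_simps)
  moreover have "\<delta> * ((int L1 + int L2) * q + (int L2 - int L1)) > 2 * \<bar>g\<bar>"
    using 1(1) 2(1) by (intro grow) auto
  ultimately have XYp: "idot c ?XY > 0" using q by (smt (verit) zero_less_mult_iff)
  have "2 * idot c ?YX = q * (2 * g - \<delta> * ((int L1 + int L2) * q + (int L1 - int L2)))"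
    using X(3) Y(3) drift'[OF Y(2), of "p * L1"] by (simp add: g_def q_def algebra_simps)
  moreover have "\<delta> * ((int L1 + int L2) * q + (int L1 - int L2)) > 2 * \<bar>g\<bar>"
    using 1(1) 2(1) by (intro grow) auto
  ultimately have YXn: "idot c ?YX < 0" using q by (smt (verit) mult_pos_neg)
  have "e dvd p * L1 + p * L2" using 1 2 by auto
  then show ?thesis using comp[OF X(1) Y(1)] comp[OF Y(1) X(1)] XYK YXK XYp YXn \<open>p > 0\<close> 1(1)
    by (intro bexI[of _ ?XY] bexI[of _ ?YX] exI[of _ "p * L1 + p * L2"] conjI) (auto simp: add.commute)
qed

text \<open>Outer induction over the filtration, inner induction over finitely many functionals that
  determine the next level. If \<open>c\<close> vanishes on the current subgroup, nothing changes;
  otherwise \<open>reach_step\<close> needs loops with both signs of \<open>c\<close>.\<close>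

lemma reach_ann_Cf: "reach (ann (Cf j))"
proof (induction j)
  case 0
  have "ann (Cf 0) = UNIV"
    by (auto simp: ann_def Cf_def)
  then show ?case using residues by (auto simp: reach_def)
next
  case (Suc j)
  obtain F where F: "finite F" "F \<subseteq> Cf (Suc j)"
    "\<And>c. (\<forall>b\<in>F. idot c b = 0) \<Longrightarrow> (\<forall>x\<in>Cf (Suc j). idot c x = 0)"
    using finite_determining_subset[of "Cf (Suc j)"] by metis
  have "reach (ann (Cf j \<union> Y))" if "finite Y" "Y \<subseteq> Cf (Suc j)" for Y
    using that
  proof (induction Y rule: finite_induct)
    case empty then show ?case using Suc.IH by simp
  next
    case (insert c Y)
    let ?K = "ann (Cf j \<union> Y)"
    have R: "reach ?K" and c: "c \<in> Cf (Suc j)" using insert by auto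
    have eq: "ann (Cf j \<union> insert c Y) = ?K \<inter> {x. idot c x = 0}" by (auto simp: ann_def)
    have sub: "Cf j \<union> Y \<subseteq> Cf (Suc j)" using insert Cf_Suc by auto
    have Kj: "?K \<subseteq> ann (Cf j)" by (auto simp: ann_def)
    have DK: "D x \<in> ?K" if "x \<in> ?K" for x
    proof -
      have "\<forall>b\<in>Cf j \<union> Y. idot b (D x) = 0" using Cf_D sub Kj that by blast
      then show ?thesis by (simp add: ann_def)
    qed
    have cD: "idot c (D x) = 0" if "x \<in> ?K" for x using Cf_D[OF c] Kj that by blast
    show ?case
    proof (cases "\<forall>x\<in>?K. idot c x = 0")
      case True
      then have "ann (Cf j \<union> insert c Y) = ?K" unfolding eq by auto
      then show ?thesis using R by simp
    next
      case False
      then obtain x0 where x0: "x0 \<in> ?K" "idot c x0 \<noteq> 0" by blast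
      define x where "x = (if idot c x0 > 0 then x0 else - x0)"
      have x: "x \<in> ?K" "idot c x > 0" using x0 subgrp_ann[of "Cf j \<union> Y"]
        by (auto simp: x_def subgrp_def)
      have "\<exists>x\<in>?K. \<exists>y\<in>?K. \<exists>i>0. \<exists>j>0. e dvd i \<and> e dvd j \<and> x \<in> S i \<and> y \<in> S j \<and> idot c x > 0 \<and> idot c y < 0"
        if e: "e > 0" for e
      proof (cases j)
        case 0
        \<comment> \<open>On the bottom level all functionals are invariant and the current subgroup
          contains \<open>ann (Cf 1)\<close>, so the assumption \<open>abelian\<close>, applied to
          \<open>x\<close> and to \<open>-x\<close>, provides both signs.\<close>
        have K0: "v \<in> ?K" if "v \<in> ann (Cf 1)" for v
          using that sub 0 by (auto simp: ann_def)
        have s: "subgrp ?K" by (rule subgrp_ann)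
        obtain m1 i1 f1 where 1: "m1 > 0" "i1 > 0" "e dvd i1" "f1 \<in> ann (Cf 1)" "m1 *s x + f1 \<in> S i1"
          using abelian[OF e] by blast
        obtain m2 i2 f2 where 2: "m2 > 0" "i2 > 0" "e dvd i2" "f2 \<in> ann (Cf 1)" "m2 *s (- x) + f2 \<in> S i2"
          using abelian[OF e] by blast
        have "- x \<in> ?K" using s x(1) by (simp add: subgrp_def)
        then have "m1 *s x + f1 \<in> ?K" "m2 *s (- x) + f2 \<in> ?K"
          using s subgrp_smult[OF s x(1)] subgrp_smult[OF s] K0[OF 1(4)] K0[OF 2(4)] by (simp_all only: subgrp_def)
        moreover have "idot c f1 = 0" "idot c f2 = 0" using c 0 1(4) 2(4) by (auto simp: ann_def)
        then have "idot c (m1 *s x + f1) > 0" "idot c (m2 *s (- x) + f2) < 0" using 1(1) 2(1) x(2) by auto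
        ultimately show ?thesis using 1 2 by blast
      next
        case (Suc j')
        \<comment> \<open>From the second level on, \<open>x\<close> is annihilated by all invariant
          functionals. These are exactly the functionals vanishing on \<open>range D\<close>, so a
          multiple of \<open>x\<close> is some \<open>D w\<close>, and \<open>w\<close> is the
          vector for the commutator.\<close>
        have "\<exists>m>0. m *s x \<in> range D"
        proof (rule multiple_in_subgroup)
          have "0 \<in> range D" "D a + D b \<in> range D" "- D a \<in> range D" for a b
            using D_simps(1)[of a b] D_simps(4) D_simps(5)[of a] by (metis rangeI)+
          then show "subgrp (range D)" unfolding subgrp_def by blast
          fix b assume "\<forall>y\<in>range D. idot b y = 0"
          then have "b \<in> Cf j" using Cf_1_subset[of j'] Cf_1 Suc by auto
          then show "idot b x = 0" using x Kj by (auto simp: ann_def)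
        qed
        then obtain m w where m: "m > 0" "D w = m *s x" by force
        show ?thesis
        proof (rule commutator_signs[OF subgrp_ann DK cD R _ _ e])
          show "D w \<in> ?K" unfolding m using subgrp_smult[OF subgrp_ann x(1)] .
          show "idot c (D w) > 0" using m x(2) by simp
        qed
      qed
      from reach_step[OF subgrp_ann ann_divide DK cD this R]
      show ?thesis unfolding eq .
    qed
  qed
  from this[OF F(1,2)] have "reach (ann (Cf j \<union> F))" .
  moreover have "ann (Cf j \<union> F) = ann (Cf (Suc j))"
    using F Cf_Suc[of j] by (fastforce simp: ann_def idot_commute)
  ultimately show ?case by simp
qed

text \<open>Nilpotency makes \<open>Cf d\<close> the set of all functionals, so the error left by
  \<open>reach\<close> is 0 even for the modulus 1.\<close>

theorem all_heights:
  assumes "k > 0" shows "\<exists>n>0. k dvd n \<and> w \<in> S n"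
proof -
  have "x = 0" if "x \<in> ann (Cf d)" for x
    using that idot_self(2)[of x] by (auto simp: ann_def Cf_d)
  moreover obtain n u y where "n > 0" "k dvd n" "u \<in> S n" "y \<in> ann (Cf d)" "u = w + int 1 *s y"
    using reach_ann_Cf[of d, unfolded reach_def, rule_format, OF assms less_numeral_extra(1), of w] by blast
  ultimately show ?thesis by (metis add.right_neutral vector_smult_rzero)
qed

end

subsection \<open>Walks in the skew graph\<close>

lemma mpow_Suc_vec: "mpow A (Suc k) *v x = A *v (mpow A k *v x)"
  by (simp add: mpow_def matrix_vector_mul_assoc)

lemma mpow_0_vec: "mpow A 0 *v x = x"
  by (simp add: mpow_def)

lemma mpow_add_vec: "mpow A (m + n) *v x = mpow A m *v (mpow A n *v x)"
  by (induction m) (simp_all add: mpow_Suc_vec mpow_0_vec)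

lemma funpow_shift: "(shift ^^ n) s = (\<lambda>i. s (i + int n))"
  by (induction n) (simp_all add: shift_def algebra_simps)

lemma SFT_translate: assumes "s \<in> SFT C" shows "(\<lambda>i. s (i + k)) \<in> SFT C"
proof -
  have "C (s (i + k)) (s (i + 1 + k))" for i
    using assms[unfolded SFT_def mem_Collect_eq, rule_format, of "i + k"] by (simp add: ac_simps)
  then show ?thesis by (simp add: SFT_def)
qed

definition cs :: "(int^'d) set \<Rightarrow> int^'d \<Rightarrow> (int^'d) set" where
  "cs \<Gamma> g = (\<lambda>y. g + y) ` \<Gamma>"

lemma cosets_eq: "cosets \<Gamma> = range (cs \<Gamma>)"
  by (simp add: cosets_def cs_def[abs_def])

lemma cs_eq_iff:
  assumes "subgrp \<Gamma>" shows "cs \<Gamma> g = cs \<Gamma> g' \<longleftrightarrow> g - g' \<in> \<Gamma>"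
proof
  assume eq: "cs \<Gamma> g = cs \<Gamma> g'"
  have "g \<in> cs \<Gamma> g" using assms by (auto simp: cs_def subgrp_def image_iff intro!: bexI[of _ 0])
  then show "g - g' \<in> \<Gamma>" unfolding eq by (auto simp: cs_def)
next
  assume d: "g - g' \<in> \<Gamma>"
  have *: "cs \<Gamma> g \<subseteq> cs \<Gamma> g'" if "g - g' \<in> \<Gamma>" for g g'
  proof
    fix x assume "x \<in> cs \<Gamma> g"
    then obtain y where "y \<in> \<Gamma>" "x = g' + ((g - g') + y)" by (auto simp: cs_def)
    then show "x \<in> cs \<Gamma> g'" using that assms unfolding cs_def subgrp_def by blast
  qed
  have "g' - g \<in> \<Gamma>" using d assms by (metis minus_diff_eq subgrp_def)
  with * d show "cs \<Gamma> g = cs \<Gamma> g'" by blast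
qed

lemma finite_bounded_lattice: "finite {x :: int^'d. \<forall>i. x $ i \<in> F i}" if "\<And>i. finite (F i)"
proof -
  have "{x :: int^'d. \<forall>i. x $ i \<in> F i} \<subseteq> (\<lambda>f. \<chi> i. f i) ` (PiE UNIV F)"
  proof
    fix x :: "int^'d" assume "x \<in> {x. \<forall>i. x $ i \<in> F i}"
    then show "x \<in> (\<lambda>f. \<chi> i. f i) ` (PiE UNIV F)"
      by (intro image_eqI[of _ _ "\<lambda>i. x $ i"]) auto
  qed
  moreover have "finite (PiE (UNIV :: 'd set) F)" using that by (intro finite_PiE) auto
  ultimately show ?thesis using finite_surj by blast
qed

definition multiples :: "nat \<Rightarrow> (int^'d) set" where
  "multiples r = range (\<lambda>x. int r *s x)"

lemma subgrp_multiples: "subgrp (multiples r)"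
proof -
  have "int r *s x + int r *s y = int r *s (x + y)" "- (int r *s x) = int r *s (- x)" "0 = int r *s (0 :: int^'d)" for x y :: "int^'d"
    by (simp_all add: vec_eq_iff algebra_simps)
  then show ?thesis unfolding subgrp_def multiples_def by blast
qed

lemma finite_index_multiples:
  assumes "r > 0" shows "finite_index (multiples r :: (int^'d) set)"
proof -
  have "cosets (multiples r) \<subseteq> cs (multiples r) ` {x :: int^'d. \<forall>i. x $ i \<in> {0..<int r}}"
  proof
    fix c assume "c \<in> cosets (multiples r :: (int^'d) set)"
    then obtain x :: "int^'d" where x: "c = cs (multiples r) x" by (auto simp: cosets_eq)
    define y :: "int^'d" where "y = (\<chi> i. x $ i mod int r)"
    have "x - y = int r *s (\<chi> i. x $ i div int r)" by (simp add: vec_eq_iff y_def minus_mod_eq_mult_div)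
    then have "c = cs (multiples r) y" unfolding x cs_eq_iff[OF subgrp_multiples] by (auto simp: multiples_def)
    moreover have "y $ i \<in> {0..<int r}" for i using assms by (simp add: y_def)
    ultimately show "c \<in> cs (multiples r) ` {x. \<forall>i. x $ i \<in> {0..<int r}}" by blast
  qed
  moreover have "finite {x :: int^'d. \<forall>i. x $ i \<in> {0..<int r}}" by (rule finite_bounded_lattice) simp
  ultimately show ?thesis unfolding finite_index_def using finite_surj by blast
qed

locale skew_system =
  fixes C :: "'a::finite \<Rightarrow> 'a \<Rightarrow> bool" and A A' :: "int^'d^'d" and h :: "'a \<Rightarrow> 'a \<Rightarrow> int^'d"
  assumes A_inverse: "A ** A' = mat 1" "A' ** A = mat 1"
begin

lemma A_cancel[simp]: "A *v (A' *v x) = x" "A' *v (A *v x) = x"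
  by (simp_all add: matrix_vector_mul_assoc A_inverse)

abbreviation Ap :: "nat \<Rightarrow> int^'d \<Rightarrow> int^'d" where "Ap n x \<equiv> mpow A n *v x"

definition gseq :: "(int \<Rightarrow> 'a) \<Rightarrow> int^'d \<Rightarrow> nat \<Rightarrow> int^'d" where
  "gseq s g n = snd ((skew A h ^^ n) (s, g))"

lemma skew_pow: "(skew A h ^^ n) (s, g) = ((\<lambda>i. s (i + int n)), gseq s g n)"
proof -
  have "fst ((skew A h ^^ n) (s, g)) = (\<lambda>i. s (i + int n))"
    by (induction n) (auto simp: skew_def shift_def split_beta algebra_simps)
  then show ?thesis by (simp add: gseq_def prod_eq_iff)
qed

lemma gseq_0[simp]: "gseq s g 0 = g" by (simp add: gseq_def)

lemma gseq_Suc: "gseq s g (Suc n) = A *v gseq s g n + h (s (int n)) (s (int n + 1))"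
  by (simp add: gseq_def[of _ _ "Suc n"] skew_pow) (simp add: skew_def add.commute)

lemma gseq_add: "gseq s g (m + n) = gseq (\<lambda>i. s (i + int m)) (gseq s g m) n"
  by (induction n) (simp_all add: gseq_Suc algebra_simps)

lemma gseq_cong: "(\<And>i. i \<le> n \<Longrightarrow> s (int i) = s' (int i)) \<Longrightarrow> gseq s g n = gseq s' g n"
proof (induction n)
  case (Suc n)
  have "s (int n) = s' (int n)" "s (int n + 1) = s' (int n + 1)"
    using Suc.prems[of n] Suc.prems[of "Suc n"] by (simp_all add: add.commute)
  then show ?case using Suc by (simp add: gseq_Suc)
qed simp

lemma gseq_translate: "gseq s (g + u) n = gseq s g n + Ap n u"
  by (induction n) (simp_all add: gseq_Suc mpow_Suc_vec mpow_0_vec matrix_vector_right_distrib)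

text \<open>Since \<open>A\<close> is invertible, the fibre coordinate may be prescribed at a later
  time of the orbit instead of at time 0.\<close>

lemma gseq_start: "\<exists>g. gseq s g n = g'"
proof (induction n arbitrary: g')
  case (Suc n)
  obtain g where "gseq s g n = A' *v (g' - h (s (int n)) (s (int n + 1)))" using Suc by blast
  then have "gseq s g (Suc n) = g'" by (simp add: gseq_Suc)
  then show ?case by blast
qed auto

text \<open>\<open>C\<close> may have dead ends; only walks between states on bi-infinite paths can
  be prolonged to points of the shift.\<close>

definition occ :: "'a \<Rightarrow> bool" where "occ a \<longleftrightarrow> (\<exists>s\<in>SFT C. s 0 = a)"

lemma occ_point: "s \<in> SFT C \<Longrightarrow> occ (s i)"
  using SFT_translate[of s C i] unfolding occ_def by (intro bexI[of _ "\<lambda>j. s (j + i)"]) auto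

text \<open>The slack \<open>\<Gamma>\<close> treats two graphs at once: \<open>{0}\<close> gives
  the graph of the skew product, and an invariant subgroup gives the graph of the quotient without
  passing to cosets.\<close>

definition step :: "(int^'d) set \<Rightarrow> 'a \<times> (int^'d) \<Rightarrow> 'a \<times> (int^'d) \<Rightarrow> bool" where
  "step \<Gamma> x y \<longleftrightarrow> C (fst x) (fst y) \<and> snd y - (A *v snd x + h (fst x) (fst y)) \<in> \<Gamma>"

definition walk :: "(int^'d) set \<Rightarrow> nat \<Rightarrow> 'a \<times> (int^'d) \<Rightarrow> 'a \<times> (int^'d) \<Rightarrow> bool" where
  "walk \<Gamma> n = (step \<Gamma> ^^ n)"

lemma walk_0[simp]: "walk \<Gamma> 0 x y \<longleftrightarrow> x = y" by (simp add: walk_def)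

lemma walk_1[simp]: "walk \<Gamma> (Suc 0) x y \<longleftrightarrow> step \<Gamma> x y"
  by (auto simp: walk_def OO_def)

lemma walk_trans: "walk \<Gamma> m x y \<Longrightarrow> walk \<Gamma> n y z \<Longrightarrow> walk \<Gamma> (m + n) x z"
  unfolding walk_def by (auto simp: relpowp_add)

lemma walk_loop: "walk \<Gamma> n x x \<Longrightarrow> walk \<Gamma> (k * n) x x"
  by (induction k) (auto intro: walk_trans)

definition good :: "(int^'d) set \<Rightarrow> bool" where
  "good \<Gamma> \<longleftrightarrow> subgrp \<Gamma> \<and> (\<lambda>x. A *v x) ` \<Gamma> = \<Gamma>"

lemma good_zero: "good {0}" by (simp add: good_def subgrp_def)

lemma good_multiples: "good (multiples r)"
proof -
  have "(\<lambda>x. A *v x) ` multiples r = multiples r"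
  proof (intro equalityI subsetI)
    have e: "B *v (int r *s x) = int r *s (B *v x)" for B :: "int^'d^'d" and x
      by (simp add: matrix_vector_mult_def vec_eq_iff sum_distrib_left ac_simps)
    show "y \<in> multiples r" if "y \<in> (\<lambda>x. A *v x) ` multiples r" for y
      using that e by (auto simp: multiples_def)
    show "y \<in> (\<lambda>x. A *v x) ` multiples r" if y: "y \<in> multiples r" for y
    proof -
      obtain x where "y = int r *s x" using y by (auto simp: multiples_def)
      then have "y = A *v (int r *s (A' *v x))" using e by simp
      then show ?thesis by (auto simp: multiples_def)
    qed
  qed
  then show ?thesis by (simp add: good_def subgrp_multiples)
qed

lemma Ap_image: "good \<Gamma> \<Longrightarrow> Ap n ` \<Gamma> = \<Gamma>"
proof (induction n)
  case (Suc n)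
  have "Ap (Suc n) ` \<Gamma> = (\<lambda>x. A *v x) ` (Ap n ` \<Gamma>)" by (simp add: image_image mpow_Suc_vec)
  then show ?case using Suc by (simp add: good_def)
qed (simp add: mpow_0_vec)

lemma good_subgrp: "good \<Gamma> \<Longrightarrow> subgrp \<Gamma>" by (simp add: good_def)

lemma good_0: "good \<Gamma> \<Longrightarrow> 0 \<in> \<Gamma>" by (simp add: good_def subgrp_def)

lemma good_Ap: "good \<Gamma> \<Longrightarrow> x \<in> \<Gamma> \<Longrightarrow> Ap n x \<in> \<Gamma>" using Ap_image by blast

lemma gseq_mod: "good \<Gamma> \<Longrightarrow> g - g' \<in> \<Gamma> \<Longrightarrow> gseq s g n - gseq s g' n \<in> \<Gamma>"
  using gseq_translate[of s g' "g - g'" n] good_Ap[of \<Gamma> "g - g'" n] by simp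

lemma walk_along:
  assumes \<Gamma>: "good \<Gamma>" and s: "s \<in> SFT C" and ij: "i < j"
    and u: "gseq s g i - u \<in> \<Gamma>" and v: "gseq s g j - v \<in> \<Gamma>"
  shows "walk \<Gamma> (j - i) (s (int i), u) (s (int j), v)"
proof -
  have sub: "x - y \<in> \<Gamma>" if "x \<in> \<Gamma>" "y \<in> \<Gamma>" for x y
    using subgrp_diff[OF good_subgrp[OF \<Gamma>] that] .
  have e: "C (s (int k)) (s (int (Suc k)))" for k using s by (simp add: SFT_def add.commute[of 1])
  have st: "step \<Gamma> (s (int k), x) (s (int (Suc k)), y)" if "gseq s g k - x \<in> \<Gamma>" "gseq s g (Suc k) - y \<in> \<Gamma>" for k x y
  proof -
    have "A *v (gseq s g k - x) \<in> \<Gamma>" using \<Gamma> that(1) by (auto simp: good_def)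
    from sub[OF this that(2)] have "y - (A *v x + h (s (int k)) (s (int k + 1))) \<in> \<Gamma>"
      by (simp add: gseq_Suc matrix_vector_mult_diff_distrib algebra_simps)
    then show ?thesis using e by (simp add: step_def add.commute)
  qed
  have "walk \<Gamma> k (s (int i), u) (s (int (i + k)), v)" if "k > 0" "gseq s g (i + k) - v \<in> \<Gamma>" for k v
    using that
  proof (induction k arbitrary: v rule: nat_induct_non_zero)
    case 1 then show ?case using st[OF u, of v] by simp
  next
    case (Suc k)
    have 0: "gseq s g (i + k) - gseq s g (i + k) \<in> \<Gamma>" using good_0[OF \<Gamma>] by simp
    have "walk \<Gamma> 1 (s (int (i + k)), gseq s g (i + k)) (s (int (i + Suc k)), v)"
      using st[OF 0, of v] Suc.prems by simp
    from walk_trans[OF Suc.IH[OF 0] this] show ?case by simp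
  qed
  from this[of "j - i" v] ij v show ?thesis by simp
qed

text \<open>The walk is spliced between the past of \<open>s\<close> and the future of
  \<open>s'\<close>, so that the point produced lies in prescribed cylinders at both ends.
  Invariance of \<open>\<Gamma>\<close> keeps the accumulated slack in
  \<open>\<Gamma>\<close>.\<close>

lemma walk_realise:
  assumes \<Gamma>: "good \<Gamma>" and w: "walk \<Gamma> n (s 0, g) (s' 0, g')" and s: "s \<in> SFT C" "s' \<in> SFT C"
  obtains t where "t \<in> SFT C" "\<And>i. i \<le> 0 \<Longrightarrow> t i = s i" "\<And>i. i \<ge> 0 \<Longrightarrow> t (i + int n) = s' i"
    "gseq t g n - g' \<in> \<Gamma>"
proof -
  obtain f where f: "f 0 = (s 0, g)" "f n = (s' 0, g')" "\<And>i. i < n \<Longrightarrow> step \<Gamma> (f i) (f (Suc i))"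
    using w unfolding walk_def relpowp_fun_conv by blast
  define t where "t i = (if i < 0 then s i else if i \<le> int n then fst (f (nat i)) else s' (i - int n))" for i
  have tf: "t (int k) = fst (f k)" if "k \<le> n" for k using that by (simp add: t_def)
  have "t \<in> SFT C" unfolding SFT_def
  proof (intro CollectI allI)
    fix i
    consider "i < 0" | "0 \<le> i" "i < int n" | "i \<ge> int n" by linarith
    then show "C (t i) (t (i + 1))"
    proof cases
      case 1
      then have "t i = s i" by (simp add: t_def)
      moreover have "t (i + 1) = s (i + 1)"
        using 1 f(1) by (cases "i = - 1") (auto simp: t_def)
      ultimately have "t i = s i" "t (i + 1) = s (i + 1)" by simp_all
      then show ?thesis using s by (simp add: SFT_def)
    next
      case 2
      then obtain k where k: "i = int k" "k < n" by (metis of_nat_less_iff zero_le_imp_eq_int)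
      then have "t i = fst (f k)" "t (i + 1) = fst (f (Suc k))" using tf[of k] tf[of "Suc k"] by (auto simp: add.commute)
      then show ?thesis using f(3)[OF k(2)] by (simp add: step_def)
    next
      case 3
      then have "t i = s' (i - int n)" "t (i + 1) = s' (i - int n + 1)" using f(2)
        by (auto simp: t_def algebra_simps)
      then show ?thesis using s by (simp add: SFT_def)
    qed
  qed
  moreover have "t i = s i" if "i \<le> 0" for i using that f(1) by (auto simp: t_def)
  moreover have "t (i + int n) = s' i" if "i \<ge> 0" for i using that f(2) by (auto simp: t_def)
  moreover have "k \<le> n \<Longrightarrow> gseq t g k - snd (f k) \<in> \<Gamma>" for k
  proof (induction k)
    case 0 then show ?case using f(1) good_0[OF \<Gamma>] by simp
  next
    case (Suc k)
    then have "A *v (gseq t g k - snd (f k)) \<in> \<Gamma>" using \<Gamma> by (auto simp: good_def)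
    moreover have "snd (f (Suc k)) - (A *v snd (f k) + h (t (int k)) (t (int k + 1))) \<in> \<Gamma>"
      using f(3)[of k] Suc.prems tf[of k] tf[of "Suc k"] by (simp add: step_def add.commute)
    ultimately have "A *v (gseq t g k - snd (f k)) - (snd (f (Suc k)) - (A *v snd (f k) + h (t (int k)) (t (int k + 1)))) \<in> \<Gamma>"
      by (rule subgrp_diff[OF good_subgrp[OF \<Gamma>]])
    then show ?case by (simp add: gseq_Suc matrix_vector_mult_diff_distrib add_diff_eq)
  qed
  from this[of n] have "gseq t g n - g' \<in> \<Gamma>" using f(2) by simp
  ultimately show ?thesis using that by blast
qed

lemma walk_realise':
  assumes \<Gamma>: "good \<Gamma>" and w: "walk \<Gamma> n (a, g) (b, g')" and "occ a" "occ b"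
  obtains t where "t \<in> SFT C" "t 0 = a" "t (int n) = b" "gseq t g n - g' \<in> \<Gamma>"
proof -
  obtain s s' where s: "s \<in> SFT C" "s' \<in> SFT C" "a = s 0" "b = s' 0" using assms by (auto simp: occ_def)
  from walk_realise[OF \<Gamma> w[unfolded s(3,4)] s(1,2)] obtain t where
    t: "t \<in> SFT C" "\<And>i. i \<le> 0 \<Longrightarrow> t i = s i" "\<And>i. i \<ge> 0 \<Longrightarrow> t (i + int n) = s' i" "gseq t g n - g' \<in> \<Gamma>" by blast
  from t(2)[of 0] t(3)[of 0] t(1,4) s(3,4) show ?thesis using that[of t] by simp
qed

end

subsection \<open>From transitivity to walks\<close>

lemma topspace_SFT_top[simp]: "topspace (SFT_top C) = SFT C"
  by (simp add: SFT_top_def)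

lemma openin_cylinder:
  assumes "finite I"
  shows "openin (SFT_top C) {t\<in>SFT C. \<forall>i\<in>I. t i = w i}"
proof -
  have "openin (product_topology (\<lambda>i::int. discrete_topology (UNIV :: 'a set)) UNIV)
      (PiE UNIV (\<lambda>i. if i \<in> I then {w i} else UNIV))"
    using assms by (subst openin_PiE_gen) (auto intro: finite_subset[of _ I])
  moreover have "{t\<in>SFT C. \<forall>i\<in>I. t i = w i} = PiE UNIV (\<lambda>i. if i \<in> I then {w i} else UNIV) \<inter> SFT C"
    by (auto simp: PiE_iff split: if_splits)
  ultimately show ?thesis unfolding SFT_top_def openin_subtopology by blast
qed

lemma openin_SFT_top_cylinder:
  assumes "openin (SFT_top C) U" "s \<in> U"
  obtains m where "\<And>t. t \<in> SFT C \<Longrightarrow> (\<And>i. \<bar>i\<bar> \<le> int m \<Longrightarrow> t i = s i) \<Longrightarrow> t \<in> U"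
proof -
  obtain T where T: "openin (product_topology (\<lambda>i::int. discrete_topology (UNIV :: 'a set)) UNIV) T" "U = T \<inter> SFT C"
    using assms(1) by (auto simp: SFT_top_def openin_subtopology)
  with assms(2) obtain X where X: "finite {i. X i \<noteq> (UNIV :: 'a set)}" "s \<in> PiE UNIV X" "PiE UNIV X \<subseteq> T"
    unfolding openin_product_topology_alt by (auto simp: topspace_discrete_topology)
  define m where "m = (\<Sum>i | X i \<noteq> UNIV. nat \<bar>i\<bar>)"
  have m: "\<bar>i\<bar> \<le> int m" if "X i \<noteq> UNIV" for i
  proof -
    have "nat \<bar>i\<bar> \<le> m" unfolding m_def by (rule member_le_sum) (use that X(1) in auto)
    then show ?thesis by linarith
  qed
  show ?thesis
  proof (rule that)
    fix t assume t: "t \<in> SFT C" "\<And>i. \<bar>i\<bar> \<le> int m \<Longrightarrow> t i = s i"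
    have "t i \<in> X i" for i using m[of i] t(2)[of i] X(2) by (cases "X i = UNIV") (auto simp: PiE_iff)
    then show "t \<in> U" using X(3) T(2) t(1) by (auto simp: PiE_iff)
  qed
qed

lemma openin_prod_discrete_point:
  assumes "openin (prod_topology T (discrete_topology D)) W" "(s, g) \<in> W"
  obtains U where "openin T U" "s \<in> U" "U \<times> {g} \<subseteq> W"
proof -
  obtain U V where "openin T U" "s \<in> U" "g \<in> V" "U \<times> V \<subseteq> W"
    using assms(1)[unfolded openin_prod_topology_alt, rule_format, OF assms(2)] by blast
  then show ?thesis using that[of U] by blast
qed

lemma openin_prod_discrete:
  "openin T U \<Longrightarrow> g \<in> D \<Longrightarrow> openin (prod_topology T (discrete_topology D)) (U \<times> {g})"
  by (simp add: openin_prod_Times_iff)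

lemma top_transitiveD:
  assumes "top_transitive T f" "openin T U" "openin T V" "U \<noteq> {}" "V \<noteq> {}"
  obtains n x where "x \<in> U" "(f ^^ n) x \<in> V" | n x where "x \<in> V" "(f ^^ n) x \<in> U"
proof -
  obtain n where "(f ^^ n) ` U \<inter> V \<noteq> {} \<or> U \<inter> (f ^^ n) ` V \<noteq> {}"
    using assms(1)[unfolded top_transitive_def, rule_format, of U V] assms(2-) by blast
  then show ?thesis using that by blast
qed

lemma mixing_imp_totally_transitive:
  assumes "top_mixing T f" shows "totally_transitive T f"
  unfolding totally_transitive_def top_transitive_def
proof (intro allI impI)
  fix k :: nat and U V assume k: "k > 0" and UV: "openin T U \<and> openin T V \<and> U \<noteq> {} \<and> V \<noteq> {}"
  obtain N where N: "\<And>n. n \<ge> N \<Longrightarrow> (f ^^ n) ` U \<inter> V \<noteq> {}"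
    using assms UV unfolding top_mixing_def by metis
  have "k * N \<ge> N" using k by simp
  from N[OF this] show "\<exists>n. ((f ^^ k) ^^ n) ` U \<inter> V \<noteq> {} \<or> U \<inter> ((f ^^ k) ^^ n) ` V \<noteq> {}"
    unfolding funpow_mult by blast
qed

context skew_system
begin

lemma quot_map_cs:
  assumes \<Gamma>: "Ap k ` \<Gamma> = \<Gamma>"
  shows "quot_map (skew A h ^^ k) (s, cs \<Gamma> g) = ((\<lambda>i. s (i + int k)), cs \<Gamma> (gseq s g k))"
proof -
  have "(\<lambda>x. gseq s x k) ` cs \<Gamma> g = (\<lambda>u. gseq s g k + u) ` (Ap k ` \<Gamma>)"
    by (simp add: cs_def image_image gseq_translate)
  then show ?thesis by (simp add: quot_map_def skew_pow \<Gamma>, simp add: cs_def)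
qed

lemma quot_map_pow_cs:
  assumes \<Gamma>: "Ap k ` \<Gamma> = \<Gamma>"
  shows "(quot_map (skew A h ^^ k) ^^ n) (s, cs \<Gamma> g) = ((\<lambda>i. s (i + int (k * n))), cs \<Gamma> (gseq s g (k * n)))"
proof (induction n)
  case (Suc n)
  have "gseq s g (k * Suc n) = gseq (\<lambda>i. s (i + int (k * n))) (gseq s g (k * n)) k"
    using gseq_add[of s g "k * n" k] by (simp add: add.commute)
  then show ?case using Suc quot_map_cs[OF \<Gamma>] by (simp add: algebra_simps)
qed simp

lemma top_transitive_quot:
  assumes tr: "top_transitive (skew_top C) (skew A h ^^ k)" and \<Gamma>: "Ap k ` \<Gamma> = \<Gamma>"
  shows "top_transitive (quot_top C \<Gamma>) (quot_map (skew A h ^^ k))"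
  unfolding top_transitive_def
proof (intro allI impI)
  fix U V assume UV: "openin (quot_top C \<Gamma>) U \<and> openin (quot_top C \<Gamma>) V \<and> U \<noteq> {} \<and> V \<noteq> {}"
  let ?p = "\<lambda>(s, g). (s, cs \<Gamma> g) :: (int \<Rightarrow> 'a) \<times> (int^'d) set"
  let ?pre = "\<lambda>W. {x\<in>topspace (skew_top C). ?p x \<in> W}"
  have pre_open: "openin (skew_top C) (?pre W)" if W: "openin (quot_top C \<Gamma>) W" for W
    unfolding skew_top_def openin_prod_topology_alt
  proof (intro allI impI)
    fix s g assume "(s, g) \<in> {x \<in> topspace (prod_topology (SFT_top C) (discrete_topology UNIV)). ?p x \<in> W}"
    then have "(s, cs \<Gamma> g) \<in> W" by simp
    then obtain U where U: "openin (SFT_top C) U" "s \<in> U" "U \<times> {cs \<Gamma> g} \<subseteq> W"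
      using openin_prod_discrete_point W unfolding quot_top_def by metis
    then show "\<exists>U V. openin (SFT_top C) U \<and> openin (discrete_topology UNIV) V \<and> s \<in> U \<and> g \<in> V \<and>
       U \<times> V \<subseteq> {x \<in> topspace (prod_topology (SFT_top C) (discrete_topology UNIV)). ?p x \<in> W}"
      using openin_subset[OF U(1)] by (intro exI[of _ U] exI[of _ "{g}"]) auto
  qed
  have pre_ne: "?pre W \<noteq> {}" if W: "openin (quot_top C \<Gamma>) W" "W \<noteq> {}" for W
  proof -
    obtain s c where sc: "(s, c) \<in> W" using W(2) by auto
    then have "(s, c) \<in> SFT C \<times> cosets \<Gamma>" using openin_subset[OF W(1)] by (auto simp: quot_top_def)
    then obtain g where "c = cs \<Gamma> g" "s \<in> SFT C" by (auto simp: cosets_eq)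
    then have "(s, g) \<in> ?pre W" using sc by (simp add: skew_top_def)
    then show ?thesis by blast
  qed
  have semi: "?p (((skew A h ^^ k) ^^ n) x) = (quot_map (skew A h ^^ k) ^^ n) (?p x)" for n x
    by (cases x) (simp add: funpow_mult skew_pow quot_map_pow_cs[OF \<Gamma>])
  have UV': "openin (quot_top C \<Gamma>) U" "openin (quot_top C \<Gamma>) V" "U \<noteq> {}" "V \<noteq> {}" using UV by auto
  show "\<exists>n. (quot_map (skew A h ^^ k) ^^ n) ` U \<inter> V \<noteq> {} \<or> U \<inter> (quot_map (skew A h ^^ k) ^^ n) ` V \<noteq> {}"
    using top_transitiveD[OF tr pre_open[OF UV'(1)] pre_open[OF UV'(2)] pre_ne[OF UV'(1,3)] pre_ne[OF UV'(2,4)]]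
  proof cases
    case (1 n x)
    then have "?p x \<in> U" "?p (((skew A h ^^ k) ^^ n) x) \<in> V" by blast+
    then have "?p x \<in> U" "(quot_map (skew A h ^^ k) ^^ n) (?p x) \<in> V" by (simp_all only: semi)
    then show ?thesis by blast
  next
    case (2 n x)
    then have "?p x \<in> V" "?p (((skew A h ^^ k) ^^ n) x) \<in> U" by blast+
    then have "?p x \<in> V" "(quot_map (skew A h ^^ k) ^^ n) (?p x) \<in> U" by (simp_all only: semi)
    then show ?thesis by blast
  qed
qed

lemma subgrp_diff_trans: "subgrp \<Gamma> \<Longrightarrow> x - y \<in> \<Gamma> \<Longrightarrow> y - z \<in> \<Gamma> \<Longrightarrow> x - z \<in> \<Gamma>"
  for x y z :: "int^'d"
  using diff_add_cancel[of x y] unfolding subgrp_def by (metis add_diff_eq)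

section \<open>The graph form of total transitivity\<close>

definition quot_total :: "(int^'d) set \<Rightarrow> bool" where
  "quot_total \<Gamma> \<longleftrightarrow> (\<forall>k>0. top_transitive (quot_top C \<Gamma>) (quot_map (skew A h ^^ k)))"

text \<open>Transitivity tested on cylinders. The two alternatives are the two signs of the time in
  the definition of transitivity; the second one has to be turned round afterwards.\<close>

lemma quot_total_orbit:
  assumes \<Gamma>: "good \<Gamma>" and qt: "quot_total \<Gamma>" and k: "k > 0" and fin: "finite I" "finite J"
    and s: "s \<in> SFT C" "s' \<in> SFT C"
  obtains n t where "t \<in> SFT C" "\<And>i. i \<in> I \<Longrightarrow> t i = s i" "\<And>i. i \<in> J \<Longrightarrow> t (i + int (k * n)) = s' i"
      "gseq t g (k * n) - g' \<in> \<Gamma>"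
    | n t where "t \<in> SFT C" "\<And>i. i \<in> J \<Longrightarrow> t i = s' i" "\<And>i. i \<in> I \<Longrightarrow> t (i + int (k * n)) = s i"
      "gseq t g' (k * n) - g \<in> \<Gamma>"
proof -
  let ?f = "quot_map (skew A h ^^ k)"
  define U where "U = {t\<in>SFT C. \<forall>i\<in>I. t i = s i} \<times> {cs \<Gamma> g}"
  define V where "V = {t\<in>SFT C. \<forall>i\<in>J. t i = s' i} \<times> {cs \<Gamma> g'}"
  have o: "openin (quot_top C \<Gamma>) U" "openin (quot_top C \<Gamma>) V"
    unfolding quot_top_def U_def V_def
    by (intro openin_prod_discrete openin_cylinder fin; simp add: cosets_eq)+
  have "(s, cs \<Gamma> g) \<in> U" "(s', cs \<Gamma> g') \<in> V" using s by (auto simp: U_def V_def)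
  then have ne: "U \<noteq> {}" "V \<noteq> {}" by auto
  have tr: "top_transitive (quot_top C \<Gamma>) ?f" using qt k by (simp add: quot_total_def)
  note it = quot_map_pow_cs[OF Ap_image[OF \<Gamma>]]
  show ?thesis using top_transitiveD[OF tr o ne]
  proof cases
    case (1 n x)
    then obtain t where t: "x = (t, cs \<Gamma> g)" "t \<in> SFT C" "\<forall>i\<in>I. t i = s i" by (auto simp: U_def)
    from 1(2) show ?thesis using t that(1)[of t n] by (simp add: it V_def cs_eq_iff[OF good_subgrp[OF \<Gamma>]])
  next
    case (2 n x)
    then obtain t where t: "x = (t, cs \<Gamma> g')" "t \<in> SFT C" "\<forall>i\<in>J. t i = s' i" by (auto simp: V_def)
    from 2(2) show ?thesis using t that(2)[of t n] by (simp add: it U_def cs_eq_iff[OF good_subgrp[OF \<Gamma>]])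
  qed
qed

definition symmetric_walks :: "(int^'d) set \<Rightarrow> bool" where
  "symmetric_walks \<Gamma> \<longleftrightarrow> (\<forall>m a g b g'. occ a \<and> occ b \<and> walk \<Gamma> m (a, g) (b, g') \<longrightarrow> (\<exists>p>0. walk \<Gamma> p (b, g') (a, g)))"

text \<open>For \<open>{0}\<close> this turns out to be equivalent to total transitivity; for
  \<open>multiples r\<close> it is the form in which the total ftp is used.\<close>

definition free_walks :: "(int^'d) set \<Rightarrow> bool" where
  "free_walks \<Gamma> \<longleftrightarrow> (\<forall>k>0. \<forall>a g b g'. occ a \<and> occ b \<longrightarrow> (\<exists>n>0. k dvd n \<and> walk \<Gamma> n (a, g) (b, g')))"

text \<open>Transitivity of the power \<open>2j\<close>, applied to a cylinder \<open>U\<close> and its preimage under the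
  \<open>j\<close>-th iterate, forces \<open>U\<close> to return to itself after a time at least \<open>j\<close>.\<close>
lemma quot_total_symmetric_walks:
  assumes \<Gamma>: "good \<Gamma>" and qt: "quot_total \<Gamma>"
  shows "symmetric_walks \<Gamma>"
  unfolding symmetric_walks_def
proof (intro allI impI)
  fix m a g b g' assume "occ a \<and> occ b \<and> walk \<Gamma> m (a, g) (b, g')"
  then obtain t0 where t0: "t0 \<in> SFT C" "t0 0 = a" "t0 (int m) = b" "gseq t0 g m - g' \<in> \<Gamma>"
    using walk_realise'[OF \<Gamma>] by metis
  \<comment> \<open>\<open>t1\<close> is \<open>t0\<close> delayed by \<open>j\<close>, and the two
    cylinders are compared at multiples of \<open>2 * j\<close>. The delay between two visits to the
    cylinder of \<open>t0\<close> is therefore an odd multiple of \<open>j\<close>: it is never 0,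
    and it exceeds the length \<open>m\<close> of the walk to be closed.\<close>
  define j where "j = Suc m"
  define t1 where "t1 i = t0 (i - int j)" for i
  have t1: "t1 \<in> SFT C" using SFT_translate[OF t0(1), of "- int j"] by (simp add: t1_def[abs_def])
  obtain g1 where g1: "gseq t1 g1 j = g" using gseq_start by blast
  have z: "x - x \<in> \<Gamma>" for x :: "int^'d" using good_0[OF \<Gamma>] by simp
  have tri: "x - y \<in> \<Gamma> \<Longrightarrow> y - w \<in> \<Gamma> \<Longrightarrow> x - w \<in> \<Gamma>" for x y w :: "int^'d"
    using subgrp_diff_trans[OF good_subgrp[OF \<Gamma>]] by blast
  have gm: "gseq t u m - g' \<in> \<Gamma>" if "\<And>i. i \<le> m \<Longrightarrow> t (int i) = t0 (int i)" "u - g \<in> \<Gamma>" for t u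
  proof -
    have "gseq t u m = gseq t0 u m" using that(1) by (rule gseq_cong)
    then show ?thesis using tri[OF gseq_mod[OF \<Gamma> that(2)] t0(4)] by simp
  qed
  have "0 < 2 * j" by (simp add: j_def)
  then show "\<exists>p>0. walk \<Gamma> p (b, g') (a, g)"
  proof (rule quot_total_orbit[OF \<Gamma> qt _ _ _ t0(1) t1, of "2 * j" "{0..int m}" "{0..int (j + m)}" g g1])
    fix n t assume t: "t \<in> SFT C" "\<And>i. i \<in> {0..int m} \<Longrightarrow> t i = t0 i"
      "\<And>i. i \<in> {0..int (j + m)} \<Longrightarrow> t (i + int (2 * j * n)) = t1 i" "gseq t g (2 * j * n) - g1 \<in> \<Gamma>"
    let ?e = "2 * j * n + j"
    have X: "gseq t g m - g' \<in> \<Gamma>" by (rule gm) (use t(2) z in auto)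
    have "gseq t g ?e = gseq (\<lambda>i. t (i + int (2 * j * n))) (gseq t g (2 * j * n)) j" by (rule gseq_add)
    also have "\<dots> = gseq t1 (gseq t g (2 * j * n)) j" by (rule gseq_cong) (use t(3) in auto)
    finally have Y: "gseq t g ?e - g \<in> \<Gamma>" using gseq_mod[OF \<Gamma> t(4), of t1 j] g1 by simp
    have "t (int m) = b" using t(2)[of "int m"] t0 by simp
    moreover have "t (int ?e) = a" using t(3)[of "int j"] t0 by (simp add: t1_def add.commute)
    moreover have "m < ?e" by (simp add: j_def)
    ultimately show ?thesis using walk_along[OF \<Gamma> t(1) \<open>m < ?e\<close> X Y] by (intro exI[of _ "?e - m"]) auto
  next
    fix n t assume t: "t \<in> SFT C" "\<And>i. i \<in> {0..int (j + m)} \<Longrightarrow> t i = t1 i"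
      "\<And>i. i \<in> {0..int m} \<Longrightarrow> t (i + int (2 * j * n)) = t0 i" "gseq t g1 (2 * j * n) - g \<in> \<Gamma>"
    have gj: "gseq t g1 j = g" using gseq_cong[of j t t1 g1] t(2) g1 by simp
    have tj: "t (int j) = a" using t(2)[of "int j"] t0 by (simp add: t1_def)
    show ?thesis
    proof (cases n)
      case 0
      have X: "gseq t g1 m - g' \<in> \<Gamma>" by (rule gm) (use t(3) t(4) 0 in simp_all)
      have Y: "gseq t g1 j - g \<in> \<Gamma>" using gj z by simp
      have "m < j" by (simp add: j_def)
      moreover have "t (int m) = b" using t(3)[of "int m"] 0 t0 by simp
      ultimately show ?thesis using walk_along[OF \<Gamma> t(1) _ X Y] tj by (intro exI[of _ "j - m"]) auto
    next
      case (Suc n')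
      have "gseq t g1 (j + m) = gseq (\<lambda>i. t (i + int j)) g m" using gseq_add[of t g1 j m] gj by simp
      then have X: "gseq t g1 (j + m) - g' \<in> \<Gamma>"
        using gm[of "\<lambda>i. t (i + int j)" g] t(2) z by (simp add: t1_def)
      have "j + m < 2 * j * n" using Suc by (simp add: j_def)
      moreover have "t (int (j + m)) = b" using t(2)[of "int (j + m)"] t0 by (simp add: t1_def)
      moreover have "t (int (2 * j * n)) = a" using t(3)[of 0] t0 by simp
      ultimately show ?thesis using walk_along[OF \<Gamma> t(1) _ X t(4)] by (intro exI[of _ "2 * j * n - (j + m)"]) auto
    qed
  qed simp_all
qed

text \<open>Closing up walks turns the backward alternative of transitivity into a forward walk, and
  an encounter at time 0 into one at a positive time.\<close>

lemma quot_total_free_walks: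
  assumes \<Gamma>: "good \<Gamma>" and qt: "quot_total \<Gamma>"
  shows "free_walks \<Gamma>"
  unfolding free_walks_def
proof (intro allI impI)
  fix k :: nat and a g b g' assume k: "k > 0" and occ: "occ a \<and> occ b"
  note sym = quot_total_symmetric_walks[OF \<Gamma> qt, unfolded symmetric_walks_def, rule_format]
  obtain s s' where s: "s \<in> SFT C" "s 0 = a" "s' \<in> SFT C" "s' 0 = b" using occ by (auto simp: occ_def)
  have sub: "x - x \<in> \<Gamma>" for x :: "int^'d" using good_0[OF \<Gamma>] by simp
  have loop: "\<exists>n>0. k dvd n \<and> walk \<Gamma> n (a, g) (b, g')" if ba: "b = a" and gg: "g - g' \<in> \<Gamma>"
  proof -
    have "walk \<Gamma> 0 (a, g) (b, g)" using ba by simp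
    then obtain p where p: "p > 0" "walk \<Gamma> p (b, g) (a, g)" using sym[of a b 0 g g] occ by blast
    then have "walk \<Gamma> (k * p) (a, g) (a, g)" using ba walk_loop by simp
    then obtain t' where t': "t' \<in> SFT C" "t' 0 = a" "t' (int (k * p)) = a" "gseq t' g (k * p) - g \<in> \<Gamma>"
      using walk_realise'[OF \<Gamma>] occ by metis
    have "gseq t' g (k * p) - g' \<in> \<Gamma>" by (rule subgrp_diff_trans[OF good_subgrp[OF \<Gamma>] t'(4) gg])
    then have "walk \<Gamma> (k * p) (a, g) (b, g')"
      using walk_along[OF \<Gamma> t'(1), of 0 "k * p" g g g'] t' k p ba sub[of g] by simp
    then show ?thesis using k p by (intro exI[of _ "k * p"]) auto
  qed
  have return: "\<exists>n>0. k dvd n \<and> walk \<Gamma> n (a, g) (b, g')" if w: "walk \<Gamma> (k * n) (b, g') (a, g)" for n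
  proof -
    obtain p where p: "p > 0" "walk \<Gamma> p (a, g) (b, g')" using sym[of b a "k * n" g' g] w occ by blast
    \<comment> \<open>After the return walk of length \<open>p\<close>, the closed walk is traversed
      \<open>k - 1\<close> more times; modulo \<open>k\<close> the total is \<open>k * p\<close>,
      that is 0.\<close>
    let ?q = "p + (k - 1) * (k * n + p)"
    have "walk \<Gamma> ?q (a, g) (b, g')"
      using walk_trans[OF p(2) walk_loop[OF walk_trans[OF w p(2)]]] .
    moreover have "?q = k * (k * n + p - n)"
    proof -
      obtain k' where "k = Suc k'" using k by (cases k) auto
      then show ?thesis by (simp add: algebra_simps)
    qed
    then have "k dvd ?q" by (rule dvdI)
    ultimately show ?thesis using p(1) by (intro exI[of _ ?q] conjI) simp_all
  qed
  show "\<exists>n>0. k dvd n \<and> walk \<Gamma> n (a, g) (b, g')"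
  proof (rule quot_total_orbit[OF \<Gamma> qt k _ _ s(1,3), of "{0}" "{0}" g g'])
    fix n t assume t: "t \<in> SFT C" "\<And>i. i \<in> {0} \<Longrightarrow> t i = s i" "\<And>i. i \<in> {0} \<Longrightarrow> t (i + int (k * n)) = s' i"
      "gseq t g (k * n) - g' \<in> \<Gamma>"
    show ?thesis
    proof (cases "n = 0")
      case True
      then have "b = a" "g - g' \<in> \<Gamma>" using t(2)[of 0] t(3)[of 0] t(4) s by simp_all
      then show ?thesis by (rule loop)
    next
      case False
      have "walk \<Gamma> (k * n - 0) (t (int 0), g) (t (int (k * n)), g')"
        by (rule walk_along[OF \<Gamma> t(1)]) (use False k t sub in auto)
      then show ?thesis using False k t(2)[of 0] t(3)[of 0] s by (intro exI[of _ "k * n"]) auto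
    qed
  next
    fix n t assume t: "t \<in> SFT C" "\<And>i. i \<in> {0} \<Longrightarrow> t i = s' i" "\<And>i. i \<in> {0} \<Longrightarrow> t (i + int (k * n)) = s i"
      "gseq t g' (k * n) - g \<in> \<Gamma>"
    show ?thesis
    proof (cases "n = 0")
      case True
      then have "g' - g \<in> \<Gamma>" using t(4) by simp
      then have "- (g' - g) \<in> \<Gamma>" using good_subgrp[OF \<Gamma>] unfolding subgrp_def by blast
      then have "g - g' \<in> \<Gamma>" by simp
      moreover have "b = a" using t(2)[of 0] t(3)[of 0] True s by simp
      ultimately show ?thesis using loop by blast
    next
      case False
      have "walk \<Gamma> (k * n - 0) (t (int 0), g') (t (int (k * n)), g)"
        by (rule walk_along[OF \<Gamma> t(1)]) (use False k t sub in auto)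
      then show ?thesis using return[of n] t(2)[of 0] t(3)[of 0] s by simp
    qed
  qed simp_all
qed

lemma totally_transitive_imp_total_ftp:
  assumes "totally_transitive (skew_top C) (skew A h)"
  shows "total_ftp C A h"
  unfolding total_ftp_def ftp_def
proof (intro allI impI)
  fix k :: nat and \<Gamma> assume "k > 0" "subgrp \<Gamma> \<and> finite_index \<Gamma> \<and> invariant (mpow A k) \<Gamma>"
  then show "top_transitive (quot_top C \<Gamma>) (quot_map (skew A h ^^ k))"
    using assms by (intro top_transitive_quot) (auto simp: totally_transitive_def invariant_def)
qed

lemma totally_transitive_imp_free_walks:
  assumes "totally_transitive (skew_top C) (skew A h)"
  shows "free_walks {0}"
proof (rule quot_total_free_walks[OF good_zero], unfold quot_total_def, intro allI impI)
  fix k :: nat assume "k > 0"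
  then show "top_transitive (quot_top C {0}) (quot_map (skew A h ^^ k))"
    using assms by (intro top_transitive_quot) (auto simp: totally_transitive_def)
qed

lemma total_ftp_imp_free_walks:
  assumes "total_ftp C A h" "r > 0"
  shows "free_walks (multiples r)"
proof (rule quot_total_free_walks[OF good_multiples], unfold quot_total_def, intro allI impI)
  fix k :: nat assume "k > 0"
  then show "top_transitive (quot_top C (multiples r)) (quot_map (skew A h ^^ k))"
    using assms(1)[unfolded total_ftp_def ftp_def, rule_format, of k "multiples r"]
    by (simp add: invariant_def subgrp_multiples finite_index_multiples[OF assms(2)] Ap_image[OF good_multiples])
qed

subsection \<open>From walks to mixing and periodic points\<close>

text \<open>Numerical semigroup argument: a loop of length \<open>l\<close> and one of length
  \<open>1 + q\<close> with \<open>l dvd q\<close> have coprime lengths. For a remaining length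
  \<open>n'\<close> the second loop is used \<open>n' mod l\<close> times to correct the
  residue.\<close>

lemma free_walks_eventually:
  assumes fw: "free_walks {0}" and occ: "occ a" "occ b"
  shows "\<exists>n0. \<forall>n\<ge>n0. walk {0} n (a, g) (b, g')"
proof -
  note fw' = fw[unfolded free_walks_def, rule_format]
  obtain l where l: "l > 0" "walk {0} l (a, g) (a, g)" using fw'[of 1 a a g g] occ by auto
  obtain s where s: "s \<in> SFT C" "s 0 = a" using occ by (auto simp: occ_def)
  have "walk {0} (1 - 0) (s (int 0), g) (s (int 1), gseq s g 1)"
    by (rule walk_along[OF good_zero s(1), of _ _ g]) auto
  then have st: "walk {0} 1 (a, g) (s 1, gseq s g 1)" using s by simp
  obtain q where q: "l dvd q" "walk {0} q (s 1, gseq s g 1) (a, g)"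
    using fw'[OF l(1), of "s 1" a "gseq s g 1" g] occ occ_point[OF s(1), of 1] by blast
  have loop1: "walk {0} (1 + q) (a, g) (a, g)" using walk_trans[OF st q(2)] .
  obtain p where p: "walk {0} p (a, g) (b, g')" using fw'[of 1 a b g g'] occ by auto
  have "walk {0} n (a, g) (b, g')" if n: "n \<ge> p + l * (1 + q)" for n
  proof -
    define n' where "n' = n - p"
    define y where "y = n' mod l"
    have "y < l" using l by (simp add: y_def)
    then have "y * (1 + q) \<le> l * (1 + q)" by (intro mult_right_mono) auto
    then have le: "y * (1 + q) \<le> n'" using n by (simp add: n'_def)
    have "l dvd n' - y" by (simp add: y_def dvd_minus_mod)
    moreover have "n' - y * (1 + q) = (n' - y) - y * q" by simp
    moreover have "l dvd (n' - y) - y * q" by (rule dvd_diff_nat[OF \<open>l dvd n' - y\<close> dvd_mult[OF q(1)]])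
    ultimately have "l dvd n' - y * (1 + q)" by (simp only:)
    then obtain x where x: "n' - y * (1 + q) = x * l" by (metis dvdE mult.commute)
    have "walk {0} (x * l + y * (1 + q)) (a, g) (a, g)"
      using walk_trans[OF walk_loop[OF l(2)] walk_loop[OF loop1]] .
    moreover have "x * l + y * (1 + q) = n'" using x le by simp
    ultimately have "walk {0} (n' + p) (a, g) (b, g')" using walk_trans[OF _ p] by simp
    then show ?thesis using n by (simp add: n'_def)
  qed
  then show ?thesis by blast
qed

lemma walk_realise_exact:
  assumes w: "walk {0} n (s 0, g) (s' 0, g')" and s: "s \<in> SFT C" "s' \<in> SFT C"
  obtains t where "t \<in> SFT C" "\<And>i. i \<le> 0 \<Longrightarrow> t i = s i" "\<And>i. i \<ge> 0 \<Longrightarrow> t (i + int n) = s' i"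
    "gseq t g n = g'"
proof -
  obtain t where t: "t \<in> SFT C" "\<And>i. i \<le> 0 \<Longrightarrow> t i = s i" "\<And>i. i \<ge> 0 \<Longrightarrow> t (i + int n) = s' i"
    "gseq t g n - g' \<in> {0}" using walk_realise[OF good_zero w s] by blast
  from t(4) have "gseq t g n = g'" by simp
  with t(1-3) show ?thesis by (rule that)
qed

lemma skew_top_cylinder:
  assumes "openin (skew_top C) U" "(s, g) \<in> U"
  obtains m where "s \<in> SFT C" "\<And>t. t \<in> SFT C \<Longrightarrow> (\<And>i. \<bar>i\<bar> \<le> int m \<Longrightarrow> t i = s i) \<Longrightarrow> (t, g) \<in> U"
proof -
  obtain U' where U': "openin (SFT_top C) U'" "s \<in> U'" "U' \<times> {g} \<subseteq> U"
    using openin_prod_discrete_point[OF assms[unfolded skew_top_def]] by blast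
  have "s \<in> SFT C" using openin_subset[OF U'(1)] U'(2) by auto
  moreover obtain m where "\<And>t. t \<in> SFT C \<Longrightarrow> (\<And>i. \<bar>i\<bar> \<le> int m \<Longrightarrow> t i = s i) \<Longrightarrow> t \<in> U'"
    using openin_SFT_top_cylinder[OF U'(1,2)] by blast
  ultimately show ?thesis using U'(3) that[of m] by blast
qed

lemma free_walks_imp_mixing:
  assumes fw: "free_walks {0}"
  shows "top_mixing (skew_top C) (skew A h)"
  unfolding top_mixing_def
proof (intro allI impI)
  fix U V :: "((int \<Rightarrow> 'a) \<times> (int^'d)) set"
  assume UV: "openin (skew_top C) U \<and> openin (skew_top C) V \<and> U \<noteq> {} \<and> V \<noteq> {}"
  then obtain s g s' g' where sg: "(s, g) \<in> U" "(s', g') \<in> V" by fastforce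
  obtain m1 where m1: "s \<in> SFT C" "\<And>t. t \<in> SFT C \<Longrightarrow> (\<And>i. \<bar>i\<bar> \<le> int m1 \<Longrightarrow> t i = s i) \<Longrightarrow> (t, g) \<in> U"
    using skew_top_cylinder[OF _ sg(1)] UV by blast
  obtain m2 where m2: "s' \<in> SFT C" "\<And>t. t \<in> SFT C \<Longrightarrow> (\<And>i. \<bar>i\<bar> \<le> int m2 \<Longrightarrow> t i = s' i) \<Longrightarrow> (t, g') \<in> V"
    using skew_top_cylinder[OF _ sg(2)] UV by blast
  \<comment> \<open>The connecting walk has to leave both windows untouched: it runs from the right
    end of the window of \<open>s\<close> to the left end of the window of \<open>s'\<close>, and
    these ends become the origins of \<open>u\<close> and \<open>u'\<close>.\<close>
  define u where "u i = s (i + int m1)" for i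
  define u' where "u' i = s' (i - int m2)" for i
  have uS: "u \<in> SFT C" "u' \<in> SFT C"
    using SFT_translate[OF m1(1), of "int m1"] SFT_translate[OF m2(1), of "- int m2"]
    by (simp_all add: u_def[abs_def] u'_def[abs_def])
  obtain g0 where g0: "gseq u' g0 m2 = g'" using gseq_start by blast
  have "occ (u 0)" "occ (u' 0)" using occ_point uS by blast+
  then obtain n0 where n0: "\<And>n. n \<ge> n0 \<Longrightarrow> walk {0} n (u 0, gseq s g m1) (u' 0, g0)"
    using free_walks_eventually[OF fw] by blast
  have "(skew A h ^^ n) ` U \<inter> V \<noteq> {}" if n: "n \<ge> n0 + m1 + m2" for n
  proof -
    define l where "l = n - m1 - m2"
    have l: "l \<ge> n0" "n = m1 + (l + m2)" using n by (auto simp: l_def)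
    obtain t where t: "t \<in> SFT C" "\<And>i. i \<le> 0 \<Longrightarrow> t i = u i" "\<And>i. i \<ge> 0 \<Longrightarrow> t (i + int l) = u' i"
      "gseq t (gseq s g m1) l = g0"
      using walk_realise_exact[OF n0[OF l(1)] uS] by blast
    define z where "z i = t (i - int m1)" for i
    have z: "z \<in> SFT C" using SFT_translate[OF t(1), of "- int m1"] by (simp add: z_def[abs_def])
    have zs: "z i = s i" if "i \<le> int m1" for i using t(2)[of "i - int m1"] that by (simp add: z_def u_def)
    have "(z, g) \<in> U" by (rule m1(2)[OF z]) (use zs in auto)
    have e1: "gseq z g m1 = gseq s g m1" by (rule gseq_cong) (use zs in auto)
    have e2: "(\<lambda>i. z (i + int m1)) = t" by (simp add: z_def)
    have "gseq z g n = gseq (\<lambda>i. t (i + int l)) (gseq t (gseq s g m1) l) m2"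
      unfolding l(2) gseq_add[of z] e1 e2 by (rule gseq_add)
    also have "\<dots> = gseq u' g0 m2" unfolding t(4) by (rule gseq_cong) (use t(3) in auto)
    finally have gn: "gseq z g n = g'" using g0 by simp
    have "(\<lambda>i. z (i + int n), g') \<in> V"
    proof (rule m2(2)[OF SFT_translate[OF z]])
      fix i assume "\<bar>i\<bar> \<le> int m2"
      then show "z (i + int n) = s' i" using t(3)[of "i + int m2"] by (simp add: z_def u'_def l(2) algebra_simps)
    qed
    then have "(skew A h ^^ n) (z, g) \<in> V" by (simp add: skew_pow gn)
    then show ?thesis using \<open>(z, g) \<in> U\<close> by blast
  qed
  then show "\<exists>N. \<forall>n\<ge>N. (skew A h ^^ n) ` U \<inter> V \<noteq> {}" by blast
qed

lemma free_walks_imp_dense_periodic: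
  assumes fw: "free_walks {0}"
  shows "dense_periodic (skew_top C) (skew A h)"
  unfolding dense_periodic_def
proof (intro equalityI closure_of_subset_topspace subsetI)
  fix x :: "(int \<Rightarrow> 'a) \<times> (int^'d)" assume "x \<in> topspace (skew_top C)"
  then show "x \<in> skew_top C closure_of periodic_points (skew_top C) (skew A h)"
    unfolding in_closure_of
  proof (intro conjI allI impI)
    fix U assume "x \<in> U \<and> openin (skew_top C) U"
    then obtain s g where sg: "x = (s, g)" "(s, g) \<in> U" "openin (skew_top C) U" by (cases x) auto
    obtain m where m: "s \<in> SFT C" "\<And>t. t \<in> SFT C \<Longrightarrow> (\<And>i. \<bar>i\<bar> \<le> int m \<Longrightarrow> t i = s i) \<Longrightarrow> (t, g) \<in> U"
      using skew_top_cylinder[OF sg(3,2)] by blast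
    define u where "u i = s (i - int m)" for i
    have u: "u \<in> SFT C" using SFT_translate[OF m(1), of "- int m"] by (simp add: u_def[abs_def])
    obtain g0 where g0: "gseq u g0 m = g" using gseq_start by blast
    have "occ (u (int (2 * m)))" "occ (u 0)" using occ_point u by blast+
    then obtain p where p: "p > 0" "walk {0} p (u (int (2 * m)), gseq u g0 (2 * m)) (u 0, g0)"
      using fw[unfolded free_walks_def, rule_format, OF less_numeral_extra(1)] by blast
    then obtain P where P: "P 0 = (u (int (2 * m)), gseq u g0 (2 * m))" "P p = (u 0, g0)"
      "\<And>i. i < p \<Longrightarrow> step {0} (P i) (P (Suc i))"
      unfolding walk_def relpowp_fun_conv by blast
    define L where "L = 2 * m + p"
    have "L > 0" using p by (simp add: L_def)
    \<comment> \<open>The orbit over the window, of length \<open>2 * m\<close>, followed by the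
      walk that returns to its beginning; \<open>y\<close> below repeats this closed walk of length
      \<open>L\<close> periodically.\<close>
    define F where "F i = (if i \<le> 2 * m then (u (int i), gseq u g0 i) else P (i - 2 * m))" for i
    have F: "step {0} (F i) (F (Suc i))" if "i < L" for i
    proof (cases "i < 2 * m")
      case True
      then show ?thesis using u by (simp add: F_def step_def gseq_Suc SFT_def add.commute[of 1])
    next
      case False
      then have "F i = P (i - 2 * m)" "F (Suc i) = P (Suc (i - 2 * m))"
        using P(1) by (auto simp: F_def Suc_diff_le not_less_eq_eq)
      then show ?thesis using P(3)[of "i - 2 * m"] False that by (simp add: L_def)
    qed
    have FL: "F L = F 0" using P p by (simp add: F_def L_def)
    define y where "y i = F (nat ((i + int m) mod int L))" for i
    have ystep: "step {0} (y i) (y (i + 1))" for i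
    proof -
      define k where "k = nat ((i + int m) mod int L)"
      have k: "k < L" using \<open>L > 0\<close> by (simp add: k_def nat_less_iff)
      have ki: "int k = (i + int m) mod int L" using \<open>L > 0\<close> by (simp add: k_def)
      have "(i + 1 + int m) mod int L = (int k + 1) mod int L"
        unfolding ki by (simp add: mod_simps algebra_simps)
      also have "\<dots> = int (Suc k mod L)" by (simp add: zmod_int add.commute)
      finally have "y (i + 1) = F (if Suc k = L then 0 else Suc k)"
        using k by (auto simp: y_def)
      then have "y (i + 1) = F (Suc k)" using FL by auto
      then show ?thesis using F[OF k] by (simp add: y_def k_def)
    qed
    define z where "z i = fst (y i)" for i
    have z: "z \<in> SFT C" using ystep by (simp add: SFT_def z_def step_def)
    have ym: "y i = (s i, gseq u g0 (nat (i + int m)))" if "\<bar>i\<bar> \<le> int m" for i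
    proof -
      have "i + int m < int L" "0 \<le> i + int m" using that p by (auto simp: L_def)
      then have "(i + int m) mod int L = i + int m" by simp
      moreover have "nat (i + int m) \<le> 2 * m" using that by linarith
      moreover have "int (nat (i + int m)) = i + int m" using that by linarith
      ultimately show ?thesis using that by (simp add: y_def F_def u_def)
    qed
    then have "(z, g) \<in> U" by (intro m(2)[OF z]) (simp add: z_def)
    have gz: "gseq z g n = snd (y (int n))" for n
    proof (induction n)
      case 0 then show ?case using ym[of 0] g0 by simp
    next
      case (Suc n)
      then show ?case using ystep[of "int n"] by (simp add: gseq_Suc z_def step_def add.commute[of 1])
    qed
    have per: "y (i + int L) = y i" for i
    proof -
      have "i + int L + int m = (i + int m) + int L" by simp
      then show ?thesis by (simp only: y_def mod_add_self2)
    qed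
    have "gseq z g L = g" using gz[of L] gz[of 0] per[of 0] by simp
    moreover have "(\<lambda>i. z (i + int L)) = z" using per by (simp add: z_def fun_eq_iff)
    ultimately have "(skew A h ^^ L) (z, g) = (z, g)" by (simp add: skew_pow)
    then have "(z, g) \<in> periodic_points (skew_top C) (skew A h)"
      using \<open>L > 0\<close> z unfolding periodic_points_def by (auto simp: skew_top_def)
    then show "\<exists>y. y \<in> periodic_points (skew_top C) (skew A h) \<and> y \<in> U" using \<open>(z, g) \<in> U\<close> by blast
  qed
qed

text \<open>A periodic point close to an orbit realising the walk follows it exactly, and the rest
  of its period leads back. The period is multiplied by \<open>Suc m\<close> so that it outlasts the
  walk.\<close>

lemma dense_periodic_imp_symmetric_walks:
  assumes dp: "dense_periodic (skew_top C) (skew A h)"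
  shows "symmetric_walks {0}"
  unfolding symmetric_walks_def
proof (intro allI impI)
  fix m a g b g' assume w: "occ a \<and> occ b \<and> walk {0} m (a, g) (b, g')"
  obtain t where t: "t \<in> SFT C" "t 0 = a" "t (int m) = b" "gseq t g m - g' \<in> {0}"
    using walk_realise'[OF good_zero, of m a g b g'] w by blast
  define U where "U = {s\<in>SFT C. \<forall>i\<in>{0..int m}. s i = t i} \<times> {g}"
  have "openin (skew_top C) U" unfolding U_def skew_top_def
    by (intro openin_prod_discrete openin_cylinder) auto
  moreover have "(t, g) \<in> U" using t by (simp add: U_def)
  moreover have "(t, g) \<in> skew_top C closure_of periodic_points (skew_top C) (skew A h)"
    unfolding dp[unfolded dense_periodic_def] using t(1) by (simp add: skew_top_def)
  ultimately obtain y where y: "y \<in> periodic_points (skew_top C) (skew A h)" "y \<in> U"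
    unfolding in_closure_of by blast
  then obtain s where s: "(s, g) \<in> periodic_points (skew_top C) (skew A h)" "(s, g) \<in> U"
    unfolding U_def by blast
  from s(1) obtain L where L: "L > 0" "(skew A h ^^ L) (s, g) = (s, g)" unfolding periodic_points_def by blast
  have sS: "s \<in> SFT C" "\<And>i. i \<in> {0..int m} \<Longrightarrow> s i = t i" using s by (auto simp: U_def)
  define n where "n = L * Suc m"
  have "((skew A h ^^ L) ^^ k) (s, g) = (s, g)" for k by (induction k) (simp_all add: L(2))
  then have "(skew A h ^^ n) (s, g) = (s, g)" unfolding n_def funpow_mult[symmetric] .
  then have n: "(\<lambda>i. s (i + int n)) = s" "gseq s g n = g" unfolding skew_pow by blast+
  have "1 * Suc m \<le> L * Suc m" using L(1) by (intro mult_le_mono1) simp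
  then have "m < n" by (simp add: n_def)
  have "gseq s g m = gseq t g m" by (rule gseq_cong) (use sS in auto)
  then have X: "gseq s g m - g' \<in> {0}" using t by simp
  have Y: "gseq s g n - g \<in> {0}" using n(2) by simp
  have "s (int m) = b" using sS t by simp
  moreover have "s (int n) = a" using fun_cong[OF n(1), of 0] sS(2)[of 0] t by simp
  ultimately show "\<exists>p>0. walk {0} p (b, g') (a, g)"
    using walk_along[OF good_zero sS(1) \<open>m < n\<close> X Y] \<open>m < n\<close> by (intro exI[of _ "n - m"] conjI) simp_all
qed

end

lemma subgrp_add: "subgrp H \<Longrightarrow> x \<in> H \<Longrightarrow> y \<in> H \<Longrightarrow> x + y \<in> H"
  and subgrp_uminus: "subgrp H \<Longrightarrow> x \<in> H \<Longrightarrow> - x \<in> H"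
  and subgrp_0: "subgrp H \<Longrightarrow> 0 \<in> H"
  by (simp_all add: subgrp_def)

lemma (in unipotent) subgrp_range_D: "subgrp (range D)"
proof -
  have "0 \<in> range D" "D a + D b \<in> range D" "- D a \<in> range D" for a b
    using D_simps(1)[of a b] D_simps(4) D_simps(5)[of a] by (metis rangeI)+
  then show ?thesis unfolding subgrp_def by blast
qed

lemma (in unipotent) Bi_diff_range: "Bi k u - u \<in> range D"
proof (induction k)
  case 0 then show ?case using subgrp_range_D by (simp add: subgrp_def)
next
  case (Suc k)
  have "Bi (Suc k) u - u = (Bi k u - u) + D (Bi k u)" by (simp add: Bi_Suc)
  then show ?case using subgrp_add[OF subgrp_range_D Suc rangeI[of D "Bi k u"]] by (simp only:)
qed

lemma (in unipotent) range_D_ann: "range D \<subseteq> ann (Cf 1)"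
  by (auto simp: ann_def Cf_1 simp del: One_nat_def)

context skew_system
begin

lemma walk_translate: "walk \<Gamma> n (a, g) (b, g') \<Longrightarrow> walk \<Gamma> n (a, g + u) (b, g' + Ap n u)"
proof (induction n arbitrary: b g')
  case 0 then show ?case by (simp add: mpow_0_vec)
next
  case (Suc n)
  then obtain c k where ck: "walk \<Gamma> n (a, g) (c, k)" "step \<Gamma> (c, k) (b, g')" by (auto simp: walk_def)
  have "g' + Ap (Suc n) u - (A *v (k + Ap n u) + h c b) = g' - (A *v k + h c b)"
    by (simp add: mpow_Suc_vec matrix_vector_right_distrib)
  then have "step \<Gamma> (c, k + Ap n u) (b, g' + Ap (Suc n) u)"
    using ck(2) by (simp only: step_def fst_conv snd_conv)
  then show ?case using Suc.IH[OF ck(1)] by (auto simp: walk_def)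
qed

text \<open>As \<open>\<Gamma>\<close> is invariant under \<open>A\<close>, the slack used on the
  individual edges can be transported to the end of the walk and collected there.\<close>

lemma walk_exact:
  assumes \<Gamma>: "good \<Gamma>" and "walk \<Gamma> n (a, g) (b, g')"
  shows "\<exists>\<gamma>\<in>\<Gamma>. walk {0} n (a, g) (b, g' + \<gamma>)"
  using assms(2)
proof (induction n arbitrary: b g')
  case 0 then show ?case using good_0[OF \<Gamma>] by auto
next
  case (Suc n)
  then obtain c k where ck: "walk \<Gamma> n (a, g) (c, k)" "step \<Gamma> (c, k) (b, g')" by (auto simp: walk_def)
  obtain \<gamma> where \<gamma>: "\<gamma> \<in> \<Gamma>" "walk {0} n (a, g) (c, k + \<gamma>)" using Suc.IH[OF ck(1)] by blast
  let ?d = "A *v \<gamma> - (g' - (A *v k + h c b))"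
  have "A *v \<gamma> \<in> \<Gamma>" using \<Gamma> \<gamma>(1) by (auto simp: good_def)
  then have "?d \<in> \<Gamma>" using ck(2) subgrp_diff[OF good_subgrp[OF \<Gamma>]] by (simp add: step_def)
  moreover have "step {0} (c, k + \<gamma>) (b, g' + ?d)"
    using ck(2) by (simp add: step_def matrix_vector_right_distrib)
  then have "walk {0} (Suc n) (a, g) (b, g' + ?d)" using walk_trans[OF \<gamma>(2), of 1] by simp
  ultimately show ?case by blast
qed

subsection \<open>The spectrum of the twisting matrix\<close>

text \<open>If \<open>c\<close> is a left eigenvector for an eigenvalue of modulus greater than \<open>1\<close>, then along
  every walk starting far enough from \<open>ker c\<close> the modulus of \<open>c\<close> increases.\<close>
lemma loops_imp_spectrum_le_1:
  assumes loops: "\<And>g. \<exists>p>0. walk {0} p (a, g) (a, g)" and \<mu>: "\<mu> \<in> cspec A"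
  shows "norm \<mu> \<le> 1"
proof (rule ccontr)
  assume "\<not> norm \<mu> \<le> 1"
  then have m1: "norm \<mu> > 1" by simp
  obtain c :: "complex^'d" where c: "c \<noteq> 0"
    "\<And>x. (\<Sum>i\<in>UNIV. c $ i * of_int ((A *v x) $ i)) = \<mu> * (\<Sum>i\<in>UNIV. c $ i * of_int (x $ i))"
    using left_eigenvector[OF \<mu>] by blast
  define \<phi> where "\<phi> x = (\<Sum>i\<in>UNIV. c $ i * of_int (x $ i))" for x :: "int^'d"
  have \<phi>A: "\<phi> (A *v x) = \<mu> * \<phi> x" for x using c(2) by (simp add: \<phi>_def)
  have \<phi>_add: "\<phi> (x + y) = \<phi> x + \<phi> y" for x y by (simp add: \<phi>_def sum.distrib algebra_simps)
  define H where "H = (\<Sum>b\<in>UNIV. \<Sum>b'\<in>UNIV. norm (\<phi> (h b b')))"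
  have H: "norm (\<phi> (h b b')) \<le> H" for b b'
  proof -
    have "norm (\<phi> (h b b')) \<le> (\<Sum>b'\<in>UNIV. norm (\<phi> (h b b')))" by (rule member_le_sum) auto
    also have "\<dots> \<le> H" unfolding H_def by (rule member_le_sum) (auto intro: sum_nonneg)
    finally show ?thesis .
  qed
  \<comment> \<open>The fixed point of the lower bound \<open>norm \<mu> * t - H\<close> for the new
    modulus; the excess over it is multiplied by at least \<open>norm \<mu>\<close> in each
    step.\<close>
  define K where "K = H / (norm \<mu> - 1)"
  have "H = (norm \<mu> - 1) * K" using m1 by (simp add: K_def)
  then have K: "H = norm \<mu> * K - K" by (simp only: left_diff_distrib mult_1)
  have st: "norm \<mu> * (norm (\<phi> (snd x)) - K) \<le> norm (\<phi> (snd y)) - K" if "step {0} x y" for x y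
  proof -
    have "snd y = A *v snd x + h (fst x) (fst y)" using that by (simp add: step_def)
    then have "\<phi> (snd y) = \<mu> * \<phi> (snd x) + \<phi> (h (fst x) (fst y))" by (simp add: \<phi>_add \<phi>A)
    then have "norm (\<phi> (snd y)) \<ge> norm (\<mu> * \<phi> (snd x)) - norm (\<phi> (h (fst x) (fst y)))"
      using norm_diff_ineq[of "\<mu> * \<phi> (snd x)" "\<phi> (h (fst x) (fst y))"] by simp
    then show ?thesis using H[of "fst x" "fst y"] K by (simp add: norm_mult algebra_simps)
  qed
  have grow: "norm \<mu> ^ n * (norm (\<phi> (snd x)) - K) \<le> norm (\<phi> (snd y)) - K" if "walk {0} n x y" for n x y
    using that
  proof (induction n arbitrary: y)
    case (Suc n)
    then obtain z where z: "walk {0} n x z" "step {0} z y" by (auto simp: walk_def)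
    have "norm \<mu> ^ Suc n * (norm (\<phi> (snd x)) - K) \<le> norm \<mu> * (norm (\<phi> (snd z)) - K)"
      using mult_left_mono[OF Suc.IH[OF z(1)], of "norm \<mu>"] by (simp add: mult.assoc)
    also have "\<dots> \<le> norm (\<phi> (snd y)) - K" by (rule st[OF z(2)])
    finally show ?case .
  qed simp
  obtain i where i: "c $ i \<noteq> 0" using c(1) by (auto simp: vec_eq_iff)
  obtain M :: nat where M: "K < of_nat M * norm (c $ i)" using reals_Archimedean3[of "norm (c $ i)"] i by auto
  define g :: "int^'d" where "g = axis i (int M)"
  have "\<phi> g = c $ i * of_nat M"
    by (simp add: \<phi>_def g_def axis_def if_distrib if_distribR cong: if_cong)
  then have g: "norm (\<phi> g) - K > 0" using M by (simp add: norm_mult mult.commute)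
  obtain p where p: "p > 0" "walk {0} p (a, g) (a, g)" using loops by blast
  have "norm \<mu> ^ p * (norm (\<phi> g) - K) \<le> 1 * (norm (\<phi> g) - K)" using grow[OF p(2)] by simp
  then have "norm \<mu> ^ p \<le> 1" using g by (simp only: mult_le_cancel_right_pos)
  moreover have "norm \<mu> ^ p > 1" using m1 p(1) by (simp add: one_less_power)
  ultimately show False by simp
qed

end

subsection \<open>Walks as a twisted semigroup\<close>

locale unipotent_skew = skew_system C A A' h
  for C :: "'a::finite \<Rightarrow> 'a \<Rightarrow> bool" and A A' :: "int^'d^'d" and h :: "'a \<Rightarrow> 'a \<Rightarrow> int^'d" +
  fixes N d :: nat
  assumes N_pos: "N > 0"
    and nil: "((\<lambda>u. mpow A N *v u - u) ^^ d) x = 0"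
begin

sublocale unipotent "mpow A N" d
  by standard (rule nil)

lemma Bi_eq: "Bi n x = Ap (N * n) x"
  by (induction n) (simp_all add: Bi_Suc D_def mpow_0_vec mpow_add_vec)

lemma invariant_functional_Bi: "c \<in> Cf 1 \<Longrightarrow> idot c (Bi n u) = idot c u"
  by (induction n) (auto simp: Bi_Suc Cf_1 simp del: One_nat_def)

text \<open>Lengths are counted in units of \<open>N\<close>, so that concatenation is twisted by
  powers of the unipotent matrix only.\<close>

definition heights :: "'a \<Rightarrow> int^'d \<Rightarrow> nat \<Rightarrow> (int^'d) set" where
  "heights a g n = {u. walk {0} (N * n) (a, g) (a, g + u)}"

lemma heights_comp:
  assumes "u \<in> heights a g n" "v \<in> heights a g k" shows "Bi k u + v \<in> heights a g (n + k)"
proof -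
  have "walk {0} (N * k) (a, g + u) (a, g + v + Ap (N * k) u)"
    using walk_translate assms(2) by (simp add: heights_def)
  moreover have "walk {0} (N * n) (a, g) (a, g + u)" using assms(1) by (simp add: heights_def)
  ultimately have "walk {0} (N * n + N * k) (a, g) (a, g + v + Ap (N * k) u)" by (rule walk_trans[rotated])
  then show ?thesis by (simp add: heights_def Bi_eq algebra_simps)
qed

lemma heights_residues:
  assumes fw: "free_walks (multiples r)" and "occ a" "k > 0"
  shows "\<exists>n>0. k dvd n \<and> (\<exists>u\<in>heights a g n. \<exists>y. u = w + int r *s y)"
proof -
  have "N * k > 0" using assms N_pos by simp
  then obtain n where n: "n > 0" "N * k dvd n" "walk (multiples r) n (a, g) (a, g + w)"
    using fw assms(2) unfolding free_walks_def by blast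
  obtain \<gamma> where \<gamma>: "\<gamma> \<in> multiples r" "walk {0} n (a, g) (a, g + w + \<gamma>)"
    using walk_exact[OF good_multiples n(3)] by blast
  obtain q where q: "n = N * k * q" using n(2) by blast
  have "w + \<gamma> \<in> heights a g (k * q)" using \<gamma>(2) by (simp add: heights_def q algebra_simps)
  moreover have "k * q > 0" using n(1) q by simp
  ultimately show ?thesis using \<gamma>(1) by (intro exI[of _ "k * q"]) (auto simp: multiples_def)
qed

text \<open>Seen through the invariant functionals, loop heights form an ordinary abelian semigroup;
  the condition asks it to contain a positive multiple of every vector, so that it is not confined
  to a half-space.\<close>

definition abelian_heights :: bool where
  "abelian_heights \<longleftrightarrow> (\<forall>a g e x. occ a \<and> e > 0 \<longrightarrow>
     (\<exists>m>0. \<exists>i>0. e dvd i \<and> (\<exists>f\<in>ann (Cf 1). m *s x + f \<in> heights a g i)))"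

text \<open>Modulo 1 the free walks only connect the states, leaving an arbitrary error
  \<open>\<gamma>\<close> in the fibre; a loop of height \<open>- \<gamma>\<close> at the end vertex
  removes it.\<close>

lemma abelian_heights_imp_free_walks:
  assumes fw: "\<And>r. r > 0 \<Longrightarrow> free_walks (multiples r)" and ab: "abelian_heights"
  shows "free_walks {0}"
  unfolding free_walks_def
proof (intro allI impI)
  fix k :: nat and a g b g' assume k: "k > 0" and occ: "occ a \<and> occ b"
  obtain n1 where n1: "n1 > 0" "k dvd n1" "walk (multiples 1) n1 (a, g) (b, g')"
    using fw[OF less_numeral_extra(1), unfolded free_walks_def, rule_format, OF k occ, of g g'] by blast
  obtain \<gamma> where \<gamma>: "walk {0} n1 (a, g) (b, g' + \<gamma>)" using walk_exact[OF good_multiples n1(3)] by blast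
  interpret hs: height_semigroup "mpow A N" d "heights b (g' + \<gamma>)"
  proof unfold_locales
    fix u n v k assume "u \<in> heights b (g' + \<gamma>) n" "v \<in> heights b (g' + \<gamma>) k"
    then show "Bi k u + v \<in> heights b (g' + \<gamma>) (n + k)" by (rule heights_comp)
  next
    fix k r :: nat and w assume "k > 0" "r > 0"
    then show "\<exists>n>0. k dvd n \<and> (\<exists>u\<in>heights b (g' + \<gamma>) n. \<exists>y. u = w + int r *s y)"
      by (intro heights_residues fw) (use occ in blast)+
  next
    fix e :: nat and x assume "e > 0"
    then show "\<exists>m>0. \<exists>i>0. e dvd i \<and> (\<exists>f\<in>ann (Cf 1). m *s x + f \<in> heights b (g' + \<gamma>) i)"
      using ab[unfolded abelian_heights_def, rule_format, of b e] occ by blast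
  qed
  obtain n where n: "n > 0" "k dvd n" "- \<gamma> \<in> heights b (g' + \<gamma>) n" using hs.all_heights[OF k] by blast
  then have "walk {0} (N * n) (b, g' + \<gamma>) (b, g')" by (simp add: heights_def)
  from walk_trans[OF \<gamma> this] have "walk {0} (n1 + N * n) (a, g) (b, g')" .
  then show "\<exists>n>0. k dvd n \<and> walk {0} n (a, g) (b, g')"
    using n1(1,2) n(2) by (intro exI[of _ "n1 + N * n"] conjI) simp_all
qed

text \<open>The length of a return walk \<open>p\<close> after a loop of length
  \<open>M * j\<close>, followed by \<open>e * M - 1\<close> further rounds of the closed walk. It
  is a multiple of \<open>M\<close>, and the quotient is divisible by \<open>e\<close> as soon as
  \<open>j\<close> is.\<close>

lemma loop_length:
  fixes e j M p :: nat
  assumes "e * M > 0" shows "p + (e * M - 1) * (M * j + p) = M * (e * (M * j + p) - j)"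
proof -
  define X where "X = e * M * (M * j + p)"
  have "1 * (M * j + p) \<le> X" unfolding X_def using assms by (intro mult_le_mono1) simp
  moreover have "(e * M - 1) * (M * j + p) = X - (M * j + p)" unfolding X_def by (simp only: diff_mult_distrib mult_1)
  moreover have "M * (e * (M * j + p) - j) = X - M * j" unfolding X_def by (simp only: diff_mult_distrib2 mult_ac)
  moreover have "p + (X - (Y + p)) = X - Y" if "Y + p \<le> X" for Y using that by simp
  ultimately show ?thesis by (simp only: mult_1)
qed

text \<open>Modulo \<open>ann (Cf 1)\<close> the twist disappears, because \<open>Bi j x - x\<close>
  lies in \<open>range D\<close>.\<close>

lemma heights_mod_ann_add:
  fixes a :: 'a and g :: "int^'d" and e :: nat
  defines "P \<equiv> {u. \<exists>j>0. e dvd j \<and> (\<exists>f\<in>ann (Cf 1). u + f \<in> heights a g j)}"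
  assumes "x \<in> P" "y \<in> P" shows "x + y \<in> P"
proof -
  obtain i f where 1: "i > 0" "e dvd i" "f \<in> ann (Cf 1)" "x + f \<in> heights a g i"
    using assms(2) unfolding P_def by blast
  obtain j f' where 2: "j > 0" "e dvd j" "f' \<in> ann (Cf 1)" "y + f' \<in> heights a g j"
    using assms(3) unfolding P_def by blast
  let ?f = "(Bi j (x + f) - (x + f)) + (f + f')"
  have "?f \<in> ann (Cf 1)"
    by (rule subgrp_add[OF subgrp_ann subsetD[OF range_D_ann Bi_diff_range] subgrp_add[OF subgrp_ann 1(3) 2(3)]])
  moreover have "x + y + ?f = Bi j (x + f) + (y + f')" by (simp add: algebra_simps)
  then have "x + y + ?f \<in> heights a g (i + j)" using heights_comp[OF 1(4) 2(4)] by (simp only:)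
  moreover have "i + j > 0" "e dvd i + j" using 1(1,2) 2(1,2) by simp_all
  ultimately have "\<exists>j>0. e dvd j \<and> (\<exists>f\<in>ann (Cf 1). x + y + f \<in> heights a g j)"
    by (intro exI[of _ "i + j"] conjI bexI[of _ ?f])
  then show ?thesis by (simp only: P_def mem_Collect_eq)
qed

text \<open>Closing a loop's walk differently provides a loop with the negative height modulo
  \<open>ann (Cf 1)\<close>, so the heights form a subgroup there. It meets every residue class
  modulo every \<open>r\<close>, so only functionals vanishing on \<open>x\<close> can annihilate
  it, and a multiple of \<open>x\<close> belongs to it.\<close>

lemma symmetric_walks_imp_abelian_heights:
  assumes fw: "\<And>r. r > 0 \<Longrightarrow> free_walks (multiples r)" and sym: "symmetric_walks {0}"
  shows "abelian_heights"
  unfolding abelian_heights_def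
proof (intro allI impI)
  fix a g and e :: nat and x assume ae: "occ a \<and> e > 0"
  define P where "P = {u. \<exists>j>0. e dvd j \<and> (\<exists>f\<in>ann (Cf 1). u + f \<in> heights a g j)}"
  have add: "u + v \<in> P" if "u \<in> P" "v \<in> P" for u v
    using that unfolding P_def by (rule heights_mod_ann_add)
  have sa: "subgrp (ann (Cf 1))" by (rule subgrp_ann)
  have neg: "- u \<in> P" if "u \<in> P" for u
  proof -
    from that have "\<exists>j>0. e dvd j \<and> (\<exists>f\<in>ann (Cf 1). u + f \<in> heights a g j)" by (simp only: P_def mem_Collect_eq)
    then obtain j f where 1: "j > 0" "e dvd j" "f \<in> ann (Cf 1)" "u + f \<in> heights a g j" by (elim exE conjE bexE)
    from 1(4) have w: "walk {0} (N * j) (a, g) (a, g + (u + f))" by (simp only: heights_def mem_Collect_eq)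
    obtain p where p: "p > 0" "walk {0} p (a, g + (u + f)) (a, g)"
      using sym[unfolded symmetric_walks_def, rule_format, of a a "N * j" g "g + (u + f)"] w ae by blast
    let ?j = "e * (N * j + p) - j"
    let ?q = "p + (e * N - 1) * (N * j + p)"
    have "walk {0} ?q (a, g + (u + f)) (a, g)"
      using walk_trans[OF p(2) walk_loop[OF walk_trans[OF w p(2)]]] .
    moreover have qj: "?q = N * ?j" by (rule loop_length) (use ae N_pos in simp)
    ultimately have "walk {0} (N * ?j) (a, g + (u + f)) (a, g)" by (simp only:)
    from walk_translate[OF this, of "- (u + f)"]
    have "walk {0} (N * ?j) (a, g + (u + f) + - (u + f)) (a, g + Bi ?j (- (u + f)))" by (simp only: Bi_eq)
    moreover have "g + (u + f) + - (u + f) = g" by simp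
    ultimately have w': "- Bi ?j (u + f) \<in> heights a g ?j"
      by (simp only: heights_def mem_Collect_eq Bi_simps)
    have "N * ?j > 0" unfolding qj[symmetric] using p(1) by simp
    then have "?j > 0" by (simp only: nat_0_less_mult_iff)
    moreover have "e dvd ?j" by (rule dvd_diff_nat[OF dvd_triv_left 1(2)])
    moreover have "- (Bi ?j (u + f) - (u + f)) - f \<in> ann (Cf 1)"
      by (rule subgrp_diff[OF sa subgrp_uminus[OF sa subsetD[OF range_D_ann Bi_diff_range]] 1(3)])
    moreover have "- u + (- (Bi ?j (u + f) - (u + f)) - f) = - Bi ?j (u + f)" by (simp add: algebra_simps)
    ultimately show ?thesis using w' by (simp only: P_def mem_Collect_eq)
        (intro exI[of _ ?j] conjI bexI[of _ "- (Bi ?j (u + f) - (u + f)) - f"]; simp only:)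
  qed
  have res: "\<exists>u\<in>P. \<exists>y. u = w + int r *s y" if r: "r > 0" for r w
  proof -
    obtain n u y where "n > 0" "e dvd n" "u \<in> heights a g n" "u = w + int r *s y"
      using heights_residues[OF fw[OF r]] ae by blast
    moreover have "0 \<in> ann (Cf 1)" using sa by (simp add: subgrp_def)
    ultimately have "u \<in> P" unfolding P_def by (intro CollectI exI[of _ n] conjI bexI[of _ 0]) simp_all
    then show ?thesis using \<open>u = w + int r *s y\<close> by blast
  qed
  have "\<exists>m>0. m *s x \<in> P"
  proof (rule multiple_in_subgroup)
    obtain u where "u \<in> P" using res[OF less_numeral_extra(1)] by blast
    then have "u + - u \<in> P" by (intro add neg)
    then have "0 \<in> P" by simp
    then show "subgrp P" using add neg by (simp add: subgrp_def)
    fix c assume c: "\<forall>y\<in>P. idot c y = 0"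
    \<comment> \<open>A multiple of \<open>r\<close> smaller than \<open>r\<close> in absolute value
      is 0.\<close>
    define r where "r = nat \<bar>idot c x\<bar> + 1"
    have "r > 0" by (simp add: r_def)
    then obtain u y where u: "u \<in> P" "u = x + int r *s y" using res[of r x] by blast
    then have "idot c x = - (int r * idot c y)" using c by auto
    then have "int r dvd idot c x" by simp
    then have "idot c x \<noteq> 0 \<Longrightarrow> int r \<le> \<bar>idot c x\<bar>" using dvd_imp_le_int[of "idot c x" "int r"] by simp
    then show "idot c x = 0" by (auto simp: r_def)
  qed
  then show "\<exists>m>0. \<exists>i>0. e dvd i \<and> (\<exists>f\<in>ann (Cf 1). m *s x + f \<in> heights a g i)"
    by (auto simp: P_def)
qed

end

lemma max_component:
  fixes x :: "real^'d"
  shows "\<exists>i. norm x \<le> real CARD('d) * \<bar>x $ i\<bar>"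
proof -
  have "Max (range (\<lambda>j. \<bar>x $ j\<bar>)) \<in> range (\<lambda>j. \<bar>x $ j\<bar>)" by (rule Max_in) auto
  then obtain i where "Max (range (\<lambda>j. \<bar>x $ j\<bar>)) = \<bar>x $ i\<bar>" by blast
  then have i: "\<bar>x $ j\<bar> \<le> \<bar>x $ i\<bar>" for j using Max_ge[of "range (\<lambda>j. \<bar>x $ j\<bar>)" "\<bar>x $ j\<bar>"] by simp
  have "norm x \<le> (\<Sum>j\<in>UNIV. \<bar>x $ j\<bar>)" by (rule norm_le_l1_cart)
  also have "\<dots> \<le> (\<Sum>j\<in>(UNIV :: 'd set). \<bar>x $ i\<bar>)" by (rule sum_mono) (rule i)
  finally show ?thesis by (intro exI[of _ i]) simp
qed

lemma infdist_lt_obtain: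
  assumes "A \<noteq> {}" "infdist x A < e" obtains a where "a \<in> A" "dist x a < e"
  using assms by (metis cINF_less_iff bdd_belowI2 infdist_notempty zero_le_dist)

context unipotent_skew
begin

subsection \<open>Birkhoff sums modulo the Fried subgroup\<close>

definition isum :: "(int \<Rightarrow> 'a) \<Rightarrow> nat \<Rightarrow> int^'d" where
  "isum s n = (\<Sum>i<n. gseq (\<lambda>j. s (j + int (N * i))) 0 N)"

lemma fried_sum_eq: "fried_sum A h N s n = rvec (isum s n)"
  by (simp add: fried_sum_def isum_def rvec_def iter_height_def gseq_def funpow_shift)

lemma isum_Suc: "isum s (Suc n) = isum s n + gseq (\<lambda>j. s (j + int (N * n))) 0 N"
  by (simp add: isum_def)

text \<open>Modulo \<open>range D\<close> the twist by \<open>mpow A N\<close> is trivial, so the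
  fibre coordinate of the orbit is the Birkhoff sum that defines the rotation vector.\<close>

lemma gseq_isum: "gseq s g (N * n) - g - isum s n \<in> range D"
proof (induction n)
  case 0 then show ?case using subgrp_0[OF subgrp_range_D] by (simp add: isum_def)
next
  case (Suc n)
  let ?x = "gseq s g (N * n)"
  have "gseq s g (N * Suc n) = gseq (\<lambda>j. s (j + int (N * n))) (0 + ?x) N"
    using gseq_add[of s g "N * n" N] by (simp add: add.commute)
  also have "\<dots> = gseq (\<lambda>j. s (j + int (N * n))) 0 N + mpow A N *v ?x" by (rule gseq_translate)
  finally have "gseq s g (N * Suc n) - g - isum s (Suc n) = (?x - g - isum s n) + D ?x"
    by (simp add: isum_Suc D_def)
  then show ?case using subgrp_add[OF subgrp_range_D Suc rangeI[of D ?x]] by (simp only:)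
qed

text \<open>The kernel of an integer functional is pure, and for an invariant one it contains the
  image of \<open>B - 1\<close>, hence the purification. So invariant functionals factor through the
  Fried quotient.\<close>

lemma fried_subset:
  assumes c: "c \<in> Cf 1" shows "fried (mpow A N) \<subseteq> {x. idot c x = 0}"
proof -
  have oi: "of_int n * x = n *s x" for n and x :: "int^'d"
  proof -
    have "(of_int n :: int^'d) $ i = n" for i by (induction n rule: int_induct[where k = 0]) auto
    then show ?thesis by (simp add: vec_eq_iff)
  qed
  have "Defs.pure {x. idot c x = 0}"
    by (auto simp: Defs.pure_def subgrp_def oi)
  moreover have "range (\<lambda>x. mpow A N *v x - x) \<subseteq> {x. idot c x = 0}"
    using c by (auto simp: Cf_1 D_def simp del: One_nat_def)
  ultimately show ?thesis unfolding fried_def purification_def by blast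
qed

lemma range_D_fried: "range D \<subseteq> fried (mpow A N)"
  unfolding fried_def purification_def by (auto simp: D_def)

lemma fried_space_subspace: "subspace (fried_space (mpow A N))"
  by (simp add: fried_space_def)

lemma range_D_fried_space: "x \<in> range D \<Longrightarrow> rvec x \<in> fried_space (mpow A N)"
  unfolding fried_space_def rvec_def[symmetric, abs_def]
  by (rule span_base) (use range_D_fried in auto)

lemma fried_space_orth:
  assumes c: "c \<in> Cf 1" and w: "w \<in> fried_space (mpow A N)" shows "rvec c \<bullet> w = 0"
proof -
  have "fried_space (mpow A N) \<subseteq> {w. rvec c \<bullet> w = 0}"
    unfolding fried_space_def rvec_def[symmetric, abs_def]
  proof (rule span_minimal)
    show "(\<lambda>x. rvec x) ` fried (mpow A N) \<subseteq> {w. rvec c \<bullet> w = 0}"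
      using fried_subset[OF c] by (auto simp: inner_rvec)
  qed (simp add: subspace_hyperplane)
  then show ?thesis using w by auto
qed

subsection \<open>A neighbourhood of zero of rotation vectors yields loops in all directions\<close>

text \<open>One walk is fixed for each of the finitely many pairs of states. The cost of closing up
  an orbit segment is then bounded independently of the length of the segment.\<close>

lemma connecting_heights:
  assumes fw: "free_walks (multiples 1)" and e: "e > 0"
  shows "\<exists>\<eta> p. \<forall>b b'. occ b \<and> occ b' \<longrightarrow> p b b' > 0 \<and> N * e dvd p b b' \<and> walk {0} (p b b') (b, 0) (b', \<eta> b b')"
proof -
  have "\<exists>\<eta> p. occ b \<and> occ b' \<longrightarrow> p > 0 \<and> N * e dvd p \<and> walk {0} p (b, 0) (b', \<eta>)" for b b'
  proof (cases "occ b \<and> occ b'")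
    case True
    have "N * e > 0" using e N_pos by simp
    then obtain p where p: "p > 0" "N * e dvd p" "walk (multiples 1) p (b, 0) (b', 0)"
      using fw[unfolded free_walks_def, rule_format, of "N * e" b b' 0 0] True by auto
    obtain \<gamma> where "walk {0} p (b, 0) (b', 0 + \<gamma>)" using walk_exact[OF good_multiples p(3)] by auto
    then show ?thesis using p by blast
  qed auto
  then show ?thesis by metis
qed

lemma Ap_N_dvd: assumes "c \<in> Cf 1" "N dvd p" shows "idot c (Ap p u) = idot c u"
proof -
  obtain k where "p = N * k" using assms(2) by blast
  then show ?thesis using invariant_functional_Bi[OF assms(1), of k u] by (simp add: Bi_eq)
qed

text \<open>A long orbit segment of a point with rotation vector \<open>v\<close> is closed up by
  two connecting walks. Its height per unit of time is \<open>v\<close> up to \<delta>, as far as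
  invariant functionals can see; \<open>K\<close> accounts for the connecting walks and is fixed
  before \<open>v\<close>, \<open>M\<close> and \<delta>.\<close>

lemma rotation_vector_loop:
  assumes fw: "free_walks (multiples 1)" and e: "e > 0" and a: "occ a"
  obtains K where "K \<ge> 0" "\<And>v M \<delta>. v \<in> rot_F_lift C A h N \<Longrightarrow> \<delta> > 0 \<Longrightarrow>
    \<exists>j>0. \<exists>n\<ge>M. \<exists>y\<in>heights a g j. e dvd j \<and>
      (\<forall>z\<in>Cf 1. rvec z \<bullet> rvec y \<le> real n * (rvec z \<bullet> v + \<delta> * norm (rvec z)) + K * norm (rvec z))"
proof -
  obtain \<eta> p where \<eta>: "\<And>b b'. occ b \<Longrightarrow> occ b' \<Longrightarrow> p b b' > 0 \<and> N * e dvd p b b' \<and> walk {0} (p b b') (b, 0) (b', \<eta> b b')"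
    using connecting_heights[OF fw e] by metis
  define K0 where "K0 = (\<Sum>b\<in>UNIV. \<Sum>b'\<in>UNIV. norm (rvec (\<eta> b b')))"
  have K0: "norm (rvec (\<eta> b b')) \<le> K0" for b b'
  proof -
    have "norm (rvec (\<eta> b b')) \<le> (\<Sum>b'\<in>UNIV. norm (rvec (\<eta> b b')))" by (rule member_le_sum) auto
    also have "\<dots> \<le> K0" unfolding K0_def by (rule member_le_sum) (auto intro: sum_nonneg)
    finally show ?thesis .
  qed
  have "K0 \<ge> 0" unfolding K0_def by (intro sum_nonneg) auto
  show ?thesis
  proof (rule that[of "2 * K0"])
    show "0 \<le> 2 * K0" using \<open>K0 \<ge> 0\<close> by simp
    fix v :: "real^'d" and M :: nat and \<delta> :: real assume v: "v \<in> rot_F_lift C A h N" and \<delta>: "\<delta> > 0"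
    let ?V = "fried_space (mpow A N)"
    obtain s where s: "s \<in> SFT C" and lim: "(\<lambda>n. infdist ((1 / real n) *\<^sub>R fried_sum A h N s n - v) ?V) \<longlonglongrightarrow> 0"
      using v unfolding rot_F_lift_def by auto
    obtain n0 where n0: "\<And>n. n \<ge> n0 \<Longrightarrow> infdist ((1 / real n) *\<^sub>R fried_sum A h N s n - v) ?V < \<delta>"
      using LIMSEQ_D[OF lim \<delta>] infdist_nonneg by fastforce
    \<comment> \<open>A multiple of \<open>e\<close>, so that the length \<open>N * n\<close> of the
      segment is divisible by \<open>N * e\<close> like those of the connecting walks.\<close>
    define n where "n = e * (n0 + M + 1)"
    have "1 * (n0 + M + 1) \<le> n" unfolding n_def using e by (intro mult_le_mono1) simp
    then have n: "n \<ge> n0" "n \<ge> M" "n > 0" by auto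
    have "?V \<noteq> {}" using fried_space_subspace subspace_0 by blast
    then obtain w where w: "w \<in> ?V" "dist ((1 / real n) *\<^sub>R fried_sum A h N s n - v) w < \<delta>"
      using infdist_lt_obtain n0[OF n(1)] by metis
    have occs: "occ (s i)" for i using occ_point[OF s] .
    define p1 p2 \<eta>1 \<eta>2 where "p1 = p a (s 0)" and "p2 = p (s (int (N * n))) a"
      and "\<eta>1 = \<eta> a (s 0)" and "\<eta>2 = \<eta> (s (int (N * n))) a"
    have 1: "p1 > 0" "N * e dvd p1" "walk {0} p1 (a, 0) (s 0, \<eta>1)"
      using \<eta>[OF a occs[of 0]] by (simp_all add: p1_def \<eta>1_def)
    have 2: "p2 > 0" "N * e dvd p2" "walk {0} p2 (s (int (N * n)), 0) (a, \<eta>2)"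
      using \<eta>[OF occs[of "int (N * n)"] a] by (simp_all add: p2_def \<eta>2_def del: of_nat_mult)
    define g1 where "g1 = \<eta>1 + Ap p1 g"
    define g2 where "g2 = gseq s g1 (N * n)"
    define y where "y = \<eta>2 + Ap p2 g2 - g"
    have w1: "walk {0} p1 (a, g) (s 0, g1)" using walk_translate[OF 1(3), of g] by (simp add: g1_def)
    have "N * n > 0" using n N_pos by simp
    then have "walk {0} (N * n - 0) (s (int 0), g1) (s (int (N * n)), g2)"
      by (rule walk_along[OF good_zero s, of _ _ g1]) (simp_all add: g2_def)
    then have w2: "walk {0} (N * n) (s 0, g1) (s (int (N * n)), g2)" by simp
    have w3: "walk {0} p2 (s (int (N * n)), g2) (a, g + y)" using walk_translate[OF 2(3), of g2] by (simp add: y_def)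
    have walk_y: "walk {0} (p1 + N * n + p2) (a, g) (a, g + y)" using walk_trans[OF walk_trans[OF w1 w2] w3] .
    have "N * e dvd N * n" by (simp add: n_def)
    then have "N * e dvd p1 + N * n + p2" using 1 2 by (intro dvd_add) auto
    then obtain q where q: "p1 + N * n + p2 = N * e * q" by blast
    have "N * e * q > 0" unfolding q[symmetric] using 1(1) by simp
    then have "e * q > 0" by simp
    moreover have "y \<in> heights a g (e * q)" using walk_y q by (simp add: heights_def mult.assoc)
    moreover have "rvec z \<bullet> rvec y \<le> real n * (rvec z \<bullet> v + \<delta> * norm (rvec z)) + 2 * K0 * norm (rvec z)"
      if z: "z \<in> Cf 1" for z
    proof -
      have Nd: "N dvd p1" "N dvd p2" using 1 2 by auto
      obtain t where t: "g2 - g1 - isum s n = D t" using gseq_isum[of s g1 n] by (auto simp: g2_def)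
      have "idot z (g2 - g1 - isum s n) = 0" unfolding t using z by (simp add: Cf_1 del: One_nat_def)
      then have "idot z y = idot z \<eta>1 + idot z (isum s n) + idot z \<eta>2"
        by (simp add: y_def Ap_N_dvd[OF z Nd(1)] Ap_N_dvd[OF z Nd(2)] g1_def)
      then have zy: "rvec z \<bullet> rvec y = rvec z \<bullet> rvec \<eta>1 + rvec z \<bullet> rvec (isum s n) + rvec z \<bullet> rvec \<eta>2"
        by (simp add: inner_rvec)
      let ?q = "(1 / real n) *\<^sub>R rvec (isum s n) - v"
      \<comment> \<open>The distance is taken only modulo the Fried space; its nearby element
        \<open>w\<close> is invisible to the invariant functional \<open>z\<close>.\<close>
      have "rvec z \<bullet> ?q = rvec z \<bullet> (?q - w)" using fried_space_orth[OF z w(1)] by (simp add: inner_diff_right)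
      also have "\<dots> \<le> norm (rvec z) * norm (?q - w)" by (rule norm_cauchy_schwarz)
      also have "\<dots> \<le> norm (rvec z) * \<delta>" using w(2) by (intro mult_left_mono) (auto simp: dist_norm fried_sum_eq)
      finally have "rvec z \<bullet> rvec (isum s n) / real n \<le> rvec z \<bullet> v + \<delta> * norm (rvec z)"
        by (simp add: inner_diff_right mult.commute)
      then have "rvec z \<bullet> rvec (isum s n) \<le> real n * (rvec z \<bullet> v + \<delta> * norm (rvec z))"
        using n(3) by (simp add: divide_le_eq mult.commute)
      moreover have "rvec z \<bullet> rvec \<eta>1 \<le> K0 * norm (rvec z)" "rvec z \<bullet> rvec \<eta>2 \<le> K0 * norm (rvec z)"
        using norm_cauchy_schwarz[of "rvec z" "rvec \<eta>1"] norm_cauchy_schwarz[of "rvec z" "rvec \<eta>2"]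
          mult_left_mono[OF K0, of "norm (rvec z)" a "s 0"] mult_left_mono[OF K0, of "norm (rvec z)" "s (int (N * n))" a]
        by (simp_all add: \<eta>1_def \<eta>2_def mult.commute)
      ultimately show ?thesis unfolding zy by simp
    qed
    ultimately show "\<exists>j>0. \<exists>n\<ge>M. \<exists>y\<in>heights a g j. e dvd j \<and>
      (\<forall>z\<in>Cf 1. rvec z \<bullet> rvec y \<le> real n * (rvec z \<bullet> v + \<delta> * norm (rvec z)) + 2 * K0 * norm (rvec z))"
      using n(2) by (intro exI[of _ "e * q"] exI[of _ n] bexI[of _ y] conjI ballI) simp_all
  qed
qed

text \<open>Loops for the finitely many rotation vectors \<open>\<epsilon> / 2\<close> times plus or
  minus a unit vector suffice: for each \<open>z\<close>, the one opposite to its largest coordinate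
  descends.\<close>

lemma descent_loops:
  assumes fw: "free_walks (multiples 1)" and e: "e > 0" and a: "occ a"
    and int0: "0 \<in> interior (rot_F_lift C A h N)"
  shows "\<exists>Y. finite Y \<and> (\<forall>y\<in>Y. \<exists>j>0. e dvd j \<and> y \<in> heights a g j) \<and>
    (\<forall>z\<in>Cf 1. \<exists>y\<in>Y. rvec z \<bullet> rvec y \<le> - norm (rvec z))"
proof -
  obtain \<epsilon> where \<epsilon>: "\<epsilon> > 0" "ball 0 \<epsilon> \<subseteq> rot_F_lift C A h N" using int0 by (auto simp: mem_interior)
  obtain K where K: "K \<ge> 0" "\<And>v M \<delta>. v \<in> rot_F_lift C A h N \<Longrightarrow> \<delta> > 0 \<Longrightarrow>
    \<exists>j>0. \<exists>n\<ge>M. \<exists>y\<in>heights a g j. e dvd j \<and>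
      (\<forall>z\<in>Cf 1. rvec z \<bullet> rvec y \<le> real n * (rvec z \<bullet> v + \<delta> * norm (rvec z)) + K * norm (rvec z))"
    using rotation_vector_loop[OF fw e a] by blast
  \<comment> \<open>The largest coordinate of \<open>z\<close> is at least
    \<open>1 / CARD('d)\<close> of its norm, so the chosen vector has inner product at most
    \<open>- 2 * \<delta> * norm\<close> with \<open>z\<close>, and the error \<delta> uses up half
    of it.\<close>
  define \<delta> where "\<delta> = \<epsilon> / (4 * real CARD('d))"
  have \<delta>: "\<delta> > 0" using \<epsilon> by (simp add: \<delta>_def)
  \<comment> \<open>From time \<open>M\<close> on, the linear descent also absorbs the closing cost
    \<open>K\<close> and leaves at least one unit.\<close>
  obtain M :: nat where M: "(K + 1) / \<delta> \<le> real M" using real_arch_simple by blast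
  define v where "v = (\<lambda>(i, b). (if b then \<epsilon> / 2 else - \<epsilon> / 2) *\<^sub>R axis i 1 :: real^'d)"
  have vR: "v \<sigma> \<in> rot_F_lift C A h N" for \<sigma>
  proof -
    obtain i b where "\<sigma> = (i, b)" by (cases \<sigma>)
    then have "v \<sigma> \<in> ball 0 \<epsilon>" using \<epsilon>(1) by (simp add: v_def norm_axis_1)
    then show ?thesis using \<epsilon>(2) by blast
  qed
  have "\<exists>y. (\<exists>j>0. e dvd j \<and> y \<in> heights a g j) \<and> (\<exists>n\<ge>M. \<forall>z\<in>Cf 1. rvec z \<bullet> rvec y \<le>
      real n * (rvec z \<bullet> v \<sigma> + \<delta> * norm (rvec z)) + K * norm (rvec z))" for \<sigma>
    using K(2)[OF vR[of \<sigma>] \<delta>, of M] by metis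
  then obtain y where y: "\<And>\<sigma>. \<exists>j>0. e dvd j \<and> y \<sigma> \<in> heights a g j"
    "\<And>\<sigma>. \<exists>n\<ge>M. \<forall>z\<in>Cf 1. rvec z \<bullet> rvec (y \<sigma>) \<le> real n * (rvec z \<bullet> v \<sigma> + \<delta> * norm (rvec z)) + K * norm (rvec z)"
    by metis
  show ?thesis
  proof (intro exI[of _ "range y"] conjI ballI)
    show "finite (range y)" by simp
    show "\<exists>j>0. e dvd j \<and> u \<in> heights a g j" if "u \<in> range y" for u using y(1) that by auto
    fix z assume z: "z \<in> Cf 1"
    obtain i where i: "norm (rvec z) \<le> real CARD('d) * \<bar>rvec z $ i\<bar>" using max_component by blast
    define \<sigma> where "\<sigma> = (i, rvec z $ i \<le> 0)"
    have "rvec z \<bullet> v \<sigma> = - (\<epsilon> / 2) * \<bar>rvec z $ i\<bar>"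
      by (auto simp: \<sigma>_def v_def inner_axis)
    also have "\<dots> \<le> - 2 * \<delta> * norm (rvec z)"
    proof -
      have "2 * \<delta> * norm (rvec z) \<le> 2 * \<delta> * (real CARD('d) * \<bar>rvec z $ i\<bar>)"
        using i \<delta> by (intro mult_left_mono) auto
      also have "\<dots> = (\<epsilon> / 2) * \<bar>rvec z $ i\<bar>" by (simp add: \<delta>_def)
      finally show ?thesis by simp
    qed
    finally have zv: "rvec z \<bullet> v \<sigma> + \<delta> * norm (rvec z) \<le> - (\<delta> * norm (rvec z))" by simp
    obtain n where n: "n \<ge> M" "rvec z \<bullet> rvec (y \<sigma>) \<le> real n * (rvec z \<bullet> v \<sigma> + \<delta> * norm (rvec z)) + K * norm (rvec z)"
      using y(2)[of \<sigma>] z by blast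
    note n(2)
    also have "real n * (rvec z \<bullet> v \<sigma> + \<delta> * norm (rvec z)) \<le> real n * - (\<delta> * norm (rvec z))"
      by (intro mult_left_mono zv) simp
    also have "real n * - (\<delta> * norm (rvec z)) \<le> - ((K + 1) * norm (rvec z))"
    proof -
      have "(K + 1) / \<delta> \<le> real n" using M n(1) by linarith
      then have "K + 1 \<le> real n * \<delta>" using \<delta> by (simp add: divide_le_eq)
      then have "(K + 1) * norm (rvec z) \<le> real n * \<delta> * norm (rvec z)" by (intro mult_right_mono) auto
      then show ?thesis by (simp add: mult.assoc)
    qed
    finally have "rvec z \<bullet> rvec (y \<sigma>) \<le> - norm (rvec z)" by (simp add: algebra_simps)
    then show "\<exists>u\<in>range y. rvec z \<bullet> rvec u \<le> - norm (rvec z)" by blast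
  qed
qed

end

lemma descent_estimate:
  fixes p q n X T :: real
  assumes "p \<le> - n" "\<bar>q\<bar> \<le> n * X" "X \<le> T" "n \<ge> 0" "T \<ge> 0"
  shows "(T + 1) * p - q \<le> - n"
proof -
  have "T + 1 \<ge> 0" using assms(5) by simp
  then have "(T + 1) * p \<le> (T + 1) * - n" by (rule mult_left_mono[OF assms(1)])
  moreover have "n * X \<le> n * T" by (rule mult_left_mono[OF assms(3,4)])
  moreover have "(T + 1) * - n = - (n * T) - n" by (simp add: algebra_simps)
  ultimately show ?thesis using assms(2) by linarith
qed

context unipotent_skew
begin

text \<open>The walk \<open>u\<close> is steered by \<open>Y\<close> against the gradient of \<open>\<Phi> u = (\<Sum>c\<in>F. (idot c u)\<^sup>2)\<close>, which
  cannot decrease forever; hence the gradient is bounded infinitely often, and by the pigeonhole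
  principle two positions agree modulo the annihilator of the invariant functionals.\<close>
lemma descent_recurrence:
  fixes Y :: "(int^'d) set" and x :: "int^'d"
  assumes finY: "finite Y" and Y: "\<forall>z\<in>Cf 1. \<exists>y\<in>Y. rvec z \<bullet> rvec y \<le> - norm (rvec z)"
  shows "\<exists>m T ys. m > 0 \<and> T > 0 \<and> (\<forall>i :: nat. ys i \<in> Y) \<and> (\<Sum>i<m. int T *s ys i) - int m *s x \<in> ann (Cf 1)"
proof -
  obtain F where F: "finite F" "F \<subseteq> Cf 1" "\<And>c. (\<forall>b\<in>F. idot c b = 0) \<Longrightarrow> (\<forall>x\<in>Cf 1. idot c x = 0)"
    using finite_determining_subset[of "Cf 1"] by metis
  \<comment> \<open>Half the gradient of \<Phi>. As a combination of invariant functionals it is one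
    itself, so some element of \<open>Y\<close> descends against it.\<close>
  define grad where "grad u = (\<Sum>c\<in>F. idot c u *s c)" for u
  define \<Phi> where "\<Phi> u = idot (grad u) u" for u
  have idot_sum: "idot (\<Sum>c\<in>I. f c) w = (\<Sum>c\<in>I. idot (f c) w)" for I :: "(int^'d) set" and f :: "int^'d \<Rightarrow> int^'d" and w
    by (induction I rule: infinite_finite_induct) simp_all
  have grad_idot: "idot (grad u) w = (\<Sum>c\<in>F. idot c u * idot c w)" for u w
    by (simp add: grad_def idot_sum)
  have \<Phi>_eq: "\<Phi> u = (\<Sum>c\<in>F. (idot c u)\<^sup>2)" for u by (simp add: \<Phi>_def grad_idot power2_eq_square)
  have \<Phi>_nonneg: "\<Phi> u \<ge> 0" for u by (simp add: \<Phi>_eq sum_nonneg)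
  have \<Phi>_add: "\<Phi> (u + w) = \<Phi> u + 2 * idot (grad u) w + \<Phi> w" for u w
  proof -
    have "\<Phi> (u + w) = (\<Sum>c\<in>F. (idot c u)\<^sup>2 + (idot c w)\<^sup>2 + 2 * (idot c u * idot c w))"
      by (simp only: \<Phi>_eq idot_simps power2_sum mult.assoc)
    also have "\<dots> = (\<Sum>c\<in>F. (idot c u)\<^sup>2) + (\<Sum>c\<in>F. (idot c w)\<^sup>2) + 2 * (\<Sum>c\<in>F. idot c u * idot c w)"
      by (simp only: sum.distrib sum_distrib_left)
    finally show ?thesis unfolding \<Phi>_eq grad_idot by linarith
  qed
  have grad_Cf: "grad u \<in> Cf 1" for u
    unfolding Cf_1 grad_idot
  proof (intro allI sum.neutral ballI)
    fix v c assume "c \<in> F"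
    then have "c \<in> Cf 1" using F(2) by blast
    then have "idot c (D v) = 0" unfolding Cf_1 by (rule spec)
    then show "idot c u * idot c (D v) = 0" by simp
  qed
  define sel where "sel z = (SOME y. y \<in> Y \<and> rvec z \<bullet> rvec y \<le> - norm (rvec z))" for z
  have sel: "sel z \<in> Y \<and> rvec z \<bullet> rvec (sel z) \<le> - norm (rvec z)" if "z \<in> Cf 1" for z
    using bspec[OF Y that] unfolding sel_def Bex_def by (rule someI_ex)
  obtain T0 :: nat where T0: "norm (rvec x) \<le> real T0" using real_arch_simple by blast
  define T where "T = T0 + 1"
  \<comment> \<open>Subtracting \<open>x\<close> at every step makes a recurrence express a multiple
    of \<open>x\<close> through heights. Taking \<open>T\<close> copies of the height, with
    \<open>T\<close> exceeding the norm of \<open>x\<close> by at least 1, outweighs the drift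
    \<open>-x\<close>.\<close>
  define w where "w u = int T *s sel (grad u) - x" for u
  have w_desc: "real_of_int (idot (grad u) (w u)) \<le> - norm (rvec (grad u))" for u
  proof -
    let ?z = "rvec (grad u)"
    have "idot (grad u) (w u) = int T * idot (grad u) (sel (grad u)) - idot (grad u) x"
      unfolding w_def by simp
    then have "real_of_int (idot (grad u) (w u)) = real T * (?z \<bullet> rvec (sel (grad u))) - ?z \<bullet> rvec x"
      unfolding inner_rvec by simp
    also have "\<dots> \<le> - norm ?z"
      unfolding T_def of_nat_add of_nat_1
      by (rule descent_estimate[OF conjunct2[OF sel[OF grad_Cf]] Cauchy_Schwarz_ineq2 T0 norm_ge_zero of_nat_0_le_iff])
    finally show ?thesis .
  qed
  define M where "M = (\<Sum>y\<in>Y. \<Phi> (int T *s y - x))"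
  have M: "\<Phi> (w u) \<le> M" for u
  proof -
    have "sel (grad u) \<in> Y" using sel[OF grad_Cf] by (rule conjunct1)
    then show ?thesis unfolding M_def w_def
      by (rule member_le_sum[where f = "\<lambda>y. \<Phi> (int T *s y - x)"]) (simp_all add: \<Phi>_nonneg finY)
  qed
  have M0: "M \<ge> 0" by (simp add: M_def sum_nonneg \<Phi>_nonneg)
  define u where "u = rec_nat 0 (\<lambda>_ v. v + w v)"
  have u_Suc: "u (Suc n) = u n + w (u n)" for n by (simp add: u_def)
  have step: "real_of_int (\<Phi> (u (Suc n))) \<le> \<Phi> (u n) - 2 * norm (rvec (grad (u n))) + M" for n
  proof -
    have "real_of_int (\<Phi> (u (Suc n))) = \<Phi> (u n) + 2 * real_of_int (idot (grad (u n)) (w (u n))) + \<Phi> (w (u n))"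
      unfolding u_Suc \<Phi>_add by simp
    moreover have "real_of_int (\<Phi> (w (u n))) \<le> M" using M by simp
    ultimately show ?thesis using w_desc[of "u n"] by linarith
  qed
  \<comment> \<open>Outside \<open>I\<close> the potential \<Phi> drops by more than 1 in each step,
    which cannot go on forever for a nonnegative quantity.\<close>
  define I where "I = {n. norm (rvec (grad (u n))) \<le> M + 1}"
  have "infinite I"
  proof
    assume "finite I"
    then obtain n0 where n0: "\<forall>n\<in>I. n < n0" unfolding finite_nat_set_iff_bounded ..
    have "real_of_int (\<Phi> (u (n0 + k))) \<le> \<Phi> (u n0) - real k" for k
    proof (induction k)
      case (Suc k)
      have "n0 + k \<notin> I" using n0 by auto
      then have "norm (rvec (grad (u (n0 + k)))) > real_of_int M + 1" by (simp add: I_def)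
      moreover have "real_of_int M \<ge> 0" using M0 by simp
      moreover have "n0 + Suc k = Suc (n0 + k)" "real (Suc k) = real k + 1" by simp_all
      ultimately show ?case using step[of "n0 + k"] Suc by (simp only:)
    qed simp
    note this[of "nat (\<Phi> (u n0)) + 1"]
    also have "real_of_int (\<Phi> (u n0)) - real (nat (\<Phi> (u n0)) + 1) < 0" using \<Phi>_nonneg[of "u n0"] by simp
    finally show False using \<Phi>_nonneg[of "u (n0 + (nat (\<Phi> (u n0)) + 1))"] by linarith
  qed
  moreover have "finite ((\<lambda>n. grad (u n)) ` I)"
  proof (rule finite_subset)
    show "(\<lambda>n. grad (u n)) ` I \<subseteq> {z. \<forall>i. z $ i \<in> {- (M + 1)..M + 1}}"
    proof safe
      fix n i assume "n \<in> I"
      then have "\<bar>rvec (grad (u n)) $ i\<bar> \<le> M + 1"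
        using Finite_Cartesian_Product.norm_nth_le[of "rvec (grad (u n))" i] by (simp add: I_def)
      then have "real_of_int \<bar>grad (u n) $ i\<bar> \<le> real_of_int (M + 1)" by (simp add: rvec_def)
      then have "\<bar>grad (u n) $ i\<bar> \<le> M + 1" by (simp only: of_int_le_iff)
      then show "grad (u n) $ i \<in> {- (M + 1)..M + 1}" by auto
    qed
    show "finite {z :: int^'d. \<forall>i. z $ i \<in> {- (M + 1)..M + 1}}" by (rule finite_bounded_lattice) simp
  qed
  ultimately have "\<not> inj_on (\<lambda>n. grad (u n)) I" using finite_imageD by blast
  then obtain a b where "a \<noteq> b" "grad (u a) = grad (u b)" unfolding inj_on_def by blast
  then obtain a b where ab: "a < b" "grad (u a) = grad (u b)"
    by (metis linorder_neqE_nat)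
  \<comment> \<open>\<open>grad\<close> is linear, so equal gradients at two times give gradient 0
    at the difference; there \<Phi> vanishes, and with it every invariant functional.\<close>
  define v where "v = u b - u a"
  have "grad v = grad (u b) - grad (u a)"
    by (simp add: grad_def v_def vector_sub_rdistrib sum_subtractf)
  then have "grad v = 0" using ab by simp
  then have "\<Phi> v = 0" by (simp add: \<Phi>_def)
  then have "\<forall>c\<in>F. idot c v = 0" unfolding \<Phi>_eq by (subst (asm) sum_nonneg_eq_0_iff) (use F(1) in auto)
  then have "\<forall>c\<in>Cf 1. idot v c = 0" using F(3)[of v] by (simp add: idot_commute)
  then have v: "v \<in> ann (Cf 1)" by (simp add: ann_def idot_commute)
  define ys where "ys i = sel (grad (u (a + i)))" for i
  have u_sum: "u (a + k) - u a = (\<Sum>i<k. int T *s ys i) - int k *s x" for k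
  proof (induction k)
    case 0 then show ?case by (simp add: vec_eq_iff)
  next
    case (Suc k)
    have "u (a + Suc k) - u a = (u (a + k) - u a) + w (u (a + k))" by (simp add: u_Suc)
    also have "\<dots> = (\<Sum>i<k. int T *s ys i) - int k *s x + (int T *s ys k - x)"
      unfolding Suc by (simp add: w_def ys_def)
    also have "\<dots> = (\<Sum>i<Suc k. int T *s ys i) - int (Suc k) *s x"
      by (simp add: vec_eq_iff algebra_simps)
    finally show ?case .
  qed
  have "a + (b - a) = b" using ab(1) by simp
  with u_sum[of "b - a"] v have "(\<Sum>i<b - a. int T *s ys i) - int (b - a) *s x \<in> ann (Cf 1)"
    by (simp add: v_def)
  moreover have "\<forall>i. ys i \<in> Y" using conjunct1[OF sel[OF grad_Cf]] by (simp add: ys_def)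
  moreover have "b - a > 0" "T > 0" using ab(1) by (simp_all add: T_def)
  ultimately show ?thesis by (intro exI[of _ "b - a"] exI[of _ T] exI[of _ ys] conjI)
qed

lemma rotation_imp_abelian_heights:
  assumes fw: "free_walks (multiples 1)" and int0: "0 \<in> interior (rot_F_lift C A h N)"
  shows "abelian_heights"
  unfolding abelian_heights_def
proof (intro allI impI)
  fix a g and e :: nat and x assume ae: "occ a \<and> e > 0"
  then have a: "occ a" and e: "e > 0" by auto
  obtain Y where Y: "finite Y" "\<forall>y\<in>Y. \<exists>j>0. e dvd j \<and> y \<in> heights a g j"
    "\<forall>z\<in>Cf 1. \<exists>y\<in>Y. rvec z \<bullet> rvec y \<le> - norm (rvec z)"
    using descent_loops[OF fw e a int0, of g] by (elim exE conjE)
  obtain m T ys where m: "m > 0" "T > 0" "\<forall>i :: nat. ys i \<in> Y"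
    "(\<Sum>i<m. int T *s ys i) - int m *s x \<in> ann (Cf 1)"
    using descent_recurrence[OF Y(1,3), of x] by (elim exE conjE)
  define P where "P = {u. \<exists>j>0. e dvd j \<and> (\<exists>f\<in>ann (Cf 1). u + f \<in> heights a g j)}"
  have add: "u + v \<in> P" if "u \<in> P" "v \<in> P" for u v
    using that unfolding P_def by (rule heights_mod_ann_add)
  have YP: "y \<in> P" if y: "y \<in> Y" for y
  proof -
    obtain j where "j > 0" "e dvd j" "y \<in> heights a g j" using bspec[OF Y(2) y] by (elim exE conjE)
    then show ?thesis unfolding P_def mem_Collect_eq
      by (intro exI[of _ j] conjI bexI[of _ 0]) (simp_all add: subgrp_0[OF subgrp_ann] del: One_nat_def)
  qed
  have mult: "int n *s u \<in> P" if "n > 0" "u \<in> P" for n u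
    using that(1)
  proof (induction n rule: nat_induct_non_zero)
    case 1 then show ?case using that by simp
  next
    case (Suc n)
    have "int (Suc n) *s u = int n *s u + u" by (simp add: vec_eq_iff algebra_simps)
    then show ?case using add[OF Suc.IH that(2)] by (simp only:)
  qed
  have "(\<Sum>i<k. int T *s ys i) \<in> P" if "k > 0" for k using that
  proof (induction k rule: nat_induct_non_zero)
    case 1 then show ?case using mult[OF m(2) YP[OF spec[OF m(3), of 0]]] by simp
  next
    case (Suc k)
    then show ?case using add[OF Suc.IH mult[OF m(2) YP[OF spec[OF m(3), of k]]]] by simp
  qed
  from this[OF m(1)] have "\<exists>j>0. e dvd j \<and> (\<exists>f\<in>ann (Cf 1). (\<Sum>i<m. int T *s ys i) + f \<in> heights a g j)"
    by (simp only: P_def mem_Collect_eq)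
  then obtain j f where j: "j > 0" "e dvd j" "f \<in> ann (Cf 1)" "(\<Sum>i<m. int T *s ys i) + f \<in> heights a g j"
    by (elim exE conjE bexE)
  let ?f = "(\<Sum>i<m. int T *s ys i) - int m *s x + f"
  have "?f \<in> ann (Cf 1)" by (rule subgrp_add[OF subgrp_ann m(4) j(3)])
  moreover have "int m *s x + ?f = (\<Sum>i<m. int T *s ys i) + f" by simp
  then have "int m *s x + ?f \<in> heights a g j" using j(4) by (simp only:)
  moreover have "int m > 0" using m(1) by simp
  ultimately show "\<exists>m>0. \<exists>i>0. e dvd i \<and> (\<exists>f\<in>ann (Cf 1). m *s x + f \<in> heights a g i)"
    using j(1,2) by (intro exI[of _ "int m"] exI[of _ j] conjI bexI[of _ ?f])
qed

end

section \<open>Realising small vectors as rotation vectors\<close>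

text \<open>Beyond radius \<open>4 * k\<close> the descent term \<open>2 * (E \<bullet> w)\<close>
  is at most -4 and pays for the square of the step; inside, one step adds at most 2.\<close>

lemma bounded_steering:
  fixes E w :: "'b::real_inner"
  assumes w: "norm w \<le> 2" and desc: "E \<bullet> w \<le> - norm E / (2 * k)" and k: "k > 0"
    and E: "norm E \<le> 4 * k + 2"
  shows "norm (E + w) \<le> 4 * k + 2"
proof (cases "norm E \<ge> 4 * k")
  case True
  have "(norm (E + w))\<^sup>2 = (norm E)\<^sup>2 + 2 * (E \<bullet> w) + (norm w)\<^sup>2"
    by (simp add: power2_norm_eq_inner inner_add_left inner_add_right inner_commute)
  moreover have "(norm w)\<^sup>2 \<le> 2\<^sup>2" by (rule power_mono[OF w]) simp
  moreover have "2 * (E \<bullet> w) \<le> - 4"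
  proof -
    have "norm E / (2 * k) \<ge> 4 * k / (2 * k)" using True k by (intro divide_right_mono) auto
    then have "norm E / (2 * k) \<ge> 2" using k by simp
    then show ?thesis using desc by simp
  qed
  ultimately have "(norm (E + w))\<^sup>2 \<le> (norm E)\<^sup>2" by simp
  then have "norm (E + w) \<le> norm E" by (rule power2_le_imp_le) simp
  then show ?thesis using E by linarith
next
  case False
  then show ?thesis using norm_triangle_ineq[of E w] w by linarith
qed

context unipotent_skew
begin

lemma gseq_bounded: "\<exists>H\<ge>0. \<forall>s. norm (rvec (gseq s 0 n)) \<le> H"
proof -
  have "finite (range (\<lambda>s. gseq s 0 n))"
  proof (induction n)
    case (Suc n)
    have "range (\<lambda>s. gseq s 0 (Suc n)) \<subseteq> (\<lambda>(x, b, b'). A *v x + h b b') ` (range (\<lambda>s. gseq s 0 n) \<times> UNIV)"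
    proof (rule image_subsetI)
      fix s
      show "gseq s 0 (Suc n) \<in> (\<lambda>(x, b, b'). A *v x + h b b') ` (range (\<lambda>s. gseq s 0 n) \<times> UNIV)"
        by (rule image_eqI[of _ _ "(gseq s 0 n, s (int n), s (int n + 1))"]) (simp_all add: gseq_Suc)
    qed
    moreover have "finite (range (\<lambda>s. gseq s 0 n) \<times> (UNIV :: ('a \<times> 'a) set))" using Suc by simp
    ultimately show ?case using finite_surj by blast
  qed simp
  then have fin: "finite ((\<lambda>x. norm (rvec x)) ` range (\<lambda>s. gseq s 0 n))" by simp
  have le: "norm (rvec (gseq s 0 n)) \<le> Max ((\<lambda>x. norm (rvec x)) ` range (\<lambda>s. gseq s 0 n))" for s
    by (rule Max_ge[OF fin]) blast
  then have "0 \<le> Max ((\<lambda>x. norm (rvec x)) ` range (\<lambda>s. gseq s 0 n))"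
    using norm_ge_zero order_trans by blast
  with le show ?thesis by blast
qed

lemma isum_increment:
  assumes "\<forall>s. norm (rvec (gseq s 0 N)) \<le> H"
  shows "norm (rvec (isum s (m + k) - isum s m)) \<le> real k * H"
proof (induction k)
  case (Suc k)
  let ?g = "gseq (\<lambda>j. s (j + int (N * (m + k)))) 0 N"
  have "isum s (m + Suc k) - isum s m = (isum s (m + k) - isum s m) + ?g" by (simp add: isum_Suc)
  then have "norm (rvec (isum s (m + Suc k) - isum s m)) \<le> norm (rvec (isum s (m + k) - isum s m)) + norm (rvec ?g)"
    using norm_triangle_ineq by (metis rvec_simps(1))
  also have "\<dots> \<le> real k * H + H" using Suc assms by (intro add_mono) auto
  finally show ?case by (simp add: algebra_simps)
qed simp

lemma concatenate_blocks:
  assumes M: "M > 0" and F0: "\<forall>\<sigma>. F \<sigma> 0 = (a, 0)" and FM: "\<forall>\<sigma>. F \<sigma> M = (a, tgt \<sigma>)"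
    and Fs: "\<forall>\<sigma>. \<forall>i<M. step {0} (F \<sigma> i) (F \<sigma> (Suc i))"
  shows "\<exists>s\<in>SFT C. \<forall>t. gseq (\<lambda>i. s (i + int (M * t))) 0 M = tgt (\<sigma> t :: 'c)"
proof -
  \<comment> \<open>For negative \<open>i\<close> the block number \<open>nat (i div int M)\<close>
    is 0, so the block of \<open>\<sigma> 0\<close> is repeated into the past.\<close>
  define s where "s i = fst (F (\<sigma> (nat (i div int M))) (nat (i mod int M)))" for i
  \<comment> \<open>The case \<open>j = M\<close> is included: at a seam the end of one block and
    the beginning of the next are both at state \<open>a\<close>.\<close>
  have s_val: "s (q * int M + int j) = fst (F (\<sigma> (nat q)) j)" if "j \<le> M" for q j
  proof (cases "j = M")
    case True
    then have "q * int M + int j = (q + 1) * int M" by (simp add: algebra_simps)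
    then show ?thesis using True M F0 FM by (simp add: s_def)
  next
    case False
    then show ?thesis using that by (simp add: s_def)
  qed
  have "s \<in> SFT C" unfolding SFT_def mem_Collect_eq
  proof
    fix i
    define q j where "q = i div int M" and "j = nat (i mod int M)"
    have j: "j < M" using M by (simp add: j_def nat_less_iff)
    have i: "i = q * int M + int j" using M by (simp add: q_def j_def)
    then have i1: "i + 1 = q * int M + int (Suc j)" by simp
    have "s i = fst (F (\<sigma> (nat q)) j)" by (subst i, rule s_val) (use j in simp)
    moreover have "s (i + 1) = fst (F (\<sigma> (nat q)) (Suc j))" unfolding i1 by (rule s_val) (use j in simp)
    ultimately have "s i = fst (F (\<sigma> (nat q)) j)" "s (i + 1) = fst (F (\<sigma> (nat q)) (Suc j))" by simp_all
    then show "C (s i) (s (i + 1))" using Fs j by (simp add: step_def)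
  qed
  moreover have "gseq (\<lambda>i. s (i + int (M * t))) 0 M = tgt (\<sigma> t)" for t
  proof -
    have v: "s (int j + int (M * t)) = fst (F (\<sigma> t) j)" if "j \<le> M" for j
      using s_val[OF that, of "int t"] by (simp add: algebra_simps)
    have "j \<le> M \<Longrightarrow> gseq (\<lambda>i. s (i + int (M * t))) 0 j = snd (F (\<sigma> t) j)" for j
    proof (induction j)
      case 0 then show ?case using F0 by simp
    next
      case (Suc j)
      have "step {0} (F (\<sigma> t) j) (F (\<sigma> t) (Suc j))" using Fs Suc.prems by simp
      moreover have "s (int j + 1 + int (M * t)) = fst (F (\<sigma> t) (Suc j))"
        using v[OF Suc.prems] by (simp add: algebra_simps)
      ultimately show ?case using Suc v[of j] by (simp add: gseq_Suc step_def)
    qed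
    from this[of M] show ?thesis using FM by simp
  qed
  ultimately show ?thesis by blast
qed

text \<open>Loops with heights plus or minus a unit vector and one common length are concatenated,
  each time choosing the one that best reduces the discrepancy to the prescribed motion. Bounded
  discrepancy gives the rotation vector \<open>v\<close>.\<close>

lemma free_walks_imp_rotation_interior:
  assumes fw: "free_walks {0}" and a: "occ a"
  shows "0 \<in> interior (rot_F_lift C A h N)"
proof -
  define k where "k = real CARD('d)"
  have k: "k \<ge> 1" using zero_less_card_finite[where 'a = 'd] by (simp add: k_def)
  define tgt where "tgt = (\<lambda>(i, b). axis i (if b then 1 else - 1) :: int^'d)"
  have rtgt: "rvec (tgt (i, b)) = (if b then 1 else - 1) *\<^sub>R axis i 1" for i b
    by (simp add: tgt_def rvec_def vec_eq_iff axis_def)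
  have ntgt: "norm (rvec (tgt \<sigma>)) = 1" for \<sigma>
    by (cases \<sigma>) (simp add: rtgt norm_axis_1)
  have "\<forall>\<sigma>. \<exists>n0. \<forall>n\<ge>n0. walk {0} n (a, 0) (a, tgt \<sigma>)" using free_walks_eventually[OF fw a a] by blast
  then obtain nf where nf: "\<forall>\<sigma>. \<forall>n\<ge>nf \<sigma>. walk {0} n (a, 0) (a, tgt \<sigma>)" by (rule choice[THEN exE])
  \<comment> \<open>All large lengths occur for each of the finitely many targets, so one length
    \<open>N * L\<close> serves them all.\<close>
  define L where "L = (\<Sum>\<sigma>\<in>UNIV. nf \<sigma>) + 1"
  have L: "L > 0" by (simp add: L_def)
  have "1 * L \<le> N * L" using N_pos by (intro mult_le_mono1) simp
  moreover have "nf \<sigma> \<le> L" for \<sigma>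
    using member_le_sum[of \<sigma> UNIV nf] by (simp add: L_def)
  ultimately have "nf \<sigma> \<le> N * L" for \<sigma> by (metis mult_1 order_trans)
  then have "\<forall>\<sigma>. walk {0} (N * L) (a, 0) (a, tgt \<sigma>)" using nf by simp
  then have "\<forall>\<sigma>. \<exists>f. f 0 = (a, 0) \<and> f (N * L) = (a, tgt \<sigma>) \<and> (\<forall>i<N * L. step {0} (f i) (f (Suc i)))"
    unfolding walk_def relpowp_fun_conv .
  then obtain F where F: "\<forall>\<sigma>. F \<sigma> 0 = (a, 0) \<and> F \<sigma> (N * L) = (a, tgt \<sigma>) \<and> (\<forall>i<N * L. step {0} (F \<sigma> i) (F \<sigma> (Suc i)))"
    by (rule choice[THEN exE])
  obtain H where H: "H \<ge> 0" "\<forall>s. norm (rvec (gseq s 0 N)) \<le> H" using gseq_bounded[of N] by (elim exE conjE)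
  \<comment> \<open>The best target gains \<open>norm E / k\<close> against \<open>E\<close>; for
    \<open>norm v < r\<close> the prescribed motion \<open>L v\<close> costs at most half of
    that.\<close>
  define r where "r = 1 / (2 * k * real L)"
  have r: "r > 0" using k L by (simp add: r_def)
  have "v \<in> rot_F_lift C A h N" if v: "norm v < r" for v :: "real^'d"
  proof -
    have Lv: "real L * norm v \<le> 1 / (2 * k)"
    proof -
      have "real L * norm v \<le> real L * r" using v by (intro mult_left_mono) auto
      then show ?thesis using L by (simp add: r_def)
    qed
    have inv1: "1 / (2 * k) \<le> 1" using k by simp
    have "\<exists>\<sigma>. E \<bullet> (rvec (tgt \<sigma>) - real L *\<^sub>R v) \<le> - norm E / (2 * k)" for E
    proof -
      obtain i where i: "norm E \<le> k * \<bar>E $ i\<bar>" using max_component unfolding k_def by blast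
      let ?\<sigma> = "(i, E $ i \<le> 0)"
      have "E \<bullet> rvec (tgt ?\<sigma>) = - \<bar>E $ i\<bar>" by (auto simp: rtgt inner_axis)
      moreover have "\<bar>E $ i\<bar> \<ge> norm E / k" using i k by (simp add: divide_le_eq mult.commute)
      moreover have "- (E \<bullet> (real L *\<^sub>R v)) \<le> norm E / (2 * k)"
      proof -
        have "- (E \<bullet> (real L *\<^sub>R v)) \<le> norm E * norm (real L *\<^sub>R v)"
          using Cauchy_Schwarz_ineq2[of E "real L *\<^sub>R v"] by linarith
        also have "\<dots> \<le> norm E * (1 / (2 * k))" using Lv by (intro mult_left_mono) auto
        finally show ?thesis by simp
      qed
      moreover have "norm E / k = 2 * (norm E / (2 * k))" by simp
      ultimately have "E \<bullet> (rvec (tgt ?\<sigma>) - real L *\<^sub>R v) \<le> - (norm E / (2 * k))"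
        unfolding inner_diff_right by linarith
      then show ?thesis by (intro exI[of _ ?\<sigma>]) simp
    qed
    then have "\<forall>E. \<exists>\<sigma>. E \<bullet> (rvec (tgt \<sigma>) - real L *\<^sub>R v) \<le> - norm E / (2 * k)" by (rule allI)
    then obtain sel where sel: "\<forall>E. E \<bullet> (rvec (tgt (sel E)) - real L *\<^sub>R v) \<le> - norm E / (2 * k)"
      by (rule choice[THEN exE])
    \<comment> \<open>The discrepancy after \<open>t\<close> loops: the sum of their heights minus
      \<open>t L v\<close>.\<close>
    define E where "E = rec_nat 0 (\<lambda>_ E. E + (rvec (tgt (sel E)) - real L *\<^sub>R v))"
    have E_Suc: "E (Suc t) = E t + (rvec (tgt (sel (E t))) - real L *\<^sub>R v)" for t by (simp add: E_def)
    have E_bound: "norm (E t) \<le> 4 * k + 2" for t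
    proof (induction t)
      case 0 then show ?case using k by (simp add: E_def)
    next
      case (Suc t)
      have "norm (rvec (tgt (sel (E t))) - real L *\<^sub>R v) \<le> 1 + real L * norm v"
        using norm_triangle_ineq4[of "rvec (tgt (sel (E t)))" "real L *\<^sub>R v"] ntgt[of "sel (E t)"] by simp
      then have "norm (rvec (tgt (sel (E t))) - real L *\<^sub>R v) \<le> 2" using Lv inv1 by linarith
      then show ?case unfolding E_Suc using sel k Suc by (intro bounded_steering) auto
    qed
    define \<sigma> where "\<sigma> t = sel (E t)" for t
    have "N * L > 0" using N_pos L by simp
    from concatenate_blocks[OF this, of F a tgt \<sigma>] F obtain s where s: "s \<in> SFT C"
      "\<forall>t. gseq (\<lambda>i. s (i + int (N * L * t))) 0 (N * L) = tgt (\<sigma> t)" by blast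
    define S where "S t = (\<Sum>\<tau><t. tgt (\<sigma> \<tau>))" for t
    have gS: "gseq s 0 (N * L * t) - S t \<in> range D" for t
    proof (induction t)
      case 0 then show ?case using subgrp_0[OF subgrp_range_D] by (simp add: S_def)
    next
      case (Suc t)
      let ?x = "gseq s 0 (N * L * t)"
      have "gseq s 0 (N * L * Suc t) = gseq (\<lambda>i. s (i + int (N * L * t))) (0 + ?x) (N * L)"
        using gseq_add[of s 0 "N * L * t" "N * L"] by (simp add: add.commute)
      also have "\<dots> = tgt (\<sigma> t) + Bi L ?x" unfolding gseq_translate Bi_eq using s(2) by simp
      finally have "gseq s 0 (N * L * Suc t) - S (Suc t) = (?x - S t) + (Bi L ?x - ?x)" by (simp add: S_def)
      then show ?case using subgrp_add[OF subgrp_range_D Suc Bi_diff_range] by (simp only:)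
    qed
    have iS: "isum s (L * t) - S t \<in> range D" for t
    proof -
      have "isum s (L * t) - S t = (gseq s 0 (N * L * t) - S t) - (gseq s 0 (N * (L * t)) - 0 - isum s (L * t))"
        by (simp add: mult.assoc)
      then show ?thesis using subgrp_diff[OF subgrp_range_D gS gseq_isum] by (simp only:)
    qed
    have ES: "rvec (S t) = E t + real (L * t) *\<^sub>R v" for t
    proof (induction t)
      case 0 then show ?case by (simp add: S_def E_def)
    next
      case (Suc t)
      have "rvec (S (Suc t)) = rvec (S t) + rvec (tgt (\<sigma> t))" by (simp add: S_def)
      then show ?case unfolding Suc E_Suc \<sigma>_def by (simp add: algebra_simps)
    qed
    let ?V = "fried_space (mpow A N)"
    define K where "K = real L * H + (4 * k + 2) + real L * norm v"
    have bound: "infdist ((1 / real n) *\<^sub>R fried_sum A h N s n - v) ?V \<le> K * (1 / real n)" if n: "n > 0" for n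
    proof -
      define t \<rho> where "t = n div L" and "\<rho> = n mod L"
      have \<rho>: "n = L * t + \<rho>" "\<rho> \<le> L" using L by (simp_all add: t_def \<rho>_def less_imp_le)
      let ?w = "(1 / real n) *\<^sub>R rvec (isum s (L * t) - S t)"
      \<comment> \<open>The true Birkhoff sum differs from the sum of the targets by the accumulated
        twist, an element of \<open>range D\<close>, which the distance to the Fried space
        ignores.\<close>
      have "?w \<in> ?V" by (rule subspace_scale[OF fried_space_subspace range_D_fried_space[OF iS]])
      then have "infdist ((1 / real n) *\<^sub>R fried_sum A h N s n - v) ?V \<le> dist ((1 / real n) *\<^sub>R fried_sum A h N s n - v) ?w"
        by (rule infdist_le)
      also have "(1 / real n) *\<^sub>R fried_sum A h N s n - v - ?w =
          (1 / real n) *\<^sub>R (rvec (isum s n - isum s (L * t)) + E t - real \<rho> *\<^sub>R v)"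
      proof -
        have vn: "v = (1 / real n) *\<^sub>R (real n *\<^sub>R v)" using n by simp
        have "real n *\<^sub>R v = real (L * t) *\<^sub>R v + real \<rho> *\<^sub>R v"
          by (subst \<rho>(1)) (simp only: of_nat_add scaleR_add_left)
        then have "rvec (isum s n) - real n *\<^sub>R v - rvec (isum s (L * t) - S t) =
            rvec (isum s n - isum s (L * t)) + E t - real \<rho> *\<^sub>R v"
          by (simp add: ES)
        then show ?thesis
          by (subst (1) vn) (simp only: fried_sum_eq scaleR_diff_right[symmetric])
      qed
      then have "dist ((1 / real n) *\<^sub>R fried_sum A h N s n - v) ?w =
          norm (rvec (isum s n - isum s (L * t)) + E t - real \<rho> *\<^sub>R v) * (1 / real n)"
        unfolding dist_norm by simp
      also have "\<dots> \<le> K * (1 / real n)"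
      proof (rule mult_right_mono)
        have "norm (rvec (isum s n - isum s (L * t))) \<le> real \<rho> * H"
          using isum_increment[OF H(2), of s "L * t" \<rho>] unfolding \<rho>(1)[symmetric] .
        also have "\<dots> \<le> real L * H" using \<rho>(2) H(1) by (intro mult_right_mono) auto
        finally have 1: "norm (rvec (isum s n - isum s (L * t))) \<le> real L * H" .
        have 2: "norm (real \<rho> *\<^sub>R v) \<le> real L * norm v" using \<rho>(2) by (simp add: mult_right_mono)
        show "norm (rvec (isum s n - isum s (L * t)) + E t - real \<rho> *\<^sub>R v) \<le> K"
          unfolding K_def
          using norm_triangle_ineq4[of "rvec (isum s n - isum s (L * t)) + E t" "real \<rho> *\<^sub>R v"]
            norm_triangle_ineq[of "rvec (isum s n - isum s (L * t))" "E t"] 1 2 E_bound[of t] by linarith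
      qed simp
      finally show ?thesis .
    qed
    have "(\<lambda>n. infdist ((1 / real n) *\<^sub>R fried_sum A h N s n - v) ?V) \<longlonglongrightarrow> 0"
    proof (rule Lim_null_comparison)
      show "\<forall>\<^sub>F n in sequentially. norm (infdist ((1 / real n) *\<^sub>R fried_sum A h N s n - v) ?V) \<le> K * (1 / real n)"
        using eventually_gt_at_top[of 0] by eventually_elim (simp only: real_norm_def abs_of_nonneg[OF infdist_nonneg] bound)
      show "(\<lambda>n. K * (1 / real n)) \<longlonglongrightarrow> 0" by (rule tendsto_mult_right_zero[OF lim_1_over_n])
    qed
    then show ?thesis using s(1) unfolding rot_F_lift_def by blast
  qed
  then have "ball 0 r \<subseteq> rot_F_lift C A h N" by auto
  then show ?thesis using r by (auto simp: mem_interior)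
qed

end

section \<open>The equivalences\<close>

context skew_system
begin

lemma unipotent_power:
  assumes loops: "\<And>\<mu>. \<mu> \<in> cspec A \<Longrightarrow> norm \<mu> \<le> 1"
  shows "spec_radius A = 1" and "\<exists>d. unipotent_skew A A' (NA A) d"
proof -
  note rt = root_of_unity_spectrum[OF A_inverse(1) loops]
  have "norm ` cspec A = {1}" using rt(1) cspec_finite_nonempty[of A] by force
  then show "spec_radius A = 1" by (simp add: spec_radius_def)
  have "NA A > 0 \<and> cspec (mpow A (NA A)) = {1}"
    unfolding NA_def by (rule LeastI_ex) (rule rt(2))
  then obtain d where "\<forall>x. ((\<lambda>u. mpow A (NA A) *v u - u) ^^ d) x = 0" "NA A > 0"
    using cspec_unipotent by blast
  then have "unipotent_skew A A' (NA A) d" by unfold_locales auto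
  then show "\<exists>d. unipotent_skew A A' (NA A) d" by blast
qed

end

text \<open>All implications pass through \<open>free_walks {0}\<close>. Loops at every height bound
  the spectrum when total transitivity or dense periodic points are assumed; when the rotation set
  is assumed, the bound comes from the spectral radius.\<close>

theorem mainTheorem3:
  fixes C :: "'a::finite \<Rightarrow> 'a \<Rightarrow> bool"
    and A :: "int^'d^'d"
    and h :: "'a \<Rightarrow> 'a \<Rightarrow> int^'d"
  assumes det: "det A = 1 \<or> det A = -1"
    and nonempty: "SFT C \<noteq> {}"
    and base_trans: "top_transitive (SFT_top C) shift"
  shows "(totally_transitive (skew_top C) (skew A h)
            \<longleftrightarrow> (spec_radius A = 1 \<and> total_ftp C A h
                 \<and> 0 \<in> interior (rot_F_lift C A h (NA A))))
       \<and> (totally_transitive (skew_top C) (skew A h)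
            \<longleftrightarrow> (total_ftp C A h \<and> dense_periodic (skew_top C) (skew A h)))
       \<and> (totally_transitive (skew_top C) (skew A h)
            \<longleftrightarrow> top_mixing (skew_top C) (skew A h))"
proof -
  obtain A' where A': "A ** A' = mat 1" "A' ** A = mat 1" using int_matrix_inverse[OF det] by blast
  interpret skew_system C A A' h by unfold_locales (rule A')+
  obtain s where "s \<in> SFT C" using nonempty by blast
  then have a: "occ (s 0)" by (rule occ_point)
  let ?T = "totally_transitive (skew_top C) (skew A h)"
  have mix: "top_mixing (skew_top C) (skew A h)" if "free_walks {0}" using that by (rule free_walks_imp_mixing)
  have tt: "?T" if "free_walks {0}" using mixing_imp_totally_transitive[OF mix[OF that]] .
  have fw_loops: "\<exists>p>0. walk {0} p (s 0, g) (s 0, g)" if "free_walks {0}" for g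
    using that[unfolded free_walks_def, rule_format, OF less_numeral_extra(1), of "s 0" "s 0" g g] a by blast
  have 1: "spec_radius A = 1 \<and> total_ftp C A h \<and> 0 \<in> interior (rot_F_lift C A h (NA A))" if ?T
  proof -
    have fw: "free_walks {0}" using that by (rule totally_transitive_imp_free_walks)
    note le = loops_imp_spectrum_le_1[OF fw_loops[OF fw]]
    obtain d where us: "unipotent_skew A A' (NA A) d" using unipotent_power(2)[OF le] by blast
    interpret unipotent_skew C A A' h "NA A" d by (rule us)
    show ?thesis
      using unipotent_power(1)[OF le] totally_transitive_imp_total_ftp[OF that]
        free_walks_imp_rotation_interior[OF fw a] by (intro conjI)
  qed
  have 2: ?T if sr: "spec_radius A = 1" and ftp: "total_ftp C A h"
    and int0: "0 \<in> interior (rot_F_lift C A h (NA A))"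
  proof -
    have "norm \<mu> \<le> 1" if "\<mu> \<in> cspec A" for \<mu>
      unfolding sr[symmetric] spec_radius_def using that cspec_finite_nonempty(1)[of A] by (intro Max_ge) auto
    then obtain d where us: "unipotent_skew A A' (NA A) d" using unipotent_power(2) by blast
    interpret unipotent_skew C A A' h "NA A" d by (rule us)
    note fw = total_ftp_imp_free_walks[OF ftp]
    have "abelian_heights" using rotation_imp_abelian_heights[OF fw[OF less_numeral_extra(1)] int0] .
    from abelian_heights_imp_free_walks[OF fw this] show ?thesis by (rule tt)
  qed
  have 3: ?T if ftp: "total_ftp C A h" and dp: "dense_periodic (skew_top C) (skew A h)"
  proof -
    have sym: "symmetric_walks {0}" using dp by (rule dense_periodic_imp_symmetric_walks)
    have "\<exists>p>0. walk {0} p (s 0, g) (s 0, g)" for g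
      using sym[unfolded symmetric_walks_def, rule_format, of "s 0" "s 0" 0 g g] a by simp
    note le = loops_imp_spectrum_le_1[OF this]
    obtain d where us: "unipotent_skew A A' (NA A) d" using unipotent_power(2)[OF le] by blast
    interpret unipotent_skew C A A' h "NA A" d by (rule us)
    note fw = total_ftp_imp_free_walks[OF ftp]
    have "abelian_heights" using symmetric_walks_imp_abelian_heights[OF fw sym] .
    from abelian_heights_imp_free_walks[OF fw this] show ?thesis by (rule tt)
  qed
  have 4: "total_ftp C A h \<and> dense_periodic (skew_top C) (skew A h) \<and> top_mixing (skew_top C) (skew A h)" if ?T
    using totally_transitive_imp_total_ftp[OF that] free_walks_imp_dense_periodic mix
      totally_transitive_imp_free_walks[OF that] by blast
  show ?thesis using 1 2 3 4 mixing_imp_totally_transitive by blast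
qed

end
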